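(* There exist universal constants $\tilde C_4,\tilde C_5,\tilde C_6>0$ such that the following holds. Let $n\ge2$ and $1\le r\le n$, and let $\{p_i,w_i\}_{i=1}^N$ be an approximate $4$-design in $\mathbb{C}^n$ satisfying $$\Big\|\sum_{i=1}^N p_i w_iw_i^*-\tfrac1n\,\mathrm{id}\Big\|_\infty\le\frac1n$$ and having either operator norm accuracy $\theta_\infty\le \frac{1}{16r^2}$ or trace norm accuracy $\theta_1\le\frac14$. Let $m\ge\tilde C_4\,nr\log n$ be an integer, let $a_1,\dots,a_m\in\mathbb{C}^n$ be drawn independently from $\{p_i,w_i\}_{i=1}^N$ (each $a_j$ equals $w_i$ with probability $p_i$), set $A_j=\sqrt{n(n+1)}\,a_ja_j^*$, and let $\mathcal{A}:\mathcal{H}_n\to\mathbb{R}^m$ be the linear map $\mathcal{A}(Z)=\big(\mathrm{tr}(ZA_j)\big)_{j=1}^m$. Then with probability at least $1-e^{-\tilde C_5m}$ the following holds simultaneously for all $X\in\mathcal{H}_n$ of rank at most $r$, all $\eta\ge0$ and all $\epsilon\in\mathbb{R}^m$ with $\|\epsilon\|_{\ell_2}\le\eta$: setting $b=\mathcal{A}(X)+\epsilon$, any solution $X^\#$ of the convex optimization problem $$\underset{Z\in\mathcal{H}_n}{\text{minimize}}\ \|Z\|_1\quad\text{subject to}\quad \|\mathcal{A}(Z)-b\|_{\ell_2}\le\eta$$ satisfies $$\|X-X^\#\|_2\le\frac{\tilde C_6\,\eta}{\sqrt m}.$$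
   Context: $\mathcal{H}_n$ is the real vector space of Hermitian $n\times n$ complex matrices. $\|\cdot\|_p$ denotes the Schatten-$p$ norm: $\|Z\|_1$ is the nuclear (trace) norm, $\|Z\|_2$ the Frobenius norm, $\|Z\|_\infty$ the spectral (operator) norm. $\|\cdot\|_{\ell_2}$ is the Euclidean norm. "Universal" means that the constants do not depend on $n,r,m,N$, the approximate design, or any other parameter. Approximate $t$-design: a finite weighted set $\{p_i,w_i\}_{i=1}^N$ of vectors $w_i\in\mathbb{C}^n$ with $\|w_i\|_{\ell_2}=1$ and weights $p_i\ge0$, $\sum_ip_i=1$, is an approximate $t$-design of $p$-norm accuracy $\theta_p$ if $$\Big\|\sum_{i=1}^Np_i(w_iw_i^* )^{\otimes t}-\int_{\mathbb{C}P^{n-1}}(ww^* )^{\otimes t}\,\mathrm{d}w\Big\|_p\le\binom{n+t-1}{t}^{-1}\theta_p,$$ where the integral is with respect to the unique unitarily invariant probability measure on $\mathbb{C}P^{n-1}$ and the integrand is computed using any unit-norm representative $w\in\mathbb{C}^n$. Equivalently, the integral equals $\binom{n+t-1}{t}^{-1}P_{\mathrm{Sym}^t}$, where $P_{\mathrm{Sym}^t}$ is the orthogonal projector onto the totally symmetric subspace of $(\mathbb{C}^n)^{\otimes t}$. Operator norm accuracy is the case $p=\infty$, trace norm accuracy the case $p=1$. *)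

theory Defs
  imports
    "HOL-Probability.Probability"
    "HOL-Probability.Product_PMF"
    "Jordan_Normal_Form.Schur_Decomposition"
    "Jordan_Normal_Form.DL_Rank"
begin

unbundle no vec_syntax

definition hermitian_mats :: "nat \<Rightarrow> complex mat set" where
  "hermitian_mats n = {A \<in> carrier_mat n n. mat_adjoint A = A}"

definition unitary_mats :: "nat \<Rightarrow> complex mat set" where
  "unitary_mats n =
     {U \<in> carrier_mat n n. mat_adjoint U * U = 1\<^sub>m n \<and> U * mat_adjoint U = 1\<^sub>m n}"

definition mat_trace :: "'a::comm_monoid_add mat \<Rightarrow> 'a" where
  "mat_trace A = (\<Sum>i<dim_row A. A $$ (i, i))"

definition vec_l2_norm :: "'a::real_normed_vector vec \<Rightarrow> real" where
  "vec_l2_norm v = L2_set (\<lambda>i. norm (v $ i)) {..<dim_vec v}"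

text \<open>The multiset of singular values: square roots of the eigenvalues of \<open>A\<^sup>*A\<close>, repeated
  according to their multiplicity. These eigenvalues are real and nonnegative, so \<open>Re\<close> loses
  nothing.\<close>

definition singular_values :: "complex mat \<Rightarrow> real multiset" where
  "singular_values A =
     image_mset (\<lambda>z. sqrt (Re z)) (proots (char_poly (mat_adjoint A * A)))"

text \<open>Meaningful for \<open>1 \<le> p \<le> \<infinity>\<close>. The inserted \<open>0\<close> only matters for empty matrices.\<close>

definition schatten_norm :: "ereal \<Rightarrow> complex mat \<Rightarrow> real" where
  "schatten_norm p A =
     (if p = \<infinity> then Max (insert 0 (set_mset (singular_values A)))
      else (\<Sum>s\<in>#singular_values A. s powr real_of_ereal p) powr (1 / real_of_ereal p))"

text \<open>The matrix \<open>w w\<^sup>*\<close>.\<close>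

definition ket_bra :: "complex vec \<Rightarrow> complex mat" where
  "ket_bra w = mat (dim_vec w) (dim_vec w) (\<lambda>(i, j). w $ i * cnj (w $ j))"

definition kronecker_product :: "'a::times mat \<Rightarrow> 'a mat \<Rightarrow> 'a mat" where
  "kronecker_product A B =
     mat (dim_row A * dim_row B) (dim_col A * dim_col B)
       (\<lambda>(i, j). A $$ (i div dim_row B, j div dim_col B) * B $$ (i mod dim_row B, j mod dim_col B))"

primrec tensor_power :: "'a::semiring_1 mat \<Rightarrow> nat \<Rightarrow> 'a mat" where
  "tensor_power A 0 = 1\<^sub>m 1"
| "tensor_power A (Suc t) = kronecker_product A (tensor_power A t)"

text \<open>Weighted sums and integrals of \<open>k \<times> k\<close> matrices, taken entrywise.\<close>

definition weighted_mat_sum ::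
    "nat \<Rightarrow> nat \<Rightarrow> (nat \<Rightarrow> real) \<Rightarrow> (nat \<Rightarrow> complex mat) \<Rightarrow> complex mat" where
  "weighted_mat_sum k N p M =
     mat k k (\<lambda>(a, b). \<Sum>i<N. complex_of_real (p i) * M i $$ (a, b))"

definition mat_integral :: "nat \<Rightarrow> 'a measure \<Rightarrow> ('a \<Rightarrow> complex mat) \<Rightarrow> complex mat" where
  "mat_integral k \<mu> F = mat k k (\<lambda>(a, b). \<integral>x. F x $$ (a, b) \<partial>\<mu>)"

text \<open>A point of \<open>\<complex>P\<^bsup>n-1\<^esup>\<close>, i.e. a line spanned by a unit vector \<open>w\<close>, is represented by the
  orthogonal projector \<open>w w\<^sup>*\<close> onto it, which does not depend on the choice of \<open>w\<close>. A unitary \<open>U\<close>,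
  mapping the line of \<open>w\<close> to the line of \<open>U w\<close>, then acts by \<open>P \<mapsto> U P U\<^sup>*\<close>. The Borel sets are
  generated by the matrix entries.\<close>

definition proj_space :: "nat \<Rightarrow> complex mat set" where
  "proj_space n = {ket_bra w | w. w \<in> carrier_vec n \<and> vec_l2_norm w = 1}"

definition proj_space_borel :: "nat \<Rightarrow> complex mat measure" where
  "proj_space_borel n = sigma (proj_space n)
     {{P \<in> proj_space n. P $$ (i, j) \<in> B} | i j B. i < n \<and> j < n \<and> B \<in> sets borel}"

definition unitarily_invariant_prob :: "nat \<Rightarrow> complex mat measure \<Rightarrow> bool" where
  "unitarily_invariant_prob n \<mu> \<longleftrightarrow>
     prob_space \<mu> \<and> sets \<mu> = sets (proj_space_borel n) \<and>
     (\<forall>U\<in>unitary_mats n. distr \<mu> \<mu> (\<lambda>P. U * P * mat_adjoint U) = \<mu>)"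

definition weighted_unit_vectors ::
    "nat \<Rightarrow> nat \<Rightarrow> (nat \<Rightarrow> real) \<Rightarrow> (nat \<Rightarrow> complex vec) \<Rightarrow> bool" where
  "weighted_unit_vectors n N p w \<longleftrightarrow>
     (\<forall>i<N. w i \<in> carrier_vec n \<and> vec_l2_norm (w i) = 1 \<and> 0 \<le> p i) \<and> (\<Sum>i<N. p i) = 1"

text \<open>The argument \<open>q\<close> is the index of the Schatten norm in which the accuracy \<open>\<theta>\<close> is measured.
  For \<open>n \<ge> 1\<close> there is exactly one \<open>\<mu>\<close> with \<open>unitarily_invariant_prob n \<mu>\<close>.\<close>

definition approx_design ::
    "nat \<Rightarrow> nat \<Rightarrow> ereal \<Rightarrow> real \<Rightarrow> nat \<Rightarrow> (nat \<Rightarrow> real) \<Rightarrow> (nat \<Rightarrow> complex vec) \<Rightarrow> bool" where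
  "approx_design n t q \<theta> N p w \<longleftrightarrow>
     weighted_unit_vectors n N p w \<and>
     (\<exists>\<mu>. unitarily_invariant_prob n \<mu> \<and>
       schatten_norm q
         (weighted_mat_sum (n ^ t) N p (\<lambda>i. tensor_power (ket_bra (w i)) t)
          - mat_integral (n ^ t) \<mu> (\<lambda>P. tensor_power P t))
       \<le> inverse (real ((n + t - 1) choose t)) * \<theta>)"

text \<open>The law of a single draw, and of \<open>m\<close> independent draws \<open>a 0, \<dots>, a (m - 1)\<close>
  (with \<open>a j = 0\<close> for \<open>j \<ge> m\<close>).\<close>

definition design_pmf :: "nat \<Rightarrow> (nat \<Rightarrow> real) \<Rightarrow> (nat \<Rightarrow> complex vec) \<Rightarrow> complex vec pmf" where
  "design_pmf N p w = map_pmf w (embed_pmf (\<lambda>i. if i < N then p i else 0))"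

definition design_sample_pmf ::
    "nat \<Rightarrow> nat \<Rightarrow> nat \<Rightarrow> (nat \<Rightarrow> real) \<Rightarrow> (nat \<Rightarrow> complex vec) \<Rightarrow> (nat \<Rightarrow> complex vec) pmf" where
  "design_sample_pmf n m N p w = Pi_pmf {..<m} (0\<^sub>v n) (\<lambda>_. design_pmf N p w)"

definition meas_mat :: "nat \<Rightarrow> complex vec \<Rightarrow> complex mat" where
  "meas_mat n v = complex_of_real (sqrt (real n * (real n + 1))) \<cdot>\<^sub>m ket_bra v"

text \<open>The trace below is real for Hermitian \<open>Z\<close>; \<open>Re\<close> is only a coercion.\<close>

definition meas_map :: "nat \<Rightarrow> nat \<Rightarrow> (nat \<Rightarrow> complex vec) \<Rightarrow> complex mat \<Rightarrow> real vec" where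
  "meas_map n m a Z = vec m (\<lambda>j. Re (mat_trace (Z * meas_mat n (a j))))"

definition feasible_set ::
    "nat \<Rightarrow> nat \<Rightarrow> (nat \<Rightarrow> complex vec) \<Rightarrow> real vec \<Rightarrow> real \<Rightarrow> complex mat set" where
  "feasible_set n m a b \<eta> = {Z \<in> hermitian_mats n. vec_l2_norm (meas_map n m a Z - b) \<le> \<eta>}"

definition nuclear_norm_solutions ::
    "nat \<Rightarrow> nat \<Rightarrow> (nat \<Rightarrow> complex vec) \<Rightarrow> real vec \<Rightarrow> real \<Rightarrow> complex mat set" where
  "nuclear_norm_solutions n m a b \<eta> =
     {Y \<in> feasible_set n m a b \<eta>.
        \<forall>Z\<in>feasible_set n m a b \<eta>. schatten_norm 1 Y \<le> schatten_norm 1 Z}"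

end

theory Submission
  imports Defs
begin

text \<open>Every solution \<open>Y\<close> satisfies \<open>\<parallel>Y\<parallel>\<^sub>1 \<le> \<parallel>X\<parallel>\<^sub>1\<close>, which forces \<open>Z = Y - X\<close> into the cone
  \<open>\<parallel>Z\<parallel>\<^sub>1\<^sup>2 \<le> 6 r \<parallel>Z\<parallel>\<^sub>2\<^sup>2\<close>, while \<open>\<A>(Z)\<close> has norm at most \<open>2 \<eta>\<close>. So it suffices to bound \<open>\<A>\<close> from below
  on the cone, and this follows Mendelson's small ball method: the design has the second and fourth
  moments of the invariant measure up to constants, hence the truncated first moment of \<open>tr (Z A)\<close> is
  bounded below; the empirical means of the truncated variables deviate from it little, uniformly in
  \<open>Z\<close>. By the bounded differences inequality it is enough to control this deviation in expectation,
  which symmetrisation, contraction and the duality of \<open>\<parallel>\<cdot>\<parallel>\<^sub>1\<close> and \<open>\<parallel>\<cdot>\<parallel>\<^sub>\<infinity>\<close> reduce to the spectral norm of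
  a Rademacher sum of the \<open>A\<^sub>j\<close>. A noncommutative Khintchine inequality bounds the latter by the norm of
  \<open>\<Sum>\<^sub>j A\<^sub>j\<close>, whose expectation obeys a quadratic inequality by the same argument (Rudelson).\<close>

section \<open>Orthonormal bases and Hermitian forms\<close>

text \<open>The size of \<open>m\<close> is a balance in the last estimate. On the cone the nuclear
  norm is at most \<open>sqrt (6 * r)\<close>, and the Rademacher sum has norm of order
  \<open>sqrt (D * m)\<close> with \<open>D\<close> of order n log n; the product is a small
  multiple of \<open>m\<close> once \<open>m\<close> exceeds a multiple of n r log n. The logarithm
  is the moment order at which the dimension factor of the Khintchine bound becomes harmless. The
  near-tight frame condition keeps the norm of the sum of the measurement matrices of order
  \<open>m\<close> on average.

  Truncation at 1 meets two needs. Fourth moments alone give no exponential concentration, but the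
  truncated process moves by at most 1 per sample; and min |t| 1 is 1-Lipschitz in t, so contraction
  leads back to the linear process.

  Each \<open>Z\<close> is tested in its own eigenbasis. Hence only means of products of four
  squared overlaps with an orthonormal basis are compared with those of the invariant measure. These
  are determined by invariance under diagonal phases and rotations of coordinate planes, together
  with trace 1.\<close>

definition ip :: "nat \<Rightarrow> (nat \<Rightarrow> complex) \<Rightarrow> (nat \<Rightarrow> complex) \<Rightarrow> complex" where
  "ip n x y = (\<Sum>i<n. cnj (x i) * y i)"

definition sqn :: "nat \<Rightarrow> (nat \<Rightarrow> complex) \<Rightarrow> real" where
  "sqn n x = (\<Sum>i<n. (cmod (x i))\<^sup>2)"

text \<open>The second clause is completeness. Having it in the definition lets
  \<open>onb_expand\<close> read off expansions without a dimension count.\<close>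

definition onb :: "nat \<Rightarrow> (nat \<Rightarrow> nat \<Rightarrow> complex) \<Rightarrow> bool" where
  "onb n u \<longleftrightarrow> (\<forall>k<n. \<forall>l<n. ip n (u k) (u l) = (if k = l then 1 else 0)) \<and>
     (\<forall>i<n. \<forall>j<n. (\<Sum>k<n. u k i * cnj (u k j)) = (if i = j then 1 else 0))"

definition bform :: "nat \<Rightarrow> (nat \<Rightarrow> nat \<Rightarrow> complex) \<Rightarrow> (nat \<Rightarrow> complex) \<Rightarrow> (nat \<Rightarrow> complex) \<Rightarrow> complex" where
  "bform n A x y = (\<Sum>i<n. \<Sum>j<n. cnj (x i) * A i j * y j)"

definition herm :: "nat \<Rightarrow> (nat \<Rightarrow> nat \<Rightarrow> complex) \<Rightarrow> bool" where
  "herm n A \<longleftrightarrow> (\<forall>i<n. \<forall>j<n. A j i = cnj (A i j))"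

text \<open>A full spectral decomposition, with eigenvalues unordered and repeated by multiplicity.
  All Schatten norms of Hermitian matrices are read off from \<open>l\<close>, whichever
  decomposition is chosen.\<close>

definition eigsys :: "nat \<Rightarrow> (nat \<Rightarrow> nat \<Rightarrow> complex) \<Rightarrow> (nat \<Rightarrow> nat \<Rightarrow> complex) \<Rightarrow> (nat \<Rightarrow> real) \<Rightarrow> bool" where
  "eigsys n A u l \<longleftrightarrow> onb n u \<and> (\<forall>i<n. \<forall>j<n. A i j = (\<Sum>k<n. complex_of_real (l k) * u k i * cnj (u k j)))"

abbreviation qf :: "nat \<Rightarrow> (nat \<Rightarrow> nat \<Rightarrow> complex) \<Rightarrow> (nat \<Rightarrow> complex) \<Rightarrow> real" where
  "qf n A x \<equiv> Re (bform n A x x)"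

lemma onb_ip: "onb n u \<Longrightarrow> k < n \<Longrightarrow> l < n \<Longrightarrow> ip n (u k) (u l) = (if k = l then 1 else 0)"
  by (simp add: onb_def)

lemma onb_complete:
  "onb n u \<Longrightarrow> i < n \<Longrightarrow> j < n \<Longrightarrow> (\<Sum>k<n. u k i * cnj (u k j)) = (if i = j then 1 else 0)"
  by (simp add: onb_def)

lemma eigsys_onb: "eigsys n A u l \<Longrightarrow> onb n u"
  by (simp add: eigsys_def)

lemma cnj_mult_self: "cnj z * z = complex_of_real ((cmod z)\<^sup>2)" "z * cnj z = complex_of_real ((cmod z)\<^sup>2)"
  by (simp_all only: complex_norm_square mult.commute)

lemma ip_self: "ip n x x = complex_of_real (sqn n x)"
  by (simp only: ip_def sqn_def cnj_mult_self of_real_sum)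

lemma sqn_nonneg [simp]: "0 \<le> sqn n x"
  by (simp add: sqn_def sum_nonneg)

lemma ip_cnj: "cnj (ip n x y) = ip n y x"
  by (simp add: ip_def mult.commute)

lemma cmod_ip_commute: "cmod (ip n x y) = cmod (ip n y x)"
  by (metis complex_mod_cnj ip_cnj)

lemma ip_sum_left: "ip n (\<lambda>j. \<Sum>i\<in>I. a i * w i j) z = (\<Sum>i\<in>I. cnj (a i) * ip n (w i) z)"
proof -
  have "ip n (\<lambda>j. \<Sum>i\<in>I. a i * w i j) z = (\<Sum>j<n. \<Sum>i\<in>I. cnj (a i) * (cnj (w i j) * z j))"
    by (simp add: ip_def sum_distrib_right mult.assoc)
  also have "\<dots> = (\<Sum>i\<in>I. \<Sum>j<n. cnj (a i) * (cnj (w i j) * z j))" by (rule sum.swap)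
  finally show ?thesis by (simp add: ip_def sum_distrib_left)
qed

lemma ip_sum_right: "ip n z (\<lambda>j. \<Sum>i\<in>I. a i * w i j) = (\<Sum>i\<in>I. a i * ip n z (w i))"
proof -
  have "ip n z (\<lambda>j. \<Sum>i\<in>I. a i * w i j) = (\<Sum>j<n. \<Sum>i\<in>I. a i * (cnj (z j) * w i j))"
    by (simp add: ip_def sum_distrib_left mult_ac)
  also have "\<dots> = (\<Sum>i\<in>I. \<Sum>j<n. a i * (cnj (z j) * w i j))" by (rule sum.swap)
  finally show ?thesis by (simp add: ip_def sum_distrib_left)
qed

lemma ip_cong: "(\<And>i. i < n \<Longrightarrow> x i = x' i) \<Longrightarrow> (\<And>i. i < n \<Longrightarrow> y i = y' i) \<Longrightarrow> ip n x y = ip n x' y'"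
  by (simp add: ip_def)

lemma ip_scale_left: "ip n (\<lambda>j. c * x j) y = cnj c * ip n x y"
  by (simp add: ip_def sum_distrib_left mult_ac)

lemma ip_scale_right: "ip n x (\<lambda>j. c * y j) = c * ip n x y"
  by (simp add: ip_def sum_distrib_left mult_ac)

lemma onb_expand:
  assumes "onb n u" "i < n"
  shows "x i = (\<Sum>k<n. ip n (u k) x * u k i)"
proof -
  have "(\<Sum>k<n. ip n (u k) x * u k i) = (\<Sum>k<n. \<Sum>j<n. x j * (u k i * cnj (u k j)))"
    by (simp only: ip_def sum_distrib_right) (simp add: mult_ac)
  also have "\<dots> = (\<Sum>j<n. x j * (\<Sum>k<n. u k i * cnj (u k j)))"
    by (subst sum.swap) (simp add: sum_distrib_left)
  also have "\<dots> = (\<Sum>j<n. if i = j then x j else 0)"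
    using assms by (intro sum.cong) (auto simp: onb_complete)
  also have "\<dots> = x i" using assms by simp
  finally show ?thesis by simp
qed

lemma onb_parseval:
  assumes "onb n u"
  shows "ip n x y = (\<Sum>k<n. ip n x (u k) * ip n (u k) y)"
proof -
  have "ip n x y = ip n x (\<lambda>j. \<Sum>k<n. ip n (u k) y * u k j)"
    using onb_expand[OF assms] by (intro ip_cong) auto
  then show ?thesis unfolding ip_sum_right by (simp add: mult.commute)
qed

lemma onb_sqn:
  assumes "onb n u"
  shows "sqn n x = (\<Sum>k<n. (cmod (ip n (u k) x))\<^sup>2)"
proof -
  have "complex_of_real (sqn n x) = (\<Sum>k<n. ip n x (u k) * ip n (u k) x)"
    unfolding ip_self[symmetric] by (rule onb_parseval[OF assms])
  also have "\<dots> = (\<Sum>k<n. complex_of_real ((cmod (ip n (u k) x))\<^sup>2))"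
    by (intro sum.cong) (auto simp: complex_norm_square ip_cnj mult.commute simp del: of_real_power)
  finally have "complex_of_real (sqn n x) = complex_of_real (\<Sum>k<n. (cmod (ip n (u k) x))\<^sup>2)"
    by simp
  then show ?thesis using of_real_eq_iff by blast
qed

lemma onb_sqn1: "onb n u \<Longrightarrow> k < n \<Longrightarrow> sqn n (u k) = 1"
  using ip_self[of n "u k"] onb_ip[of n u k k] of_real_eq_1_iff by metis

text \<open>The rows of a product of two unitary matrices. This is how the spectral theorem carries
  a basis that diagonalises a transformed matrix back to the original one.\<close>

lemma onb_compose:
  assumes y: "onb n y" and w: "onb n w"
  shows "onb n (\<lambda>k j. \<Sum>i<n. y k i * w i j)"
  unfolding onb_def
proof (intro conjI allI impI)
  fix k l assume k: "k < n" and l: "l < n"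
  have "ip n (\<lambda>j. \<Sum>i<n. y k i * w i j) (\<lambda>j. \<Sum>i<n. y l i * w i j) =
     (\<Sum>i<n. cnj (y k i) * (\<Sum>i'<n. y l i' * (if i = i' then 1 else 0)))"
    unfolding ip_sum_left ip_sum_right using w by (intro sum.cong refl arg_cong2[of _ _ _ _ "(*)"]) (auto simp: onb_ip)
  also have "\<dots> = ip n (y k) (y l)" by (simp add: ip_def if_distrib cong: if_cong)
  finally show "ip n (\<lambda>j. \<Sum>i<n. y k i * w i j) (\<lambda>j. \<Sum>i<n. y l i * w i j) = (if k = l then 1 else 0)"
    using k l y by (simp add: onb_ip)
next
  fix i j assume i: "i < n" and j: "j < n"
  have "(\<Sum>k<n. (\<Sum>a<n. y k a * w a i) * cnj (\<Sum>a<n. y k a * w a j))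
      = (\<Sum>k<n. \<Sum>a<n. \<Sum>b<n. y k a * cnj (y k b) * (w a i * cnj (w b j)))"
    by (simp add: sum_product mult_ac)
  also have "\<dots> = (\<Sum>a<n. \<Sum>b<n. \<Sum>k<n. y k a * cnj (y k b) * (w a i * cnj (w b j)))"
    by (subst sum.swap, rule sum.cong[OF refl], rule sum.swap)
  also have "\<dots> = (\<Sum>a<n. \<Sum>b<n. (if a = b then 1 else 0) * (w a i * cnj (w b j)))"
    using y by (intro sum.cong refl) (auto simp: onb_complete sum_distrib_right[symmetric])
  also have "\<dots> = (\<Sum>a<n. w a i * cnj (w a j))"
    by (intro sum.cong refl) (simp add: if_distrib[of "\<lambda>z. z * _"] cong: if_cong)
  finally show "(\<Sum>k<n. (\<Sum>a<n. y k a * w a i) * cnj (\<Sum>a<n. y k a * w a j)) = (if i = j then 1 else 0)"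
    using i j w by (simp add: onb_complete)
qed

section \<open>Sesquilinear forms and eigensystems\<close>

lemma bform_ip: "bform n A x y = ip n x (\<lambda>i. \<Sum>j<n. A i j * y j)"
  by (simp add: bform_def ip_def sum_distrib_left mult.assoc)

lemma bform_cong:
  "(\<And>i j. i < n \<Longrightarrow> j < n \<Longrightarrow> A i j = A' i j) \<Longrightarrow> (\<And>i. i < n \<Longrightarrow> x i = x' i) \<Longrightarrow>
   (\<And>i. i < n \<Longrightarrow> y i = y' i) \<Longrightarrow> bform n A x y = bform n A' x' y'"
  by (simp add: bform_def)

lemma hermD: "herm n A \<Longrightarrow> i < n \<Longrightarrow> j < n \<Longrightarrow> cnj (A i j) = A j i"
  unfolding herm_def by metis

lemma bform_cnj:
  assumes "herm n A" shows "cnj (bform n A x y) = bform n A y x"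
proof -
  have "cnj (bform n A x y) = (\<Sum>i<n. \<Sum>j<n. cnj (y j) * A j i * x i)"
    unfolding bform_def cnj_sum using assms by (intro sum.cong refl) (simp add: hermD mult_ac)
  also have "\<dots> = bform n A y x" unfolding bform_def by (rule sum.swap)
  finally show ?thesis .
qed

lemma bform_real: "herm n A \<Longrightarrow> bform n A x x = complex_of_real (qf n A x)"
  using bform_cnj[of n A x x] by (simp add: complex_eq_iff)

lemma bform_sum_left: "bform n A (\<lambda>j. \<Sum>i\<in>I. a i * w i j) y = (\<Sum>i\<in>I. cnj (a i) * bform n A (w i) y)"
  by (simp add: bform_ip ip_sum_left)

lemma bform_sum_right: "bform n A x (\<lambda>j. \<Sum>i\<in>I. a i * w i j) = (\<Sum>i\<in>I. a i * bform n A x (w i))"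
proof -
  have "bform n A x (\<lambda>j. \<Sum>i\<in>I. a i * w i j)
     = ip n x (\<lambda>k. \<Sum>i\<in>I. a i * (\<Sum>j<n. A k j * w i j))"
    unfolding bform_ip
    by (intro ip_cong refl, simp only: sum_distrib_left, subst sum.swap, simp add: mult_ac)
  then show ?thesis by (simp add: ip_sum_right bform_ip)
qed

lemma eigsys_herm: "eigsys n A u l \<Longrightarrow> herm n A"
  by (simp add: eigsys_def herm_def mult_ac)

lemma eigsys_bform:
  assumes "eigsys n A u l"
  shows "bform n A x y = (\<Sum>k<n. complex_of_real (l k) * ip n x (u k) * ip n (u k) y)"
proof -
  have "bform n A x y = ip n x (\<lambda>i. \<Sum>k<n. (complex_of_real (l k) * ip n (u k) y) * u k i)"
    unfolding bform_ip
  proof (rule ip_cong[OF refl])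
    fix i assume i: "i < n"
    have "(\<Sum>j<n. A i j * y j) = (\<Sum>j<n. \<Sum>k<n. complex_of_real (l k) * u k i * (cnj (u k j) * y j))"
      using assms i by (intro sum.cong refl) (simp add: eigsys_def, simp add: sum_distrib_left mult_ac)
    also have "\<dots> = (\<Sum>k<n. (complex_of_real (l k) * ip n (u k) y) * u k i)"
      by (subst sum.swap) (simp add: ip_def sum_distrib_left mult_ac)
    finally show "(\<Sum>j<n. A i j * y j) = (\<Sum>k<n. (complex_of_real (l k) * ip n (u k) y) * u k i)" .
  qed
  then show ?thesis unfolding ip_sum_right by (simp add: mult_ac)
qed

lemma eigsys_bform_basis:
  assumes "eigsys n A u l" "k < n" "j < n"
  shows "bform n A (u k) (u j) = (if k = j then complex_of_real (l k) else 0)"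
proof -
  have "bform n A (u k) (u j) = (\<Sum>i<n. complex_of_real (l i) * (if k = i then 1 else 0) * (if i = j then 1 else 0))"
    unfolding eigsys_bform[OF assms(1)] using assms by (intro sum.cong) (auto simp: onb_ip eigsys_onb)
  also have "\<dots> = (\<Sum>i<n. if k = i then (if k = j then complex_of_real (l k) else 0) else 0)"
    by (intro sum.cong) auto
  also have "\<dots> = (if k = j then complex_of_real (l k) else 0)"
    using assms by simp
  finally show ?thesis .
qed

lemma eigsys_bform_left:
  assumes "eigsys n A u l" "k < n"
  shows "bform n A (u k) y = complex_of_real (l k) * ip n (u k) y"
proof -
  have "bform n A (u k) y = (\<Sum>i<n. if k = i then complex_of_real (l k) * ip n (u k) y else 0)"
    unfolding eigsys_bform[OF assms(1)] using assms by (intro sum.cong) (auto simp: onb_ip eigsys_onb)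
  then show ?thesis using assms by simp
qed

lemma eigsys_bform_right:
  assumes "eigsys n A u l" "k < n"
  shows "bform n A x (u k) = complex_of_real (l k) * ip n x (u k)"
proof -
  have "bform n A x (u k) = (\<Sum>i<n. if k = i then complex_of_real (l k) * ip n x (u k) else 0)"
    unfolding eigsys_bform[OF assms(1)] using assms by (intro sum.cong) (auto simp: onb_ip eigsys_onb)
  then show ?thesis using assms by simp
qed

lemma eigsys_qf:
  assumes "eigsys n A u l"
  shows "qf n A x = (\<Sum>k<n. l k * (cmod (ip n (u k) x))\<^sup>2)"
proof -
  have "bform n A x x = (\<Sum>k<n. complex_of_real (l k * (cmod (ip n (u k) x))\<^sup>2))"
    unfolding eigsys_bform[OF assms] 
    by (intro sum.cong refl) (simp only: ip_cnj[of n "u _" x, symmetric] of_real_mult cnj_mult_self mult.assoc)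
  then show ?thesis by simp
qed

lemma eigsys_qf_bound:
  assumes "eigsys n A u l" "\<And>k. k < n \<Longrightarrow> \<bar>l k\<bar> \<le> L"
  shows "\<bar>qf n A x\<bar> \<le> L * sqn n x"
proof -
  have "\<bar>qf n A x\<bar> \<le> (\<Sum>k<n. \<bar>l k\<bar> * (cmod (ip n (u k) x))\<^sup>2)"
    unfolding eigsys_qf[OF assms(1)] by (rule order_trans[OF sum_abs]) (simp add: abs_mult)
  also have "\<dots> \<le> (\<Sum>k<n. L * (cmod (ip n (u k) x))\<^sup>2)"
    using assms by (intro sum_mono mult_right_mono) auto
  finally show ?thesis by (simp add: onb_sqn[OF eigsys_onb[OF assms(1)]] sum_distrib_left)
qed

text \<open>For each \<open>k\<close> the squared overlaps with the \<open>v i\<close> sum to 1, so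
  averaging eigenvalues against them cannot raise the sum of absolute values. This turns a trace
  norm bound into a bound on all diagonal deviations in a product basis.\<close>

lemma pinching:
  assumes A: "eigsys n A u l" and v: "onb n v"
  shows "(\<Sum>i<n. \<bar>qf n A (v i)\<bar>) \<le> (\<Sum>k<n. \<bar>l k\<bar>)"
proof -
  have "(\<Sum>i<n. \<bar>qf n A (v i)\<bar>) \<le> (\<Sum>i<n. \<Sum>k<n. \<bar>l k\<bar> * (cmod (ip n (v i) (u k)))\<^sup>2)"
    unfolding eigsys_qf[OF A]
    by (intro sum_mono order_trans[OF sum_abs]) (simp add: abs_mult cmod_ip_commute)
  also have "\<dots> = (\<Sum>k<n. \<bar>l k\<bar> * sqn n (u k))"
    by (subst sum.swap) (simp add: onb_sqn[OF v] sum_distrib_left)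
  also have "\<dots> = (\<Sum>k<n. \<bar>l k\<bar>)"
    by (intro sum.cong) (auto simp: onb_sqn1[OF eigsys_onb[OF A]])
  finally show ?thesis .
qed

text \<open>The Frobenius norm does not depend on the basis: Parseval trades \<open>v\<close> for
  the eigenbasis in the row index, and the overlaps left in the column index sum to 1.\<close>

lemma eigsys_frobenius:
  assumes A: "eigsys n A u l" and v: "onb n v"
  shows "(\<Sum>i<n. \<Sum>j<n. (cmod (bform n A (v i) (v j)))\<^sup>2) = (\<Sum>k<n. (l k)\<^sup>2)"
proof -
  have row: "(\<Sum>i<n. (cmod (bform n A (v i) (v j)))\<^sup>2) = (\<Sum>k<n. (l k)\<^sup>2 * (cmod (ip n (v j) (u k)))\<^sup>2)" for j
  proof -
    have "(\<Sum>i<n. (cmod (bform n A (v i) (v j)))\<^sup>2) = sqn n (\<lambda>i. \<Sum>j'<n. A i j' * v j j')"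
      unfolding onb_sqn[OF v] bform_ip ..
    also have "\<dots> = (\<Sum>k<n. (cmod (bform n A (u k) (v j)))\<^sup>2)"
      unfolding onb_sqn[OF eigsys_onb[OF A]] bform_ip ..
    also have "\<dots> = (\<Sum>k<n. (l k)\<^sup>2 * (cmod (ip n (v j) (u k)))\<^sup>2)"
      by (intro sum.cong) (auto simp: eigsys_bform_left[OF A] norm_mult power_mult_distrib cmod_ip_commute)
    finally show ?thesis .
  qed
  have "(\<Sum>i<n. \<Sum>j<n. (cmod (bform n A (v i) (v j)))\<^sup>2) = (\<Sum>j<n. \<Sum>k<n. (l k)\<^sup>2 * (cmod (ip n (v j) (u k)))\<^sup>2)"
    by (subst sum.swap) (simp add: row)
  also have "\<dots> = (\<Sum>k<n. (l k)\<^sup>2 * sqn n (u k))"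
    by (subst sum.swap) (simp add: onb_sqn[OF v] sum_distrib_left)
  also have "\<dots> = (\<Sum>k<n. (l k)\<^sup>2)"
    by (intro sum.cong) (auto simp: onb_sqn1[OF eigsys_onb[OF A]])
  finally show ?thesis .
qed

lemma onb_std: "onb n (\<lambda>k i. if i = k then 1 else 0)"
proof -
  have e: "(\<Sum>i<n. cnj (if i = k then 1 else 0) * (if i = l then 1 else 0::complex)) = (if k = l then 1 else 0)" if "k < n" for k l
  proof -
    have "(\<Sum>i<n. cnj (if i = k then 1 else 0) * (if i = l then 1 else 0::complex)) = (\<Sum>i<n. if k = i then (if k = l then 1 else 0) else 0)"
      by (intro sum.cong) auto
    then show ?thesis using that by simp
  qed
  have f: "(\<Sum>k<n. (if i = k then 1 else 0) * cnj (if j = k then 1 else 0::complex)) = (if i = j then 1 else 0)" if "i < n" for i j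
  proof -
    have "(\<Sum>k<n. (if i = k then 1 else 0) * cnj (if j = k then 1 else 0::complex)) = (\<Sum>k<n. if i = k then (if i = j then 1 else 0) else 0)"
      by (intro sum.cong) auto
    then show ?thesis using that by simp
  qed
  show ?thesis unfolding onb_def ip_def using e f by blast
qed

lemma cauchy_ip: "(cmod (ip n x y))\<^sup>2 \<le> sqn n x * sqn n y"
proof -
  have "cmod (ip n x y) \<le> (\<Sum>i<n. cmod (x i) * cmod (y i))"
    unfolding ip_def by (rule order_trans[OF norm_sum]) (simp add: norm_mult)
  then have "(cmod (ip n x y))\<^sup>2 \<le> (\<Sum>i<n. cmod (x i) * cmod (y i))\<^sup>2"
    by (intro power_mono) auto
  also have "\<dots> \<le> sqn n x * sqn n y"
    unfolding sqn_def by (rule Cauchy_Schwarz_ineq_sum)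
  finally show ?thesis .
qed

section \<open>The spectral theorem and Schatten norms\<close>

text \<open>Expanding the image of \<open>u k\<close> in the basis shows that a diagonal form means
  eigenvectors; completeness then reassembles the entries of \<open>A\<close>.\<close>

lemma eigsys_from_bform:
  assumes u: "onb n u" and d: "\<And>k j. k < n \<Longrightarrow> j < n \<Longrightarrow> bform n A (u k) (u j) = (if k = j then complex_of_real (l k) else 0)"
  shows "eigsys n A u l"
  unfolding eigsys_def
proof (intro conjI allI impI u)
  fix i j assume i: "i < n" and j: "j < n"
  have ev: "(\<Sum>m<n. A i m * u k m) = complex_of_real (l k) * u k i" if k: "k < n" for k
  proof -
    have "(\<Sum>m<n. A i m * u k m) = (\<Sum>k'<n. bform n A (u k') (u k) * u k' i)"
      unfolding bform_ip by (rule onb_expand[OF u i])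
    also have "\<dots> = (\<Sum>k'<n. if k = k' then complex_of_real (l k) * u k i else 0)"
      using k by (intro sum.cong) (auto simp: d)
    finally show ?thesis using k by simp
  qed
  have "(\<Sum>k<n. complex_of_real (l k) * u k i * cnj (u k j)) = (\<Sum>k<n. \<Sum>m<n. A i m * (u k m * cnj (u k j)))"
    by (intro sum.cong refl) (simp add: ev[symmetric] sum_distrib_right mult.assoc)
  also have "\<dots> = (\<Sum>m<n. A i m * (if m = j then 1 else 0))"
    by (subst sum.swap) (intro sum.cong refl, simp add: sum_distrib_left[symmetric] onb_complete[OF u] j)
  also have "\<dots> = A i j" using j by (simp add: if_distrib cong: if_cong)
  finally show "A i j = (\<Sum>k<n. complex_of_real (l k) * u k i * cnj (u k j))" by simp
qed

lemma bform_change_basis: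
  "bform n A (\<lambda>j. \<Sum>i<n. y i * w i j) (\<lambda>j. \<Sum>i<n. z i * w i j) = bform n (\<lambda>i j. bform n A (w i) (w j)) y z"
  unfolding bform_sum_left bform_sum_right 
  by (simp add: bform_def[of n "\<lambda>i j. bform n A (w i) (w j)"] sum_distrib_left mult_ac)

lemma herm_change_basis: "herm n A \<Longrightarrow> herm m (\<lambda>i j. bform n A (w i) (w j))"
  unfolding herm_def[of m] by (simp add: bform_cnj)

text \<open>The characteristic polynomial has a complex root. It is real because pairing the
  eigenvector equation with the unit vector \<open>x\<close> identifies it with a value of the
  Hermitian form.\<close>

lemma hermitian_eigenvector:
  assumes A: "herm n A" and n: "0 < n"
  shows "\<exists>x e. sqn n x = 1 \<and> (\<forall>i<n. (\<Sum>j<n. A i j * x j) = complex_of_real e * x i)"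
proof -
  define M where "M = mat n n (\<lambda>(i, j). A i j)"
  have M: "M \<in> carrier_mat n n" by (simp add: M_def)
  have "\<not> constant (poly (char_poly M))"
    using degree_monic_char_poly[OF M] n by (simp add: constant_degree)
  then obtain e where "poly (char_poly M) e = 0" using fundamental_theorem_of_algebra by blast
  then have "eigenvalue M e" using eigenvalue_root_char_poly[OF M] by simp
  then obtain v where v: "v \<in> carrier_vec n" "v \<noteq> 0\<^sub>v n" "M *\<^sub>v v = e \<cdot>\<^sub>v v"
    using M unfolding eigenvalue_def eigenvector_def by auto
  have ev: "(\<Sum>j<n. A i j * (v $ j)) = e * (v $ i)" if i: "i < n" for i
  proof -
    have "(M *\<^sub>v v) $ i = (\<Sum>j<n. A i j * (v $ j))"
      using v(1) i by (simp add: M_def scalar_prod_def atLeast0LessThan)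
    then show ?thesis using v i by simp
  qed
  define s where "s = sqn n (\<lambda>i. v $ i)"
  have s: "s > 0"
  proof (rule ccontr)
    assume "\<not> s > 0"
    then have "s = 0" using sqn_nonneg[of n "\<lambda>i. v $ i"] unfolding s_def by linarith
    then have "\<forall>i<n. v $ i = 0" unfolding s_def sqn_def by (subst (asm) sum_nonneg_eq_0_iff) auto
    then have "v = 0\<^sub>v n" using v(1) by auto
    then show False using v by simp
  qed
  define x where "x i = complex_of_real (1 / sqrt s) * v $ i" for i
  have x1: "sqn n x = 1"
  proof -
    have "sqn n x = (\<Sum>i<n. (1 / sqrt s)\<^sup>2 * (cmod (v $ i))\<^sup>2)"
      unfolding sqn_def x_def using s by (intro sum.cong refl) (simp add: norm_mult power_mult_distrib norm_divide power_divide)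
    also have "\<dots> = (1 / sqrt s)\<^sup>2 * s"
      unfolding s_def sqn_def sum_distrib_left ..
    finally have "sqn n x = (1 / sqrt s)\<^sup>2 * s" .
    then show ?thesis using s by (simp add: power_divide)
  qed
  have ex: "(\<Sum>j<n. A i j * x j) = e * x i" if "i < n" for i
  proof -
    have "(\<Sum>j<n. A i j * x j) = complex_of_real (1 / sqrt s) * (\<Sum>j<n. A i j * v $ j)"
      unfolding x_def by (simp add: sum_distrib_left mult_ac)
    then show ?thesis using ev[OF that] by (simp add: x_def)
  qed
  have "bform n A x x = e * ip n x x"
    unfolding bform_ip ip_scale_right[symmetric] by (rule ip_cong) (auto simp: ex)
  then have "e = bform n A x x" by (simp add: ip_self x1)
  then have "e = complex_of_real (Re e)" using bform_real[OF A, of x] by simp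
  then show ?thesis using x1 ex by metis
qed

text \<open>The basis consists of the columns of the Householder reflection exchanging \<open>v\<close>, up to
  a phase, with the first standard basis vector.\<close>

lemma onb_extend:
  assumes v: "sqn n v = 1" and n: "0 < n"
  shows "\<exists>w c. onb n w \<and> (\<forall>i<n. w 0 i = c * v i)"
proof -
  \<comment> \<open>The phase makes \<open>c * v 0\<close> real and nonpositive, so \<open>d\<close>
    is at least 1 and the reflection vector \<open>g\<close> never degenerates.\<close>
  define c where "c = (if v 0 = 0 then 1 else - cnj (v 0) / complex_of_real (cmod (v 0)))"
  have c1: "cmod c = 1" by (simp add: c_def norm_divide)
  have "c * v 0 = complex_of_real (- cmod (v 0))"
  proof (cases "v 0 = 0")
    case False
    have "c * v 0 = - (cnj (v 0) * v 0) / complex_of_real (cmod (v 0))" using False by (simp add: c_def)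
    also have "\<dots> = complex_of_real (- ((cmod (v 0))\<^sup>2 / cmod (v 0)))" unfolding cnj_mult_self by simp
    finally show ?thesis using False by (simp add: power2_eq_square)
  qed (simp add: c_def)
  then obtain a where a: "c * v 0 = complex_of_real a" "a \<le> 0" 
    by (metis neg_le_0_iff_le norm_ge_zero)
  define g where "g i = (if i = 0 then 1 else 0) - c * v i" for i
  define d where "d = complex_of_real (1 - a)"
  have d0: "d \<noteq> 0" unfolding d_def of_real_eq_0_iff using a by linarith
  have g0: "g 0 = d" by (simp add: g_def d_def a)
  have sg: "ip n g g = 2 * d"
  proof -
    have cv: "cnj (c * v 0) = complex_of_real a" using a by simp
    have "ip n g g = (\<Sum>i<n. (if i = 0 then 1 - cnj (c * v 0) - c * v 0 else 0) + cnj (c * v i) * (c * v i))"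
      unfolding ip_def g_def by (intro sum.cong) (auto simp: algebra_simps)
    also have "\<dots> = 1 - cnj (c * v 0) - c * v 0 + (\<Sum>i<n. cnj (c * v i) * (c * v i))"
      using n by (simp add: sum.distrib)
    also have "(\<Sum>i<n. cnj (c * v i) * (c * v i)) = 1"
    proof -
      have "(\<Sum>i<n. cnj (c * v i) * (c * v i)) = complex_of_real (sqn n v)"
        unfolding cnj_mult_self sqn_def by (simp add: norm_mult c1)
      then show ?thesis by (simp only: v of_real_1)
    qed
    finally show ?thesis by (simp add: cv a(1) d_def)
  qed
  define w where "w k i = (if k = i then 1 else 0) - cnj (g k) * g i / d" for k i
  have cd: "cnj d = d" by (simp add: d_def)
  have orth: "ip n (w k) (w l) = (if k = l then 1 else 0)" if k: "k < n" and l: "l < n" for k l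
  proof -
    have "ip n (w k) (w l) = (\<Sum>i<n. (if k = i then (if k = l then 1 else 0) - cnj (g l) * g k / d else 0)
       - (if l = i then g k * cnj (g l) / d else 0) + g k * cnj (g l) / (d * d) * (cnj (g i) * g i))"
      unfolding ip_def w_def by (intro sum.cong) (auto simp: cd algebra_simps)
    also have "\<dots> = (if k = l then 1 else 0) - 2 * (g k * cnj (g l) / d) + g k * cnj (g l) / (d * d) * ip n g g"
      using k l unfolding ip_def by (simp add: sum.distrib sum_subtractf sum_distrib_left sum_divide_distrib algebra_simps)
    also have "g k * cnj (g l) / (d * d) * ip n g g = 2 * (g k * cnj (g l) / d)" using d0 by (simp add: sg)
    finally show ?thesis by simp
  qed
  have sym: "cnj (w k i) = w i k" for k i by (simp add: w_def cd mult.commute)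
  have "(\<Sum>k<n. w k i * cnj (w k j)) = (if i = j then 1 else 0)" if "i < n" "j < n" for i j
  proof -
    have "(\<Sum>k<n. w k i * cnj (w k j)) = ip n (w i) (w j)" by (simp add: ip_def sym)
    then show ?thesis using orth that by simp
  qed
  then have "onb n w" using orth by (simp add: onb_def)
  moreover have "w 0 i = c * v i" for i
  proof -
    have "w 0 i = (if i = 0 then 1 else 0) - g i" using d0 by (simp add: w_def[of 0] g0 cd)
    then show ?thesis by (simp add: g_def[of i])
  qed
  ultimately show ?thesis by blast
qed

text \<open>Deflation: in a basis that begins with an eigenvector, the first row and column of the
  form vanish off the diagonal, by Hermitian symmetry, and the induction hypothesis diagonalises the
  remaining block.\<close>

theorem spectral_theorem:
  assumes "herm n A" shows "\<exists>u l. eigsys n A u l"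
  using assms
proof (induction n arbitrary: A)
  case 0
  show ?case by (simp add: eigsys_def onb_def)
next
  case (Suc n)
  let ?N = "Suc n"
  obtain x e where x: "sqn ?N x = 1" "\<forall>i<?N. (\<Sum>j<?N. A i j * x j) = complex_of_real e * x i"
    using hermitian_eigenvector[OF Suc.prems] by blast
  obtain w c where w: "onb ?N w" "\<forall>i<?N. w 0 i = c * x i" using onb_extend[OF x(1)] by blast
  define B where "B i j = bform ?N A (w i) (w j)" for i j
  have B: "herm ?N B" unfolding B_def using herm_change_basis[OF Suc.prems] .
  have B0: "B i 0 = (if i = 0 then complex_of_real e else 0)" if i: "i < ?N" for i
  proof -
    have "B i 0 = ip ?N (w i) (\<lambda>i. complex_of_real e * w 0 i)"
      unfolding B_def bform_ip
    proof (rule ip_cong[OF refl])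
      fix i assume i: "i < ?N"
      have "(\<Sum>j<?N. A i j * w 0 j) = c * (\<Sum>j<?N. A i j * x j)"
        unfolding sum_distrib_left using w(2) by (intro sum.cong) auto
      then show "(\<Sum>j<?N. A i j * w 0 j) = complex_of_real e * w 0 i" using x(2) w(2) i by simp
    qed
    then show ?thesis using w(1) i by (simp add: ip_scale_right onb_ip)
  qed
  have B0': "B 0 i = (if i = 0 then complex_of_real e else 0)" if i: "i < ?N" for i
    using hermD[OF B i, of 0] B0[OF i] by (simp split: if_splits)
  have "herm n (\<lambda>i j. B (Suc i) (Suc j))"
    unfolding herm_def using hermD[OF B] by auto
  from Suc.IH[OF this] obtain u l where u: "eigsys n (\<lambda>i j. B (Suc i) (Suc j)) u l" by blast
  \<comment> \<open>The first unit vector, followed by the eigenbasis of the smaller block with all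
    indices shifted by one.\<close>
  define y where "y k i = (case k of 0 \<Rightarrow> if i = 0 then 1 else 0 | Suc k \<Rightarrow> (case i of 0 \<Rightarrow> 0 | Suc i \<Rightarrow> u k i))" for k i
  define l' where "l' k = (case k of 0 \<Rightarrow> e | Suc k \<Rightarrow> l k)" for k
  note uo = eigsys_onb[OF u]
  have y: "onb ?N y"
    unfolding onb_def
  proof (intro conjI allI impI)
    fix k l assume "k < ?N" "l < ?N"
    then show "ip ?N (y k) (y l) = (if k = l then 1 else 0)"
      using onb_ip[OF uo] unfolding ip_def y_def
      by (cases k; cases l) (simp_all add: sum.lessThan_Suc_shift del: sum.lessThan_Suc)
  next
    fix i j assume "i < ?N" "j < ?N"
    then show "(\<Sum>k<?N. y k i * cnj (y k j)) = (if i = j then 1 else 0)"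
      using onb_complete[OF uo] unfolding y_def
      by (cases i; cases j) (simp_all add: sum.lessThan_Suc_shift del: sum.lessThan_Suc)
  qed
  have "eigsys ?N B y l'"
  proof (rule eigsys_from_bform[OF y])
    fix k j assume k: "k < ?N" and j: "j < ?N"
    show "bform ?N B (y k) (y j) = (if k = j then complex_of_real (l' k) else 0)"
      using eigsys_bform_basis[OF u] k j B0 B0' unfolding bform_def y_def l'_def
      by (cases k; cases j) (simp_all add: sum.lessThan_Suc_shift del: sum.lessThan_Suc)
  qed
  then have "bform ?N A (\<lambda>j. \<Sum>i<?N. y k i * w i j) (\<lambda>j. \<Sum>i<?N. y k' i * w i j) = (if k = k' then complex_of_real (l' k) else 0)"
    if "k < ?N" "k' < ?N" for k k'
    using eigsys_bform_basis that unfolding bform_change_basis B_def by blast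
  then have "eigsys ?N A (\<lambda>k j. \<Sum>i<?N. y k i * w i j) l'"
    by (intro eigsys_from_bform onb_compose y w)
  then show ?case by blast
qed

section \<open>Entry functions of matrices and singular values of Hermitian matrices\<close>

lemma dim_mat_adjoint [simp]: "dim_row (mat_adjoint A) = dim_col A" "dim_col (mat_adjoint A) = dim_row A"
  by (simp_all add: mat_adjoint_def)

lemma index_mat_adjoint:
  fixes A :: "complex mat"
  assumes "i < dim_col A" "j < dim_row A"
  shows "mat_adjoint A $$ (i, j) = cnj (A $$ (j, i))"
  using assms by (simp add: mat_adjoint_def mat_of_rows_index)

definition fun_of_mat :: "complex mat \<Rightarrow> nat \<Rightarrow> nat \<Rightarrow> complex" where
  "fun_of_mat M i j = M $$ (i, j)"

lemma hermitian_mats_iff: "M \<in> hermitian_mats n \<longleftrightarrow> M \<in> carrier_mat n n \<and> herm n (fun_of_mat M)"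
proof
  assume M: "M \<in> hermitian_mats n"
  then have "M $$ (j, i) = cnj (M $$ (i, j))" if "i < n" "j < n" for i j
    using that index_mat_adjoint[of j M i] by (auto simp: hermitian_mats_def)
  with M show "M \<in> carrier_mat n n \<and> herm n (fun_of_mat M)"
    unfolding herm_def fun_of_mat_def hermitian_mats_def by blast
next
  assume M: "M \<in> carrier_mat n n \<and> herm n (fun_of_mat M)"
  have "mat_adjoint M = M"
    using M hermD[of n "fun_of_mat M"] by (intro eq_matI) (auto simp: index_mat_adjoint fun_of_mat_def)
  with M show "M \<in> hermitian_mats n" by (simp add: hermitian_mats_def)
qed

text \<open>\<open>M * M\<close> is similar to the diagonal matrix of the squares of the
  \<open>l k\<close>, so its characteristic polynomial splits accordingly, and the square roots
  taken in \<open>singular_values\<close> return absolute values of eigenvalues.\<close>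

lemma singular_values_hermitian:
  assumes M: "M \<in> hermitian_mats n" and s: "eigsys n (fun_of_mat M) u l"
  shows "singular_values M = image_mset (\<lambda>k. \<bar>l k\<bar>) (mset [0..<n])"
proof -
  have Mc: "M \<in> carrier_mat n n" and Ma: "mat_adjoint M = M" using M by (auto simp: hermitian_mats_def)
  define U where "U = mat n n (\<lambda>(i, k). u k i)"
  define V where "V = mat n n (\<lambda>(k, j). cnj (u k j))"
  define D where "D = mat n n (\<lambda>(i, j). if i = j then complex_of_real ((l i)\<^sup>2) else 0)"
  note o = eigsys_onb[OF s]
  have UV: "U * V = 1\<^sub>m n"
    by (rule eq_matI) (auto simp: U_def V_def scalar_prod_def atLeast0LessThan onb_complete[OF o])
  have VU: "V * U = 1\<^sub>m n"
    using onb_ip[OF o] unfolding ip_def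
    by (intro eq_matI) (auto simp: U_def V_def scalar_prod_def atLeast0LessThan)
  have MM: "M * M = U * D * V"
  proof (rule eq_matI)
    fix i j assume "i < dim_row (U * D * V)" "j < dim_col (U * D * V)"
    then have i: "i < n" and j: "j < n" by (auto simp: U_def V_def)
    have UD: "(U * D) $$ (i, k) = complex_of_real ((l k)\<^sup>2) * u k i" if k: "k < n" for k
    proof -
      have "(U * D) $$ (i, k) = (\<Sum>m<n. u m i * (if m = k then complex_of_real ((l m)\<^sup>2) else 0))"
        using i k by (simp add: U_def D_def scalar_prod_def atLeast0LessThan)
      also have "\<dots> = (\<Sum>m<n. if k = m then complex_of_real ((l k)\<^sup>2) * u k i else 0)"
        by (intro sum.cong) auto
      finally show ?thesis using k by simp
    qed
    have "(U * D * V) $$ (i, j) = (\<Sum>k<n. (U * D) $$ (i, k) * V $$ (k, j))"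
      using i j by (simp add: scalar_prod_def atLeast0LessThan U_def V_def D_def del: index_mult_mat(1)) 
        (simp add: scalar_prod_def atLeast0LessThan)
    also have "\<dots> = (\<Sum>k<n. complex_of_real ((l k)\<^sup>2) * u k i * cnj (u k j))"
      using j by (intro sum.cong) (auto simp: UD V_def)
    finally have 1: "(U * D * V) $$ (i, j) = (\<Sum>k<n. complex_of_real ((l k)\<^sup>2) * u k i * cnj (u k j))" .
    have "(M * M) $$ (i, j) = (\<Sum>m<n. fun_of_mat M i m * fun_of_mat M m j)"
      using Mc i j by (simp add: scalar_prod_def atLeast0LessThan fun_of_mat_def)
    also have "\<dots> = ip n (\<lambda>m. cnj (fun_of_mat M i m)) (\<lambda>m. fun_of_mat M m j)"
      by (simp add: ip_def)
    also have "\<dots> = ip n (\<lambda>m. \<Sum>k<n. (complex_of_real (l k) * cnj (u k i)) * u k m) (\<lambda>m. \<Sum>k<n. (complex_of_real (l k) * cnj (u k j)) * u k m)"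
      using s i j by (intro ip_cong) (simp_all add: eigsys_def mult_ac)
    also have "\<dots> = (\<Sum>k<n. complex_of_real (l k) * u k i * (\<Sum>k'<n. (complex_of_real (l k') * cnj (u k' j)) * (if k = k' then 1 else 0)))"
      unfolding ip_sum_left ip_sum_right by (intro sum.cong refl arg_cong2[of _ _ _ _ "(*)"]) (auto simp: onb_ip[OF o])
    also have "\<dots> = (\<Sum>k<n. complex_of_real ((l k)\<^sup>2) * u k i * cnj (u k j))"
      by (intro sum.cong refl) (simp add: if_distrib power2_eq_square mult_ac cong: if_cong)
    finally show "(M * M) $$ (i, j) = (U * D * V) $$ (i, j)" using 1 by simp
  qed (use Mc in \<open>auto simp: U_def V_def\<close>)
  have "similar_mat (M * M) D"
    unfolding similar_mat_def
    by (intro exI, rule similar_mat_witI[of U V n], rule UV, rule VU, rule MM) (use Mc in \<open>auto simp: U_def V_def D_def\<close>)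
  then have "char_poly (M * M) = char_poly D" by (rule char_poly_similar)
  also have "\<dots> = (\<Prod>a\<leftarrow>diag_mat D. [:- a, 1:])"
    by (rule char_poly_upper_triangular[of _ n]) (auto simp: D_def upper_triangular_def)
  also have "diag_mat D = map (\<lambda>i. complex_of_real ((l i)\<^sup>2)) [0..<n]"
    by (auto simp: diag_mat_def D_def)
  finally have cp: "char_poly (M * M) = (\<Prod>a\<leftarrow>map (\<lambda>i. complex_of_real ((l i)\<^sup>2)) [0..<n]. [:- a, 1:])" .
  have pr: "proots (\<Prod>a\<leftarrow>as. [:- a, 1:]) = mset as" for as :: "complex list"
  proof (induction as)
    case (Cons a as)
    have "proots ([:- a, 1:] * (\<Prod>a\<leftarrow>as. [:- a, 1:])) = {#a#} + mset as"
      by (subst proots_mult) (use Cons in \<open>auto simp: prod_list_zero_iff simp del: mult_pCons_left\<close>)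
    then show ?case by simp
  qed simp
  show ?thesis unfolding singular_values_def Ma cp pr
    by (simp add: image_mset.compositionality comp_def)
qed

lemma schatten_norm_1:
  assumes "M \<in> hermitian_mats n" "eigsys n (fun_of_mat M) u l"
  shows "schatten_norm 1 M = (\<Sum>k<n. \<bar>l k\<bar>)"
proof -
  have "schatten_norm 1 M = (\<Sum>k\<leftarrow>[0..<n]. \<bar>l k\<bar>) powr 1"
    by (simp add: schatten_norm_def singular_values_hermitian[OF assms] image_mset.compositionality comp_def
        flip: sum_mset_sum_list)
  then show ?thesis by (simp add: interv_sum_list_conv_sum_set_nat atLeast0LessThan sum_nonneg)
qed

lemma schatten_norm_2:
  assumes "M \<in> hermitian_mats n" "eigsys n (fun_of_mat M) u l"
  shows "schatten_norm 2 M = sqrt (\<Sum>k<n. (l k)\<^sup>2)"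
proof -
  have "schatten_norm 2 M = (\<Sum>k\<leftarrow>[0..<n]. (l k)\<^sup>2) powr (1/2)"
    by (simp add: schatten_norm_def singular_values_hermitian[OF assms] image_mset.compositionality comp_def
        flip: sum_mset_sum_list)
  then show ?thesis by (simp add: interv_sum_list_conv_sum_set_nat atLeast0LessThan sum_nonneg powr_half_sqrt)
qed

text \<open>Stated as a lower bound on the norm, because the infinity norm occurs in hypotheses
  only.\<close>

lemma schatten_norm_inf_ge:
  assumes "M \<in> hermitian_mats n" "eigsys n (fun_of_mat M) u l" "k < n"
  shows "\<bar>l k\<bar> \<le> schatten_norm \<infinity> M"
proof -
  have "\<bar>l k\<bar> \<in> insert 0 (set_mset (singular_values M))"
    using assms(3) by (auto simp: singular_values_hermitian[OF assms(1,2)])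
  then show ?thesis by (simp add: schatten_norm_def del: insert_iff)
qed

section \<open>The descent cone of the nuclear norm\<close>

text \<open>Eigenvectors with nonzero eigenvalue lie in the column space, since \<open>X\<close>
  maps a multiple of each to the vector itself, and orthonormality makes them linearly independent
  there.\<close>

lemma card_eigenvalues_le_rank:
  assumes X: "X \<in> hermitian_mats n" and s: "eigsys n (fun_of_mat X) u x"
  shows "card {k. k < n \<and> x k \<noteq> 0} \<le> vec_space.rank n X"
proof -
  interpret vec_space "TYPE(complex)" n .
  note o = eigsys_onb[OF s]
  have Xc: "X \<in> carrier_mat n n" using X by (simp add: hermitian_mats_def)
  define K where "K = {k. k < n \<and> x k \<noteq> 0}"
  define e where "e k = vec n (u k)" for k
  define E where "E = e ` K"
  have ip_e: "(\<Sum>i<n. cnj (e k $ i) * e l $ i) = (if k = l then 1 else 0)" if "k < n" "l < n" for k l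
    using onb_ip[OF o that] by (simp add: e_def ip_def)
  have inj: "inj_on e K"
  proof (rule inj_onI)
    fix k l assume "k \<in> K" "l \<in> K" "e k = e l"
    then have "(\<Sum>i<n. cnj (e k $ i) * e k $ i) = (if k = l then 1 else 0)" "k < n"
      using ip_e[of k l] by (auto simp: K_def)
    then show "k = l" using ip_e[of k k] by (auto split: if_splits)
  qed
  have finE: "finite E" by (simp add: E_def K_def)
  have Ec: "E \<subseteq> carrier_vec n" by (auto simp: E_def e_def)
  have indpt: "lin_indpt E"
  proof
    assume "lin_dep E"
    then obtain a v where lc: "lincomb a E = 0\<^sub>v n" and v: "v \<in> E" "a v \<noteq> 0"
      using finite_lin_dep[OF finE] Ec by blast
    have "a v = 0"
    proof -
      from v(1)
      obtain k where k: "k \<in> K" "v = e k" by (auto simp: E_def)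
      have 0: "(\<Sum>w\<in>E. a w * w $ i) = 0" if "i < n" for i
        using lincomb_index[OF that Ec, of a] lc that by simp
      have "0 = (\<Sum>i<n. cnj (e k $ i) * (\<Sum>w\<in>E. a w * w $ i))" using 0 by simp
      also have "\<dots> = (\<Sum>w\<in>E. a w * (\<Sum>i<n. cnj (e k $ i) * w $ i))"
        by (simp only: sum_distrib_left, subst sum.swap, simp add: mult_ac)
      also have "\<dots> = (\<Sum>l\<in>K. a (e l) * (\<Sum>i<n. cnj (e k $ i) * e l $ i))"
        unfolding E_def by (rule sum.reindex_cong[OF inj]) auto
      also have "\<dots> = (\<Sum>l\<in>K. if k = l then a (e k) else 0)"
        using k by (intro sum.cong refl) (auto simp: ip_e K_def)
      also have "\<dots> = a (e k)" using k by (simp add: K_def)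
      finally show "a v = 0" using k by simp
    qed
    with v show False by simp
  qed
  have E_span: "E \<subseteq> span (set (cols X))"
  proof
    fix v assume "v \<in> E"
    then obtain k where k: "k < n" "x k \<noteq> 0" "v = e k" by (auto simp: E_def K_def)
    have "X *\<^sub>v (complex_of_real (1 / x k) \<cdot>\<^sub>v e k) = e k"
    proof (rule eq_vecI)
      fix i assume "i < dim_vec (e k)"
      then have i: "i < n" by (simp add: e_def)
      have "(X *\<^sub>v (complex_of_real (1 / x k) \<cdot>\<^sub>v e k)) $ i = complex_of_real (1 / x k) * (\<Sum>j<n. fun_of_mat X i j * u k j)"
        using Xc i by (simp add: scalar_prod_def e_def fun_of_mat_def atLeast0LessThan sum_distrib_left mult_ac)
      also have "(\<Sum>j<n. fun_of_mat X i j * u k j) = complex_of_real (x k) * u k i"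
      proof -
        have "(\<Sum>j<n. fun_of_mat X i j * u k j) = (\<Sum>k'<n. bform n (fun_of_mat X) (u k') (u k) * u k' i)"
          unfolding bform_ip by (rule onb_expand[OF o i])
        also have "\<dots> = (\<Sum>k'<n. if k = k' then complex_of_real (x k) * u k i else 0)"
          using k by (intro sum.cong) (auto simp: eigsys_bform_basis[OF s])
        finally show ?thesis using k by simp
      qed
      finally show "(X *\<^sub>v (complex_of_real (1 / x k) \<cdot>\<^sub>v e k)) $ i = e k $ i"
        using k i by (simp add: e_def)
    qed (use Xc in \<open>simp add: e_def\<close>)
    then have "v \<in> col_space X"
      unfolding col_space_eq[OF Xc] using k Xc
      by (auto simp: e_def intro!: bexI[of _ "complex_of_real (1 / x k) \<cdot>\<^sub>v e k"])
    then show "v \<in> span (set (cols X))" by (simp add: col_space_def)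
  qed
  have cols: "set (cols X) \<subseteq> carrier_vec n" using cols_dim[of X] Xc by simp
  have vs: "vectorspace class_ring (span_vs (set (cols X)))"
    using span_is_subspace[OF cols] subspace_is_vs by blast
  have "LinearCombinations.module.lin_indpt class_ring (span_vs (set (cols X))) E"
    using span_li_not_depend(2)[OF E_span span_is_submodule[OF cols]] indpt by blast
  then have "card E \<le> rank X"
    unfolding rank_def
    by (intro vectorspace.li_le_dim(2)[OF vs] fin_dim_span_cols[OF Xc]) (use E_span in auto)
  then show ?thesis using card_image[OF inj] by (simp add: E_def K_def)
qed

section \<open>Trace duality and the cone inequality\<close>

definition trace_prod :: "nat \<Rightarrow> (nat \<Rightarrow> nat \<Rightarrow> complex) \<Rightarrow> (nat \<Rightarrow> nat \<Rightarrow> complex) \<Rightarrow> complex" where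
  "trace_prod n A B = (\<Sum>i<n. \<Sum>j<n. A i j * B j i)"

text \<open>Functional calculus in the basis \<open>u\<close>. With the signs of the eigenvalues it
  gives the matrix that attains the duality between trace norm and spectral norm.\<close>

definition eig_mat :: "nat \<Rightarrow> (nat \<Rightarrow> nat \<Rightarrow> complex) \<Rightarrow> (nat \<Rightarrow> real) \<Rightarrow> nat \<Rightarrow> nat \<Rightarrow> complex" where
  "eig_mat n u f i j = (\<Sum>k<n. complex_of_real (f k) * u k i * cnj (u k j))"

lemma eigsys_eig_mat: "onb n u \<Longrightarrow> eigsys n (eig_mat n u f) u f"
  by (simp add: eigsys_def eig_mat_def)

lemma trace_prod_eigsys:
  assumes "eigsys n B u l"
  shows "trace_prod n A B = (\<Sum>k<n. complex_of_real (l k) * bform n A (u k) (u k))"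
proof -
  have "trace_prod n A B = (\<Sum>i<n. \<Sum>j<n. \<Sum>k<n. complex_of_real (l k) * (cnj (u k i) * A i j * u k j))"
    unfolding trace_prod_def using assms by (intro sum.cong refl) (simp add: eigsys_def sum_distrib_left mult_ac)
  also have "\<dots> = (\<Sum>i<n. \<Sum>k<n. \<Sum>j<n. complex_of_real (l k) * (cnj (u k i) * A i j * u k j))"
    by (intro sum.cong refl sum.swap)
  also have "\<dots> = (\<Sum>k<n. \<Sum>i<n. \<Sum>j<n. complex_of_real (l k) * (cnj (u k i) * A i j * u k j))"
    by (rule sum.swap)
  finally show ?thesis by (simp add: bform_def sum_distrib_left)
qed

lemma Re_tp_eigsys: "eigsys n B u l \<Longrightarrow> Re (trace_prod n A B) = (\<Sum>k<n. l k * qf n A (u k))"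
  by (simp add: trace_prod_eigsys)

text \<open>A unitary change of basis keeps the eigenvalues, so trace and Frobenius norms survive
  the rotation into the eigenbasis of \<open>X\<close> in \<open>cone_bound\<close>.\<close>

lemma eigsys_change_basis:
  assumes s: "eigsys n A u l" and e: "onb n e"
  shows "eigsys n (\<lambda>i j. bform n A (e i) (e j)) (\<lambda>k i. ip n (e i) (u k)) l"
  unfolding eigsys_def
proof (intro conjI allI impI)
  note o = eigsys_onb[OF s]
  show "onb n (\<lambda>k i. ip n (e i) (u k))"
    unfolding onb_def
  proof (intro conjI allI impI)
    fix k l assume kl: "k < n" "l < n"
    have "ip n (\<lambda>i. ip n (e i) (u k)) (\<lambda>i. ip n (e i) (u l)) = ip n (u k) (u l)"
      by (subst onb_parseval[OF e]) (simp add: ip_def[of n "\<lambda>i. ip n (e i) (u k)"] ip_cnj)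
    then show "ip n (\<lambda>i. ip n (e i) (u k)) (\<lambda>i. ip n (e i) (u l)) = (if k = l then 1 else 0)"
      using onb_ip[OF o kl] by simp
  next
    fix i j assume ij: "i < n" "j < n"
    have "(\<Sum>k<n. ip n (e i) (u k) * cnj (ip n (e j) (u k))) = ip n (e i) (e j)"
      by (subst onb_parseval[OF o]) (simp add: ip_cnj)
    then show "(\<Sum>k<n. ip n (e i) (u k) * cnj (ip n (e j) (u k))) = (if i = j then 1 else 0)"
      using onb_ip[OF e ij] by simp
  qed
  fix i j assume "i < n" "j < n"
  show "bform n A (e i) (e j) = (\<Sum>k<n. complex_of_real (l k) * ip n (e i) (u k) * cnj (ip n (e j) (u k)))"
    by (simp add: eigsys_bform[OF s] ip_cnj)
qed

lemma real_sgn_le_1: "\<bar>sgn (x::real)\<bar> \<le> 1"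
  by (simp add: sgn_if)

text \<open>Here X is diagonal with entries \<open>x\<close> and support \<open>R\<close>. Testing X
  + Z against the sign matrix of X plus that of the block \<open>B\<close> of \<open>Z\<close>
  outside \<open>R\<close> gives the trace norms of X and \<open>B\<close>, up to the diagonal of
  \<open>Z\<close> on \<open>R\<close>. As the trace norm has not grown, that diagonal dominates the
  trace norm of \<open>B\<close>. The rest of \<open>Z\<close> touches \<open>R\<close> and is
  controlled by its Frobenius norm.\<close>

lemma cone_bound_diagonal:
  assumes Z: "eigsys n Z u z"
    and W: "eigsys n (\<lambda>i j. (if i = j then complex_of_real (x i) else 0) + Z i j) f y"
    and yx: "(\<Sum>k<n. \<bar>y k\<bar>) \<le> (\<Sum>k<n. \<bar>x k\<bar>)"
    and rk: "card {k. k < n \<and> x k \<noteq> 0} \<le> r"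
  shows "(\<Sum>k<n. \<bar>z k\<bar>)\<^sup>2 \<le> 6 * real r * (\<Sum>k<n. (z k)\<^sup>2)"
proof -
  define R where "R = {k. k < n \<and> x k \<noteq> 0}"
  have R: "finite R" "R \<subseteq> {..<n}" "card R \<le> r" using rk by (auto simp: R_def)
  define B where "B i j = (if i \<in> R \<or> j \<in> R then 0 else Z i j)" for i j
  note hZ = hermD[OF eigsys_herm[OF Z]]
  have "herm n B" unfolding herm_def B_def by (simp add: hZ)
  then obtain g b where g: "eigsys n B g b" using spectral_theorem by blast
  define out where "out v i = (if i \<in> R then 0 else v i :: complex)" for v i
  have out_le: "sqn n (out v) \<le> sqn n v" for v
    unfolding sqn_def out_def by (intro sum_mono) auto
  have split_sqn: "sqn n v = (\<Sum>i\<in>R. (cmod (v i))\<^sup>2) + sqn n (out v)" for v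
  proof -
    have "sqn n v = (\<Sum>i<n. (if i \<in> R then (cmod (v i))\<^sup>2 else 0) + (cmod (out v i))\<^sup>2)"
      unfolding sqn_def out_def by (intro sum.cong) auto
    also have "\<dots> = (\<Sum>i\<in>R. (cmod (v i))\<^sup>2) + sqn n (out v)"
      using R unfolding sqn_def sum.distrib by (simp add: sum.If_cases Int_absorb1)
    finally show ?thesis .
  qed
  define T2 where "T2 = eig_mat n g (\<lambda>k. sgn (b k))"
  have T2: "eigsys n T2 g (\<lambda>k. sgn (b k))" unfolding T2_def using g by (intro eigsys_eig_mat) (rule eigsys_onb)
  \<comment> \<open>Eigenvectors of \<open>B\<close> with nonzero eigenvalue vanish on
    \<open>R\<close>, and therefore so does the sign matrix \<open>T2\<close>.\<close>
  have gR: "g k i = 0" if "i \<in> R" "k < n" "b k \<noteq> 0" for i k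
  proof -
    have i: "i < n" using that R by auto
    have "complex_of_real (b k) * g k i = (\<Sum>k'<n. if k = k' then complex_of_real (b k) * g k i else 0)"
      using that by simp
    also have "\<dots> = (\<Sum>k'<n. bform n B (g k') (g k) * g k' i)"
      using that by (intro sum.cong) (auto simp: eigsys_bform_basis[OF g])
    also have "\<dots> = (\<Sum>m<n. B i m * g k m)"
      unfolding bform_ip by (rule onb_expand[OF eigsys_onb[OF g] i, symmetric])
    also have "\<dots> = 0" using that by (simp add: B_def)
    finally show ?thesis using that by simp
  qed
  have T2R: "T2 i j = 0" if "i \<in> R \<or> j \<in> R" for i j
    unfolding T2_def eig_mat_def using that gR by (intro sum.neutral) (auto simp: sgn_if)
  \<comment> \<open>A dual certificate of spectral norm at most 1: its two summands act on
    complementary coordinates, inside and outside \<open>R\<close>.\<close>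
  define T where "T i j = (if i = j then complex_of_real (sgn (x i)) else 0) + T2 i j" for i j
  have dsum: "(\<Sum>i<n. \<Sum>j<n. (if i = j then c i else 0) * h j i) = (\<Sum>i<n. c i * h i i)" for c :: "nat \<Rightarrow> complex" and h
    by (intro sum.cong refl) (simp add: if_distrib[of "\<lambda>z. z * _"] cong: if_cong)
  have T_le: "\<bar>qf n T v\<bar> \<le> sqn n v" for v
  proof -
    have "bform n T v v = (\<Sum>i<n. \<Sum>j<n. (if i = j then complex_of_real (sgn (x i)) else 0) * (cnj (v i) * v j)) + bform n T2 v v"
      unfolding bform_def T_def sum.distrib[symmetric] by (intro sum.cong refl) (simp add: algebra_simps)
    also have "\<dots> = (\<Sum>i<n. complex_of_real (sgn (x i)) * (cnj (v i) * v i)) + bform n T2 v v"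
      by (intro arg_cong2[of _ _ _ _ "(+)"] refl sum.cong) (simp add: if_distrib[of "\<lambda>z. z * _"] cong: if_cong)
    also have "(\<Sum>i<n. complex_of_real (sgn (x i)) * (cnj (v i) * v i)) = complex_of_real (\<Sum>i<n. sgn (x i) * (cmod (v i))\<^sup>2)"
      unfolding cnj_mult_self by simp
    also have "bform n T2 v v = bform n T2 (out v) (out v)"
      unfolding bform_def out_def by (intro sum.cong refl) (auto simp: T2R)
    finally have "qf n T v = (\<Sum>i<n. sgn (x i) * (cmod (v i))\<^sup>2) + qf n T2 (out v)" by simp
    moreover have "\<bar>\<Sum>i<n. sgn (x i) * (cmod (v i))\<^sup>2\<bar> \<le> (\<Sum>i<n. if i \<in> R then (cmod (v i))\<^sup>2 else 0)"
      by (rule order_trans[OF sum_abs], intro sum_mono) (auto simp: R_def sgn_if)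
    moreover have "(\<Sum>i<n. if i \<in> R then (cmod (v i))\<^sup>2 else 0) = (\<Sum>i\<in>R. (cmod (v i))\<^sup>2)"
      using R by (simp add: sum.If_cases Int_absorb1)
    moreover have "\<bar>qf n T2 (out v)\<bar> \<le> 1 * sqn n (out v)"
      using eigsys_qf_bound[OF T2 real_sgn_le_1] .
    ultimately show ?thesis unfolding split_sqn[of v] by linarith
  qed
  have trace_prod_T2: "Re (trace_prod n T2 Z) = (\<Sum>k<n. \<bar>b k\<bar>)"
  proof -
    have "trace_prod n T2 Z = trace_prod n T2 B"
      unfolding trace_prod_def by (intro sum.cong refl) (auto simp: B_def T2R)
    then have "Re (trace_prod n T2 Z) = (\<Sum>k<n. b k * qf n T2 (g k))" using Re_tp_eigsys[OF g] by simp
    also have "\<dots> = (\<Sum>k<n. \<bar>b k\<bar>)"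
      by (intro sum.cong refl) (simp add: eigsys_bform_basis[OF T2] abs_sgn)
    finally show ?thesis .
  qed
  let ?W = "\<lambda>i j. (if i = j then complex_of_real (x i) else 0) + Z i j"
  have bR: "(\<Sum>k<n. \<bar>b k\<bar>) \<le> (\<Sum>i\<in>R. cmod (Z i i))"
  proof -
    have "trace_prod n T ?W = (\<Sum>i<n. \<Sum>j<n. (if i = j then complex_of_real (x i) else 0) * T j i) + trace_prod n T Z"
      unfolding trace_prod_def sum.distrib[symmetric] by (intro sum.cong refl) (auto simp: algebra_simps)
    also have "(\<Sum>i<n. \<Sum>j<n. (if i = j then complex_of_real (x i) else 0) * T j i) = (\<Sum>i<n. complex_of_real (x i) * T i i)"
      by (rule dsum)
    also have "\<dots> = complex_of_real (\<Sum>i<n. \<bar>x i\<bar>)"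
      unfolding of_real_sum T_def
    proof (intro sum.cong refl)
      fix i assume "i \<in> {..<n}"
      then have "x i = 0 \<or> T2 i i = 0" using T2R[of i i] by (auto simp: R_def)
      then show "complex_of_real (x i) * ((if i = i then complex_of_real (sgn (x i)) else 0) + T2 i i) = complex_of_real \<bar>x i\<bar>"
        by (auto simp: abs_sgn[of "x i"] simp flip: of_real_mult)
    qed
    also have "trace_prod n T Z = (\<Sum>i<n. \<Sum>j<n. (if i = j then complex_of_real (sgn (x i)) else 0) * Z j i) + trace_prod n T2 Z"
      unfolding trace_prod_def T_def sum.distrib[symmetric] by (simp add: algebra_simps)
    also have "(\<Sum>i<n. \<Sum>j<n. (if i = j then complex_of_real (sgn (x i)) else 0) * Z j i) = (\<Sum>i<n. complex_of_real (sgn (x i)) * Z i i)"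
      by (rule dsum)
    finally have eq: "Re (trace_prod n T ?W) = (\<Sum>i<n. \<bar>x i\<bar>) + (\<Sum>i<n. sgn (x i) * Re (Z i i)) + (\<Sum>k<n. \<bar>b k\<bar>)"
      using trace_prod_T2 by simp
    have "\<bar>\<Sum>i<n. sgn (x i) * Re (Z i i)\<bar> \<le> (\<Sum>i<n. if i \<in> R then cmod (Z i i) else 0)"
      by (rule order_trans[OF sum_abs], intro sum_mono) (auto simp: R_def sgn_if abs_Re_le_cmod)
    also have "\<dots> = (\<Sum>i\<in>R. cmod (Z i i))"
      using R by (simp add: sum.If_cases Int_absorb1)
    finally have 1: "\<bar>\<Sum>i<n. sgn (x i) * Re (Z i i)\<bar> \<le> (\<Sum>i\<in>R. cmod (Z i i))" .
    have "Re (trace_prod n T ?W) \<le> (\<Sum>k<n. \<bar>y k\<bar>)"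
      unfolding Re_tp_eigsys[OF W]
    proof (intro sum_mono)
      fix k assume "k \<in> {..<n}"
      then have "\<bar>qf n T (f k)\<bar> \<le> 1" using T_le[of "f k"] onb_sqn1[OF eigsys_onb[OF W]] by simp
      then have "\<bar>y k * qf n T (f k)\<bar> \<le> \<bar>y k\<bar>" by (simp add: abs_mult mult_left_le)
      then show "y k * qf n T (f k) \<le> \<bar>y k\<bar>" by linarith
    qed
    with eq 1 yx show ?thesis by linarith
  qed
  define S where "S = eig_mat n u (\<lambda>k. sgn (z k))"
  have S: "eigsys n S u (\<lambda>k. sgn (z k))" unfolding S_def using Z by (intro eigsys_eig_mat) (rule eigsys_onb)
  define S' where "S' i j = (if i \<in> R \<or> j \<in> R then 0 else S i j)" for i j
  have tpS: "Re (trace_prod n S Z) = (\<Sum>k<n. \<bar>z k\<bar>)"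
    unfolding Re_tp_eigsys[OF Z] by (intro sum.cong refl) (simp add: eigsys_bform_basis[OF S] abs_sgn)
  \<comment> \<open>Duality for \<open>Z\<close> itself, cut in two: the entries with both indices
    outside \<open>R\<close>, and those with some index in \<open>R\<close>. There are no mixed
    terms.\<close>
  have "trace_prod n S Z = trace_prod n S' B + (\<Sum>i<n. \<Sum>j<n. (S i j - S' i j) * (Z j i - B j i))"
    unfolding trace_prod_def sum.distrib[symmetric] by (intro sum.cong refl) (auto simp: S'_def B_def)
  then have split: "(\<Sum>k<n. \<bar>z k\<bar>) = Re (trace_prod n S' B) + Re (\<Sum>i<n. \<Sum>j<n. (S i j - S' i j) * (Z j i - B j i))"
    using tpS by simp
  have p1: "Re (trace_prod n S' B) \<le> (\<Sum>k<n. \<bar>b k\<bar>)"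
    unfolding Re_tp_eigsys[OF g]
  proof (intro sum_mono)
    fix k assume "k \<in> {..<n}"
    have "bform n S' (g k) (g k) = bform n S (out (g k)) (out (g k))"
      unfolding bform_def out_def S'_def by (intro sum.cong refl) auto
    then have "\<bar>qf n S' (g k)\<bar> \<le> 1 * sqn n (out (g k))"
      using eigsys_qf_bound[OF S real_sgn_le_1, of "out (g k)"] by simp
    also have "\<dots> \<le> 1" using out_le[of "g k"] onb_sqn1[OF eigsys_onb[OF g], of k] \<open>k \<in> {..<n}\<close> by simp
    finally have "\<bar>b k * qf n S' (g k)\<bar> \<le> \<bar>b k\<bar>" by (simp add: abs_mult mult_left_le)
    then show "b k * qf n S' (g k) \<le> \<bar>b k\<bar>" by linarith
  qed
  define q where "q = (\<Sum>k<n. (z k)\<^sup>2)"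
  have q: "q \<ge> 0" by (simp add: q_def sum_nonneg)
  have Zq: "(\<Sum>i<n. \<Sum>j<n. (cmod (Z i j))\<^sup>2) = q"
  proof -
    have "bform n Z (\<lambda>i. if i = k then 1 else 0) (\<lambda>i. if i = l then 1 else 0) = Z k l" if "k < n" "l < n" for k l
    proof -
      have "bform n Z (\<lambda>i. if i = k then 1 else 0) (\<lambda>i. if i = l then 1 else 0) = (\<Sum>i<n. \<Sum>j<n. if l = j then (if k = i then Z k l else 0) else 0)"
        unfolding bform_def by (intro sum.cong refl) auto
      then show ?thesis using that by simp
    qed
    then show ?thesis using eigsys_frobenius[OF Z onb_std] by (simp add: q_def)
  qed
  have colS: "(\<Sum>j<n. (cmod (S j i))\<^sup>2) \<le> 1" if i: "i < n" for i
  proof -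
    have "(\<Sum>j<n. (cmod (S j i))\<^sup>2) = sqn n (\<lambda>j. \<Sum>k<n. (complex_of_real (sgn (z k)) * cnj (u k i)) * u k j)"
      unfolding sqn_def S_def eig_mat_def by (simp add: mult_ac)
    also have "\<dots> = (\<Sum>k<n. (cmod (complex_of_real (sgn (z k)) * cnj (u k i)))\<^sup>2)"
      unfolding onb_sqn[OF eigsys_onb[OF Z]] ip_sum_right
    proof (intro sum.cong refl)
      fix k assume k: "k \<in> {..<n}"
      have "(\<Sum>k'<n. complex_of_real (sgn (z k')) * cnj (u k' i) * ip n (u k) (u k')) = (\<Sum>k'<n. if k = k' then complex_of_real (sgn (z k)) * cnj (u k i) else 0)"
        using k by (intro sum.cong) (auto simp: onb_ip[OF eigsys_onb[OF Z]])
      then show "(cmod (\<Sum>k'<n. complex_of_real (sgn (z k')) * cnj (u k' i) * ip n (u k) (u k')))\<^sup>2 = (cmod (complex_of_real (sgn (z k)) * cnj (u k i)))\<^sup>2"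
        using k by simp
    qed
    also have "\<dots> \<le> (\<Sum>k<n. (cmod (u k i))\<^sup>2)"
      by (intro sum_mono) (auto simp: norm_mult sgn_if)
    also have "\<dots> = 1"
    proof -
      have "complex_of_real (\<Sum>k<n. (cmod (u k i))\<^sup>2) = 1"
        using onb_complete[OF eigsys_onb[OF Z] i i] unfolding cnj_mult_self of_real_sum by simp
      then show ?thesis using of_real_eq_1_iff by blast
    qed
    finally show ?thesis .
  qed
  have hS: "cmod (S i j) = cmod (S j i)" if "i < n" "j < n" for i j
    using hermD[OF eigsys_herm[OF S] that] by (metis complex_mod_cnj)
  \<comment> \<open>The entries touching \<open>R\<close> fill at most \<open>r\<close> rows and
    \<open>r\<close> columns, each of Euclidean norm at most 1.\<close>
  have Sq: "(\<Sum>i<n. \<Sum>j<n. (cmod (S i j - S' i j))\<^sup>2) \<le> 2 * real r"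
  proof -
    have "(\<Sum>i<n. \<Sum>j<n. (cmod (S i j - S' i j))\<^sup>2) \<le>
       (\<Sum>i<n. \<Sum>j<n. (if i \<in> R then (cmod (S j i))\<^sup>2 else 0) + (if j \<in> R then (cmod (S i j))\<^sup>2 else 0))"
      by (intro sum_mono) (auto simp: S'_def hS)
    also have "\<dots> = (\<Sum>i<n. \<Sum>j<n. (if i \<in> R then (cmod (S j i))\<^sup>2 else 0)) + (\<Sum>j<n. \<Sum>i<n. (if j \<in> R then (cmod (S i j))\<^sup>2 else 0))"
      unfolding sum.distrib by (intro arg_cong2[of _ _ _ _ "(+)"] refl sum.swap)
    also have "\<dots> = 2 * (\<Sum>i<n. if i \<in> R then (\<Sum>j<n. (cmod (S j i))\<^sup>2) else 0)"
    proof -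
      have "(\<Sum>j<n. if i \<in> R then (cmod (S j i))\<^sup>2 else 0) = (if i \<in> R then (\<Sum>j<n. (cmod (S j i))\<^sup>2) else 0)" for i
        by simp
      then show ?thesis by simp
    qed
    also have "(\<Sum>i<n. if i \<in> R then (\<Sum>j<n. (cmod (S j i))\<^sup>2) else 0) = (\<Sum>i\<in>R. \<Sum>j<n. (cmod (S j i))\<^sup>2)"
      using R by (simp add: sum.If_cases Int_absorb1)
    also have "\<dots> \<le> (\<Sum>i\<in>R. 1)" using R by (intro sum_mono colS) auto
    finally show ?thesis using R by simp
  qed
  have Bq: "(\<Sum>i<n. \<Sum>j<n. (cmod (Z j i - B j i))\<^sup>2) \<le> q"
  proof -
    have "(\<Sum>i<n. \<Sum>j<n. (cmod (Z j i - B j i))\<^sup>2) \<le> (\<Sum>i<n. \<Sum>j<n. (cmod (Z j i))\<^sup>2)"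
      by (intro sum_mono) (auto simp: B_def)
    then show ?thesis using Zq by (subst (asm) (2) sum.swap) simp
  qed
  have p2: "Re (\<Sum>i<n. \<Sum>j<n. (S i j - S' i j) * (Z j i - B j i)) \<le> sqrt (2 * real r) * sqrt q"
  proof -
    let ?s = "\<lambda>p. cmod (S (fst p) (snd p) - S' (fst p) (snd p))"
    let ?t = "\<lambda>p. cmod (Z (snd p) (fst p) - B (snd p) (fst p))"
    have "Re (\<Sum>i<n. \<Sum>j<n. (S i j - S' i j) * (Z j i - B j i)) \<le> cmod (\<Sum>i<n. \<Sum>j<n. (S i j - S' i j) * (Z j i - B j i))"
      by (rule complex_Re_le_cmod)
    also have "\<dots> \<le> (\<Sum>p\<in>{..<n}\<times>{..<n}. ?s p * ?t p)"
      unfolding sum.cartesian_product by (rule order_trans[OF norm_sum]) (simp add: norm_mult split_def)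
    also have "\<dots> \<le> sqrt ((\<Sum>p\<in>{..<n}\<times>{..<n}. (?s p)\<^sup>2) * (\<Sum>p\<in>{..<n}\<times>{..<n}. (?t p)\<^sup>2))"
      by (rule real_le_rsqrt) (rule Cauchy_Schwarz_ineq_sum)
    also have "\<dots> \<le> sqrt (2 * real r * q)"
    proof (intro real_sqrt_le_mono mult_mono sum_nonneg)
      show "(\<Sum>p\<in>{..<n}\<times>{..<n}. (?s p)\<^sup>2) \<le> 2 * real r"
        using Sq unfolding sum.cartesian_product by (simp add: split_def)
      show "(\<Sum>p\<in>{..<n}\<times>{..<n}. (?t p)\<^sup>2) \<le> q"
        using Bq unfolding sum.cartesian_product by (simp add: split_def)
    qed auto
    finally show ?thesis by (simp add: real_sqrt_mult)
  qed
  have p3: "(\<Sum>i\<in>R. cmod (Z i i)) \<le> sqrt (real r) * sqrt q"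
  proof -
    have "(\<Sum>i\<in>R. cmod (Z i i) * 1)\<^sup>2 \<le> (\<Sum>i\<in>R. (cmod (Z i i))\<^sup>2) * (\<Sum>i\<in>R. 1\<^sup>2)"
      by (rule Cauchy_Schwarz_ineq_sum)
    also have "\<dots> \<le> q * real r"
    proof (intro mult_mono)
      have "(\<Sum>i\<in>R. (cmod (Z i i))\<^sup>2) \<le> (\<Sum>i<n. (cmod (Z i i))\<^sup>2)" using R by (intro sum_mono2) auto
      also have "\<dots> \<le> (\<Sum>i<n. \<Sum>j<n. (cmod (Z i j))\<^sup>2)"
        by (intro sum_mono) (auto intro!: member_le_sum[of _ "{..<n}"])
      finally show "(\<Sum>i\<in>R. (cmod (Z i i))\<^sup>2) \<le> q" using Zq by simp
    qed (use R q in \<open>auto simp: sum_nonneg\<close>)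
    finally have "(\<Sum>i\<in>R. cmod (Z i i)) \<le> sqrt (real r * q)" 
      by (intro real_le_rsqrt) (simp add: mult.commute)
    then show ?thesis by (simp add: real_sqrt_mult)
  qed
  have le: "(\<Sum>k<n. \<bar>z k\<bar>) \<le> (1 + sqrt 2) * (sqrt (real r) * sqrt q)"
    using split p1 p2 p3 bR by (simp add: real_sqrt_mult algebra_simps)
  \<comment> \<open>The square of \<open>1 + sqrt 2\<close> is \<open>3 + 2 * sqrt 2\<close>; this
    bound on the root brings it to the constant 6 of the cone.\<close>
  have s2: "sqrt 2 \<le> 3 / 2" by (rule real_le_lsqrt) (auto simp: power2_eq_square)
  have "(\<Sum>k<n. \<bar>z k\<bar>)\<^sup>2 \<le> ((1 + sqrt 2) * (sqrt (real r) * sqrt q))\<^sup>2"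
    using le by (intro power_mono) (auto simp: sum_nonneg)
  also have "\<dots> = (3 + 2 * sqrt 2) * (real r * q)"
    using q by (simp add: power_mult_distrib power2_sum)
  also have "\<dots> \<le> 6 * (real r * q)" using s2 q by (intro mult_right_mono) auto
  finally show ?thesis by (simp add: q_def)
qed

text \<open>In an eigenbasis of \<open>X\<close> the matrix of \<open>X\<close> is diagonal with at
  most \<open>r\<close> nonzero entries. Rotating \<open>Y\<close> and the difference along with it
  leaves their eigenvalues unchanged.\<close>

lemma cone_bound:
  assumes X: "X \<in> hermitian_mats n" and Y: "Y \<in> hermitian_mats n"
    and rk: "vec_space.rank n X \<le> r" and le: "schatten_norm 1 Y \<le> schatten_norm 1 X"
    and Z: "eigsys n (\<lambda>i j. fun_of_mat Y i j - fun_of_mat X i j) u z"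
  shows "(\<Sum>k<n. \<bar>z k\<bar>)\<^sup>2 \<le> 6 * real r * (\<Sum>k<n. (z k)\<^sup>2)"
proof -
  obtain e x where x: "eigsys n (fun_of_mat X) e x" using X spectral_theorem hermitian_mats_iff by blast
  obtain f y where y: "eigsys n (fun_of_mat Y) f y" using Y spectral_theorem hermitian_mats_iff by blast
  note e = eigsys_onb[OF x]
  let ?Z = "\<lambda>i j. bform n (\<lambda>i j. fun_of_mat Y i j - fun_of_mat X i j) (e i) (e j)"
  have "eigsys n (\<lambda>i j. (if i = j then complex_of_real (x i) else 0) + ?Z i j) (\<lambda>k i. ip n (e i) (f k)) y"
  proof -
    have "(if i = j then complex_of_real (x i) else 0) + ?Z i j = bform n (fun_of_mat Y) (e i) (e j)"
      if "i < n" "j < n" for i j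
      unfolding eigsys_bform_basis[OF x that, symmetric] bform_def sum.distrib[symmetric]
      by (intro sum.cong refl) (simp add: algebra_simps)
    then show ?thesis using eigsys_change_basis[OF y e] unfolding eigsys_def by simp
  qed
  then show ?thesis
    using cone_bound_diagonal[OF eigsys_change_basis[OF Z e]] card_eigenvalues_le_rank[OF X x] rk le
    unfolding schatten_norm_1[OF X x] schatten_norm_1[OF Y y] by auto
qed

section \<open>Expectations over finite product distributions\<close>

text \<open>Every sampling law here has finite support, so expectations are finite sums and suprema
  raise no measurability question. The head of the list is drawn first; induction on the sample size
  is conditioning on that draw.\<close>

fun expect :: "'a set \<Rightarrow> ('a \<Rightarrow> real) \<Rightarrow> nat \<Rightarrow> ('a list \<Rightarrow> real) \<Rightarrow> real" where
  "expect I p 0 F = F []"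
| "expect I p (Suc m) F = (\<Sum>i\<in>I. p i * expect I p m (\<lambda>xs. F (i # xs)))"

definition weights :: "'a set \<Rightarrow> ('a \<Rightarrow> real) \<Rightarrow> bool" where
  "weights I p \<longleftrightarrow> finite I \<and> (\<forall>i\<in>I. 0 \<le> p i) \<and> sum p I = 1"

lemma expect_mono:
  assumes "weights I p" "\<And>xs. length xs = m \<Longrightarrow> set xs \<subseteq> I \<Longrightarrow> F xs \<le> G xs"
  shows "expect I p m F \<le> expect I p m G"
  using assms(2)
proof (induction m arbitrary: F G)
  case (Suc m)
  show ?case unfolding expect.simps
    using assms(1) by (intro sum_mono mult_left_mono Suc.IH Suc.prems) (auto simp: weights_def)
qed simp

lemma expect_cong:
  "weights I p \<Longrightarrow> (\<And>xs. length xs = m \<Longrightarrow> set xs \<subseteq> I \<Longrightarrow> F xs = G xs) \<Longrightarrow> expect I p m F = expect I p m G"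
  by (intro antisym expect_mono) auto

lemma expect_const: "weights I p \<Longrightarrow> expect I p m (\<lambda>_. c) = c"
  by (induction m) (simp_all add: weights_def flip: sum_distrib_right)

lemma expect_add: "expect I p m (\<lambda>xs. F xs + G xs) = expect I p m F + expect I p m G"
  by (induction m arbitrary: F G) (simp_all add: distrib_left sum.distrib)

lemma expect_cmult: "expect I p m (\<lambda>xs. c * F xs) = c * expect I p m F"
  by (induction m arbitrary: F) (simp_all add: sum_distrib_left mult_ac)

lemma expect_uminus: "expect I p m (\<lambda>xs. - F xs) = - expect I p m F"
  using expect_cmult[of I p m "-1" F] by simp

lemma expect_diff: "expect I p m (\<lambda>xs. F xs - G xs) = expect I p m F - expect I p m G"
  using expect_add[of I p m F "\<lambda>xs. - G xs"] by (simp add: expect_uminus)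

lemma expect_divide: "expect I p m (\<lambda>xs. F xs / c) = expect I p m F / c"
  using expect_cmult[of I p m "inverse c" F] by (simp add: field_simps)

lemma expect_sum: "expect I p m (\<lambda>xs. \<Sum>j\<in>J. F j xs) = (\<Sum>j\<in>J. expect I p m (F j))"
proof (induction J rule: infinite_finite_induct)
  case (infinite J)
  then show ?case using expect_cmult[of I p m 0 "\<lambda>_. 0"] by simp
next
  case empty
  then show ?case using expect_cmult[of I p m 0 "\<lambda>_. 0"] by simp
qed (simp add: expect_add)

lemma expect_sum_list:
  assumes "weights I p"
  shows "expect I p m (\<lambda>xs. \<Sum>x\<leftarrow>xs. f x) = real m * (\<Sum>i\<in>I. p i * f i)"
proof (induction m)
  case (Suc m)
  have "expect I p (Suc m) (\<lambda>xs. \<Sum>x\<leftarrow>xs. f x) = (\<Sum>i\<in>I. p i * f i + p i * (real m * (\<Sum>i\<in>I. p i * f i)))"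
    using assms by (simp add: expect_add expect_const Suc.IH distrib_left)
  also have "\<dots> = real (Suc m) * (\<Sum>i\<in>I. p i * f i)"
    using assms unfolding sum.distrib sum_distrib_right[symmetric] by (simp add: weights_def algebra_simps)
  finally show ?case .
qed simp

section \<open>Concentration of functions with bounded differences\<close>

text \<open>When \<open>y\<close> is centred, the linear term vanishes in expectation and only the
  exponential of the square remains, one factor per coordinate.\<close>

lemma exp_le_quadratic:
  fixes y :: real assumes "\<bar>y\<bar> \<le> 1" shows "exp y \<le> y + exp (y\<^sup>2)"
proof -
  have "exp y \<le> 1 + y + y\<^sup>2"
  proof (cases "y \<ge> 0")
    case True
    then show ?thesis using assms by (intro exp_bound) auto
  next
    case False
    define x where "x = - y"
    have x: "x > 0" using False by (simp add: x_def)
    have e: "1 + x + x\<^sup>2 / 2 \<le> exp x" using exp_lower_Taylor_quadratic[of x] x by simp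
    have pos: "1 - x + x\<^sup>2 > 0"
    proof -
      have "1 - x + x\<^sup>2 = (x - 1/2)\<^sup>2 + 3/4" by (simp add: power2_eq_square algebra_simps)
      then show ?thesis by (metis add_nonneg_pos zero_le_power2 zero_less_divide_iff zero_less_numeral)
    qed
    \<comment> \<open>The claimed bound times a Taylor polynomial below \<open>exp x\<close> is at
      least 1, which is the claim for the reciprocal.\<close>
    have "1 \<le> 1 + (x\<^sup>2 + x^3 + x^4) / 2" using x by simp
    also have "\<dots> = (1 - x + x\<^sup>2) * (1 + x + x\<^sup>2 / 2)" by (simp add: power2_eq_square power3_eq_cube power4_eq_xxxx field_simps)
    also have "\<dots> \<le> (1 - x + x\<^sup>2) * exp x" using e pos by (intro mult_left_mono) auto
    finally have "exp (- x) \<le> 1 - x + x\<^sup>2" by (simp add: exp_minus field_simps)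
    then show ?thesis by (simp add: x_def)
  qed
  then show ?thesis using exp_ge_add_one_self[of "y\<^sup>2"] by linarith
qed

text \<open>McDiarmid's argument. \<open>g i\<close> is the conditional mean given the first draw
  \<open>i\<close>; it differs from the total mean \<open>M\<close> by at most 1. The remaining
  draws are covered by the induction hypothesis for the function with \<open>i\<close>
  fixed.\<close>

lemma bounded_differences_exp_moment:
  assumes w: "weights I p" and t: "0 \<le> t" "t \<le> 1"
    and F: "\<And>as bs i j. \<bar>F (as @ i # bs) - F (as @ j # bs)\<bar> \<le> 1"
  shows "expect I p m (\<lambda>xs. exp (t * (F xs - expect I p m F))) \<le> exp (t\<^sup>2 * real m)"
  using F
proof (induction m arbitrary: F)
  case (Suc m)
  define g where "g i = expect I p m (\<lambda>xs. F (i # xs))" for i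
  define M where "M = (\<Sum>i\<in>I. p i * g i)"
  have gg: "\<bar>g i - g j\<bar> \<le> 1" for i j
  proof -
    have "\<bar>F (i # xs) - F (j # xs)\<bar> \<le> 1" for xs using Suc.prems[of "[]" i xs j] by simp
    then have "g i - g j \<le> expect I p m (\<lambda>_. 1)" "g j - g i \<le> expect I p m (\<lambda>_. 1)"
      unfolding g_def expect_diff[symmetric] by (auto intro!: expect_mono[OF w] simp: abs_le_iff)
    then show ?thesis by (simp add: expect_const[OF w])
  qed
  have gM: "\<bar>g i - M\<bar> \<le> 1" for i
  proof -
    have "g i - M = (\<Sum>j\<in>I. p j * (g i - g j))"
      using w by (simp add: M_def weights_def right_diff_distrib sum_subtractf flip: sum_distrib_right)
    also have "\<bar>\<dots>\<bar> \<le> (\<Sum>j\<in>I. p j * 1)"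
      using w gg by (intro order_trans[OF sum_abs] sum_mono) (auto simp: abs_mult weights_def intro!: mult_left_le)
    finally show ?thesis using w by (simp add: weights_def)
  qed
  have IH: "expect I p m (\<lambda>xs. exp (t * (F (i # xs) - g i))) \<le> exp (t\<^sup>2 * real m)" for i
    unfolding g_def
  proof (rule Suc.IH)
    show "\<bar>F (i # as @ a # bs) - F (i # as @ j # bs)\<bar> \<le> 1" for as a bs j
      using Suc.prems[of "i # as" a bs j] by simp
  qed
  have "expect I p (Suc m) (\<lambda>xs. exp (t * (F xs - expect I p (Suc m) F)))
      = (\<Sum>i\<in>I. p i * (exp (t * (g i - M)) * expect I p m (\<lambda>xs. exp (t * (F (i # xs) - g i)))))"
  proof -
    have "expect I p m (\<lambda>xs. exp (t * (F (i # xs) - M))) = exp (t * (g i - M)) * expect I p m (\<lambda>xs. exp (t * (F (i # xs) - g i)))" for i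
      unfolding expect_cmult[symmetric] exp_add[symmetric] by (simp add: algebra_simps)
    moreover have "expect I p (Suc m) F = M" by (simp add: M_def g_def)
    ultimately show ?thesis by simp
  qed
  also have "\<dots> \<le> (\<Sum>i\<in>I. p i * (exp (t * (g i - M)) * exp (t\<^sup>2 * real m)))"
    using w by (intro sum_mono mult_left_mono IH) (auto simp: weights_def)
  also have "\<dots> = exp (t\<^sup>2 * real m) * (\<Sum>i\<in>I. p i * exp (t * (g i - M)))"
    by (simp add: sum_distrib_left mult_ac)
  also have "(\<Sum>i\<in>I. p i * exp (t * (g i - M))) \<le> (\<Sum>i\<in>I. p i * (t * (g i - M) + exp (t\<^sup>2)))"
  proof (intro sum_mono mult_left_mono)
    fix i assume "i \<in> I"
    have le: "\<bar>t * (g i - M)\<bar> \<le> t" using gM[of i] t by (simp add: abs_mult mult_left_le)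
    then have "exp (t * (g i - M)) \<le> t * (g i - M) + exp ((t * (g i - M))\<^sup>2)"
      using t by (intro exp_le_quadratic) auto
    also have "exp ((t * (g i - M))\<^sup>2) \<le> exp (t\<^sup>2)"
      using le t by (simp add: abs_le_square_iff[symmetric])
    finally show "exp (t * (g i - M)) \<le> t * (g i - M) + exp (t\<^sup>2)" by simp
  qed (use w in \<open>auto simp: weights_def\<close>)
  also have "\<dots> = t * (\<Sum>i\<in>I. p i * g i) - t * M * sum p I + exp (t\<^sup>2) * sum p I"
    by (simp add: sum.distrib sum_subtractf sum_distrib_left sum_distrib_right algebra_simps)
  also have "\<dots> = exp (t\<^sup>2)" using w by (simp add: M_def weights_def)
  finally show ?case by (simp add: exp_add[symmetric] algebra_simps)
qed simp

lemma bounded_differences_tail: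
  assumes w: "weights I p" and t: "0 \<le> t" "t \<le> 1"
    and F: "\<And>as bs i j. \<bar>F (as @ i # bs) - F (as @ j # bs)\<bar> \<le> 1"
  shows "expect I p m (\<lambda>xs. if F xs \<ge> expect I p m F + t * real m then 1 else 0) \<le> exp (- (t\<^sup>2 / 4) * real m)"
proof -
  let ?E = "expect I p m F"
  \<comment> \<open>Markov's inequality for the exponential moment at parameter
    \<open>t / 2\<close>, the minimiser of s^2 - s t over s.\<close>
  have "expect I p m (\<lambda>xs. if F xs \<ge> ?E + t * real m then 1 else 0)
      \<le> expect I p m (\<lambda>xs. exp (- (t / 2) * (t * real m)) * exp (t / 2 * (F xs - ?E)))"
  proof (rule expect_mono[OF w])
    fix xs
    have "0 \<le> - (t / 2) * (t * real m) + t / 2 * (F xs - ?E)" if "F xs \<ge> ?E + t * real m"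
    proof -
      have "0 \<le> t / 2 * (F xs - ?E - t * real m)" using t that by simp
      then show ?thesis by (simp add: algebra_simps)
    qed
    then show "(if F xs \<ge> ?E + t * real m then 1 else 0) \<le> exp (- (t / 2) * (t * real m)) * exp (t / 2 * (F xs - ?E))"
      unfolding exp_add[symmetric] by auto
  qed
  also have "\<dots> \<le> exp (- (t / 2) * (t * real m)) * exp ((t / 2)\<^sup>2 * real m)"
    unfolding expect_cmult using t by (intro mult_left_mono bounded_differences_exp_moment w F) auto
  also have "\<dots> = exp (- (t\<^sup>2 / 4) * real m)"
    unfolding exp_add[symmetric] by (simp add: power2_eq_square field_simps)
  finally show ?thesis .
qed

section \<open>Rademacher averages\<close>

abbreviation sign_avg :: "nat \<Rightarrow> (real list \<Rightarrow> real) \<Rightarrow> real" where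
  "sign_avg \<equiv> expect {1, - 1} (\<lambda>_. 1 / 2)"

lemma weights_sign: "weights {1, - 1 :: real} (\<lambda>_. 1 / 2)"
  by (simp add: weights_def)

lemma sign_avg_Suc: "sign_avg (Suc m) F = (sign_avg m (\<lambda>ss. F (1 # ss)) + sign_avg m (\<lambda>ss. F (- 1 # ss))) / 2"
  by simp

lemma sign_avg_uminus: "sign_avg m (\<lambda>ss. F (map uminus ss)) = sign_avg m F"
proof (induction m arbitrary: F)
  case (Suc m)
  show ?case unfolding sign_avg_Suc list.map Suc.IH[of "\<lambda>ss. F (- 1 # ss)"] 
    using Suc.IH[of "\<lambda>ss. F (1 # ss)"] by simp
qed simp

text \<open>Averages over the sign at position \<open>j\<close> first, whatever stood there before.
  It isolates one summand of a Rademacher sum in \<open>khintchine_step\<close>.\<close>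

lemma sign_avg_resample:
  assumes "j < m" shows "sign_avg m F = sign_avg m (\<lambda>ss. (F (ss[j := 1]) + F (ss[j := - 1])) / 2)"
  using assms
proof (induction m arbitrary: F j)
  case (Suc m)
  show ?case
  proof (cases j)
    case 0
    then show ?thesis by (simp only: sign_avg_Suc list_update.simps nat.case expect_divide expect_add) simp
  next
    case (Suc k)
    then show ?thesis using Suc.IH[of k "\<lambda>ss. F (1 # ss)"] Suc.IH[of k "\<lambda>ss. F (- 1 # ss)"] Suc.prems
      unfolding sign_avg_Suc list_update.simps nat.case by simp
  qed
qed simp

section \<open>Suprema of processes: contraction and symmetrisation\<close>

text \<open>A real \<open>SUP\<close> is informative only for families bounded above. The two-sided
  condition is chosen because it is stable under multiplication by signs.\<close>

definition bdd_on :: "'z set \<Rightarrow> ('z \<Rightarrow> real) \<Rightarrow> bool" where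
  "bdd_on G f \<longleftrightarrow> (\<exists>B. \<forall>z\<in>G. \<bar>f z\<bar> \<le> B)"

lemma bdd_on_const: "bdd_on G (\<lambda>_. c)"
  by (auto simp: bdd_on_def)

lemma bdd_on_add:
  assumes "bdd_on G f" "bdd_on G g" shows "bdd_on G (\<lambda>z. f z + g z)"
proof -
  from assms obtain B C where "\<forall>z\<in>G. \<bar>f z\<bar> \<le> B" "\<forall>z\<in>G. \<bar>g z\<bar> \<le> C" unfolding bdd_on_def by blast
  then have "\<forall>z\<in>G. \<bar>f z + g z\<bar> \<le> B + C" by (meson abs_triangle_ineq add_mono order_trans)
  then show ?thesis unfolding bdd_on_def by blast
qed

lemma bdd_on_cmult:
  assumes "bdd_on G f" shows "bdd_on G (\<lambda>z. c * f z)"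
proof -
  from assms obtain B where "\<forall>z\<in>G. \<bar>f z\<bar> \<le> B" unfolding bdd_on_def by blast
  then have "\<forall>z\<in>G. \<bar>c * f z\<bar> \<le> \<bar>c\<bar> * B" by (auto simp: abs_mult mult_left_mono)
  then show ?thesis unfolding bdd_on_def by blast
qed

lemma bdd_on_diff: "bdd_on G f \<Longrightarrow> bdd_on G g \<Longrightarrow> bdd_on G (\<lambda>z. f z - g z)"
  using bdd_on_add[OF _ bdd_on_cmult[of G g "-1"], of f] by simp

lemma bdd_on_sum_list:
  "(\<And>x. x \<in> set xs \<Longrightarrow> bdd_on G (\<lambda>z. g z x)) \<Longrightarrow> bdd_on G (\<lambda>z. \<Sum>x\<leftarrow>xs. g z x)"
  by (induction xs) (auto intro: bdd_on_const bdd_on_add)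

lemma bdd_on_above: "bdd_on G f \<Longrightarrow> bdd_above (f ` G)"
  unfolding bdd_on_def by (auto simp: bdd_above_def abs_le_iff)

lemma SUP_upper: "bdd_on G f \<Longrightarrow> z \<in> G \<Longrightarrow> f z \<le> (SUP z\<in>G. f z :: real)"
  by (intro cSUP_upper bdd_on_above)

lemma SUP_le: "G \<noteq> {} \<Longrightarrow> (\<And>z. z \<in> G \<Longrightarrow> f z \<le> c) \<Longrightarrow> (SUP z\<in>G. f z :: real) \<le> c"
  by (rule cSUP_least)

text \<open>Merges two suprema into one condition on pairs, the form in which contraction compares
  two points of the index set.\<close>

lemma SUP_pair_le:
  fixes f g :: "'z \<Rightarrow> real"
  assumes G: "G \<noteq> {}" and "\<And>z z'. z \<in> G \<Longrightarrow> z' \<in> G \<Longrightarrow> f z + g z' \<le> c"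
  shows "(SUP z\<in>G. f z) + (SUP z\<in>G. g z) \<le> c"
proof -
  have "(SUP z\<in>G. f z) \<le> c - (SUP z\<in>G. g z)"
  proof (rule SUP_le[OF G])
    fix z assume z: "z \<in> G"
    have "(SUP z\<in>G. g z) \<le> c - f z" using assms(2)[OF z] by (intro SUP_le[OF G]) (simp add: le_diff_eq add.commute)
    then show "f z \<le> c - (SUP z\<in>G. g z)" by simp
  qed
  then show ?thesis by simp
qed

text \<open>One sign is treated at a time, while \<open>u\<close> carries the terms outside the
  remaining list. Averaging over a single sign leaves a difference of two values of \<phi>, at most
  the distance of their arguments; exchanging the two points supplies whichever sign that distance
  needs.\<close>

lemma contraction:
  fixes h :: "'z \<Rightarrow> 'a \<Rightarrow> real"
  assumes G: "G \<noteq> {}" and \<phi>: "\<And>a b. \<bar>\<phi> a - \<phi> b\<bar> \<le> \<bar>a - b\<bar>" 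
    and h: "\<And>x. x \<in> set xs \<Longrightarrow> bdd_on G (\<lambda>z. h z x)" and u: "bdd_on G u"
  shows "sign_avg (length xs) (\<lambda>ss. SUP z\<in>G. u z + (\<Sum>(s, x)\<leftarrow>zip ss xs. s * \<phi> (h z x)))
    \<le> sign_avg (length xs) (\<lambda>ss. SUP z\<in>G. u z + (\<Sum>(s, x)\<leftarrow>zip ss xs. s * h z x))"
  using h u
proof (induction xs arbitrary: u)
  case (Cons x xs)
  let ?n = "length xs"
  have hx: "bdd_on G (\<lambda>z. h z x)" using Cons.prems by simp
  have \<phi>x: "bdd_on G (\<lambda>z. \<phi> (h z x))"
  proof -
    from hx obtain B where B: "\<forall>z\<in>G. \<bar>h z x\<bar> \<le> B" unfolding bdd_on_def by blast
    have "\<bar>\<phi> (h z x)\<bar> \<le> \<bar>\<phi> 0\<bar> + B" if "z \<in> G" for z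
      using \<phi>[of "h z x" 0] B that by fastforce
    then show ?thesis unfolding bdd_on_def by blast
  qed
  define w where "w ss z = u z + (\<Sum>(s, x)\<leftarrow>zip ss xs. s * h z x)" for ss z
  have w: "bdd_on G (w ss)" for ss
    unfolding w_def using Cons.prems
    by (intro bdd_on_add bdd_on_sum_list) (auto split: prod.split simp: case_prod_beta dest!: set_zip_rightD intro!: bdd_on_cmult)
  have IH: "sign_avg ?n (\<lambda>ss. SUP z\<in>G. (u z + c * \<phi> (h z x)) + (\<Sum>(s, x)\<leftarrow>zip ss xs. s * \<phi> (h z x)))
     \<le> sign_avg ?n (\<lambda>ss. SUP z\<in>G. (u z + c * \<phi> (h z x)) + (\<Sum>(s, x)\<leftarrow>zip ss xs. s * h z x))" for c
    using Cons.prems \<phi>x by (intro Cons.IH bdd_on_add bdd_on_cmult) auto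
  have "sign_avg (Suc ?n) (\<lambda>ss. SUP z\<in>G. u z + (\<Sum>(s, x)\<leftarrow>zip ss (x # xs). s * \<phi> (h z x))) =
    (sign_avg ?n (\<lambda>ss. SUP z\<in>G. (u z + 1 * \<phi> (h z x)) + (\<Sum>(s, x)\<leftarrow>zip ss xs. s * \<phi> (h z x))) +
     sign_avg ?n (\<lambda>ss. SUP z\<in>G. (u z + (- 1) * \<phi> (h z x)) + (\<Sum>(s, x)\<leftarrow>zip ss xs. s * \<phi> (h z x)))) / 2"
    unfolding sign_avg_Suc by (simp add: algebra_simps)
  also have "\<dots> \<le> (sign_avg ?n (\<lambda>ss. SUP z\<in>G. (u z + 1 * \<phi> (h z x)) + (\<Sum>(s, x)\<leftarrow>zip ss xs. s * h z x)) +
     sign_avg ?n (\<lambda>ss. SUP z\<in>G. (u z + (- 1) * \<phi> (h z x)) + (\<Sum>(s, x)\<leftarrow>zip ss xs. s * h z x))) / 2"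
    by (intro divide_right_mono add_mono IH) auto
  also have "\<dots> = sign_avg ?n (\<lambda>ss. (SUP z\<in>G. w ss z + \<phi> (h z x)) + (SUP z\<in>G. w ss z - \<phi> (h z x))) / 2"
    unfolding expect_add w_def by (simp add: algebra_simps)
  also have "\<dots> \<le> sign_avg ?n (\<lambda>ss. (SUP z\<in>G. w ss z + h z x) + (SUP z\<in>G. w ss z - h z x)) / 2"
  proof (intro divide_right_mono expect_mono[OF weights_sign] SUP_pair_le[OF G])
    fix ss z z' assume z: "z \<in> G" "z' \<in> G"
    have 1: "w ss z + h z x \<le> (SUP z\<in>G. w ss z + h z x)" "w ss z' - h z' x \<le> (SUP z\<in>G. w ss z - h z x)"
      using z w hx by (auto intro!: SUP_upper bdd_on_add bdd_on_diff)
    have 2: "w ss z' + h z' x \<le> (SUP z\<in>G. w ss z + h z x)" "w ss z - h z x \<le> (SUP z\<in>G. w ss z - h z x)"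
      using z w hx by (auto intro!: SUP_upper bdd_on_add bdd_on_diff)
    \<comment> \<open>The bounds 1 and 2 belong to the pair and to the exchanged pair; one of them
      matches the sign of \<open>h z x - h z' x\<close>.\<close>
    show "w ss z + \<phi> (h z x) + (w ss z' - \<phi> (h z' x)) \<le> (SUP z\<in>G. w ss z + h z x) + (SUP z\<in>G. w ss z - h z x)"
      using 1 2 \<phi>[of "h z x" "h z' x"] by linarith
  qed simp
  also have "\<dots> = sign_avg (Suc ?n) (\<lambda>ss. SUP z\<in>G. u z + (\<Sum>(s, x)\<leftarrow>zip ss (x # xs). s * h z x))"
    unfolding sign_avg_Suc expect_add w_def by (simp add: algebra_simps)
  finally show ?case by simp
qed simp

text \<open>Exchanging the two independent draws at one position preserves their joint law and
  reverses the sign of their difference, so a random sign may be inserted there. \<open>u\<close>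
  carries the positions already treated.\<close>

lemma symmetrization_ghost:
  fixes g :: "'z \<Rightarrow> 'a \<Rightarrow> real"
  assumes w: "weights I p"
  shows "expect I p m (\<lambda>xs. expect I p m (\<lambda>ys. SUP z\<in>G. u z + (\<Sum>(x, y)\<leftarrow>zip xs ys. g z x - g z y)))
     = expect I p m (\<lambda>xs. expect I p m (\<lambda>ys. sign_avg m (\<lambda>ss. SUP z\<in>G. u z + (\<Sum>(s, x, y)\<leftarrow>zip ss (zip xs ys). s * (g z x - g z y)))))"
proof (induction m arbitrary: u)
  case (Suc m)
  define Q where "Q v = expect I p m (\<lambda>xs. expect I p m (\<lambda>ys. SUP z\<in>G. v z + (\<Sum>(x, y)\<leftarrow>zip xs ys. g z x - g z y)))" for v
  define R where "R v = expect I p m (\<lambda>xs. expect I p m (\<lambda>ys. sign_avg m (\<lambda>ss. SUP z\<in>G. v z + (\<Sum>(s, x, y)\<leftarrow>zip ss (zip xs ys). s * (g z x - g z y)))))" for v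
  have QR: "Q v = R v" for v unfolding Q_def R_def by (rule Suc.IH)
  define T where "T v = (\<Sum>i\<in>I. \<Sum>j\<in>I. p i * p j * v i j)" for v :: "'a \<Rightarrow> 'a \<Rightarrow> real"
  have L: "expect I p (Suc m) (\<lambda>xs. expect I p (Suc m) (\<lambda>ys. SUP z\<in>G. u z + (\<Sum>(x, y)\<leftarrow>zip xs ys. g z x - g z y)))
     = T (\<lambda>i j. Q (\<lambda>z. u z + (g z i - g z j)))"
    by (simp add: Q_def T_def expect_sum expect_cmult sum_distrib_left mult.assoc add.assoc, subst sum.swap, simp add: mult.left_commute)
  have Rt: "expect I p (Suc m) (\<lambda>xs. expect I p (Suc m) (\<lambda>ys. sign_avg (Suc m) (\<lambda>ss. SUP z\<in>G. u z + (\<Sum>(s, x, y)\<leftarrow>zip ss (zip xs ys). s * (g z x - g z y)))))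
     = T (\<lambda>i j. (R (\<lambda>z. u z + (g z i - g z j)) + R (\<lambda>z. u z + (g z j - g z i))) / 2)"
    unfolding expect.simps(2)[of I] sign_avg_Suc 
    by (simp add: R_def T_def expect_sum expect_cmult expect_add expect_divide sum_distrib_left mult.assoc add.assoc)
  have sym: "T (\<lambda>i j. v j i) = T v" for v unfolding T_def by (subst sum.swap) (simp add: mult.commute)
  have add: "T (\<lambda>i j. (v i j + v' i j) / 2) = (T v + T v') / 2" for v v'
    unfolding T_def by (simp add: sum.distrib algebra_simps add_divide_distrib sum_divide_distrib)
  show ?case unfolding L Rt QR add
    using sym[of "\<lambda>i j. R (\<lambda>z. u z + (g z i - g z j))"] by simp
qed simp

text \<open>A ghost sample \<open>ys\<close> represents the mean, and the supremum of an expectation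
  is at most the expectation of the supremum. Once signs are inserted, the two samples separate and
  contribute equally, because flipping all signs does not change their law; this is the factor
  2.\<close>

lemma symmetrization:
  fixes g :: "'z \<Rightarrow> 'a \<Rightarrow> real"
  assumes w: "weights I p" and G: "G \<noteq> {}" and g: "\<And>x. x \<in> I \<Longrightarrow> bdd_on G (\<lambda>z. g z x)"
  shows "expect I p m (\<lambda>xs. SUP z\<in>G. (\<Sum>x\<leftarrow>xs. g z x) - real m * (\<Sum>i\<in>I. p i * g z i))
    \<le> 2 * expect I p m (\<lambda>xs. sign_avg m (\<lambda>ss. SUP z\<in>G. \<Sum>(s, x)\<leftarrow>zip ss xs. s * g z x))"
proof -
  have b1: "bdd_on G (\<lambda>z. \<Sum>x\<leftarrow>xs. g z x)" if "set xs \<subseteq> I" for xs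
    using that g by (intro bdd_on_sum_list) auto
  have b2: "bdd_on G (\<lambda>z. \<Sum>(s, x)\<leftarrow>zip ss xs. s * g z x)" if "set xs \<subseteq> I" for ss xs
    using that g unfolding case_prod_beta
    by (intro bdd_on_sum_list bdd_on_cmult) (auto dest!: set_zip_rightD)
  have zip1: "(\<Sum>(x, y)\<leftarrow>zip xs ys. g z x - g z y) = (\<Sum>x\<leftarrow>xs. g z x) - (\<Sum>y\<leftarrow>ys. g z y)" 
    if "length xs = length ys" for xs ys z
    using that by (induction xs ys rule: list_induct2) auto
  have zip2: "(\<Sum>(s, x, y)\<leftarrow>zip ss (zip xs ys). s * (g z x - g z y)) = (\<Sum>(s, x)\<leftarrow>zip ss xs. s * g z x) + (\<Sum>(s, y)\<leftarrow>zip (map uminus ss) ys. s * g z y)"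
    if "length ss = length xs" "length xs = length ys" for ss xs ys z
    using that by (induction ss xs ys rule: list_induct3) (auto simp: algebra_simps)
  have "expect I p m (\<lambda>xs. SUP z\<in>G. (\<Sum>x\<leftarrow>xs. g z x) - real m * (\<Sum>i\<in>I. p i * g z i))
    \<le> expect I p m (\<lambda>xs. expect I p m (\<lambda>ys. SUP z\<in>G. 0 + (\<Sum>(x, y)\<leftarrow>zip xs ys. g z x - g z y)))"
  proof (intro expect_mono[OF w] SUP_le[OF G])
    fix xs z assume xs: "length xs = m" "set xs \<subseteq> I" and z: "z \<in> G"
    have "(\<Sum>x\<leftarrow>xs. g z x) - real m * (\<Sum>i\<in>I. p i * g z i) = expect I p m (\<lambda>ys. (\<Sum>x\<leftarrow>xs. g z x) - (\<Sum>y\<leftarrow>ys. g z y))"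
      by (simp add: expect_diff expect_const[OF w] expect_sum_list[OF w])
    also have "\<dots> \<le> expect I p m (\<lambda>ys. SUP z\<in>G. 0 + (\<Sum>(x, y)\<leftarrow>zip xs ys. g z x - g z y))"
    proof (rule expect_mono[OF w])
      fix ys assume ys: "length ys = m" "set ys \<subseteq> I"
      show "(\<Sum>x\<leftarrow>xs. g z x) - (\<Sum>y\<leftarrow>ys. g z y) \<le> (SUP z\<in>G. 0 + (\<Sum>(x, y)\<leftarrow>zip xs ys. g z x - g z y))"
        using xs ys by (simp add: zip1) (intro SUP_upper[OF _ z] bdd_on_diff b1; simp)
    qed
    finally show "(\<Sum>x\<leftarrow>xs. g z x) - real m * (\<Sum>i\<in>I. p i * g z i) \<le> \<dots>" .
  qed
  also have "\<dots> = expect I p m (\<lambda>xs. expect I p m (\<lambda>ys. sign_avg m (\<lambda>ss. SUP z\<in>G. 0 + (\<Sum>(s, x, y)\<leftarrow>zip ss (zip xs ys). s * (g z x - g z y)))))"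
    by (rule symmetrization_ghost[OF w])
  also have "\<dots> \<le> expect I p m (\<lambda>xs. expect I p m (\<lambda>ys. sign_avg m (\<lambda>ss. (SUP z\<in>G. \<Sum>(s, x)\<leftarrow>zip ss xs. s * g z x)
      + (SUP z\<in>G. \<Sum>(s, x)\<leftarrow>zip (map uminus ss) ys. s * g z x))))"
  proof (intro expect_mono[OF w] expect_mono[OF weights_sign] SUP_le[OF G])
    fix xs ys ss z assume a: "length xs = m" "set xs \<subseteq> I" "length ys = m" "set ys \<subseteq> I" "length (ss :: real list) = m" "z \<in> G"
    show "0 + (\<Sum>(s, x, y)\<leftarrow>zip ss (zip xs ys). s * (g z x - g z y)) \<le>
      (SUP z\<in>G. \<Sum>(s, x)\<leftarrow>zip ss xs. s * g z x) + (SUP z\<in>G. \<Sum>(s, x)\<leftarrow>zip (map uminus ss) ys. s * g z x)"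
      using a by (simp add: zip2) (intro add_mono SUP_upper b2; simp)
  qed
  also have "\<dots> = 2 * expect I p m (\<lambda>xs. sign_avg m (\<lambda>ss. SUP z\<in>G. \<Sum>(s, x)\<leftarrow>zip ss xs. s * g z x))"
    unfolding expect_add expect_const[OF w]
    using sign_avg_uminus[of m "\<lambda>ss. SUP z\<in>G. \<Sum>(s, x)\<leftarrow>zip ss _. s * g z x"] by simp
  finally show ?thesis .
qed

section \<open>A noncommutative Khintchine inequality\<close>

text \<open>The difference quotient is a sum of \<open>2 * p + 1\<close> monomials. Pairing exponent
  \<open>i\<close> with \<open>2 * p - i\<close>, each pair is at most the sum of the two pure
  powers, because powers of the absolute values are ordered in the same way.\<close>

lemma power_diff_mult_le:
  fixes x y :: real
  shows "(x - y) * (x ^ (2 * p + 1) - y ^ (2 * p + 1)) \<le> (2 * real p + 1) / 2 * ((x - y)\<^sup>2 * (x ^ (2 * p) + y ^ (2 * p)))"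
proof -
  let ?s = "x ^ (2 * p) + y ^ (2 * p)"
  have pair: "y ^ i * x ^ (2 * p - i) + y ^ (2 * p - i) * x ^ i \<le> ?s" if "i \<le> 2 * p" for i
  proof -
    define a b where "a = \<bar>x\<bar>" and "b = \<bar>y\<bar>"
    have ab: "0 \<le> a" "0 \<le> b" by (auto simp: a_def b_def)
    have "0 \<le> (a ^ i - b ^ i) * (a ^ (2 * p - i) - b ^ (2 * p - i))"
    proof (cases "a \<le> b")
      case True
      then show ?thesis using ab by (intro mult_nonpos_nonpos) (auto intro: power_mono)
    next
      case False
      then show ?thesis using ab by (intro mult_nonneg_nonneg) (auto intro: power_mono)
    qed
    also have "\<dots> = a ^ (i + (2 * p - i)) + b ^ (i + (2 * p - i)) - (b ^ i * a ^ (2 * p - i) + b ^ (2 * p - i) * a ^ i)"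
      by (simp only: power_add) (simp add: algebra_simps)
    finally have "b ^ i * a ^ (2 * p - i) + b ^ (2 * p - i) * a ^ i \<le> a ^ (2 * p) + b ^ (2 * p)"
      using that by simp
    moreover have "a ^ (2 * p) = x ^ (2 * p)" "b ^ (2 * p) = y ^ (2 * p)"
      by (simp_all add: a_def b_def power_mult)
    moreover have "y ^ i * x ^ (2 * p - i) \<le> b ^ i * a ^ (2 * p - i)" "y ^ (2 * p - i) * x ^ i \<le> b ^ (2 * p - i) * a ^ i"
      unfolding a_def b_def by (metis abs_ge_self abs_mult power_abs)+
    ultimately show ?thesis by linarith
  qed
  define S where "S = (\<Sum>i<2 * p + 1. y ^ (2 * p - i) * x ^ i)"
  have "x ^ (2 * p + 1) - y ^ (2 * p + 1) = (x - y) * S"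
    unfolding S_def using power_diff_sumr2[of x "2 * p + 1" y] by simp
  then have "(x - y) * (x ^ (2 * p + 1) - y ^ (2 * p + 1)) = (x - y)\<^sup>2 * S"
    by (simp add: power2_eq_square)
  moreover have "2 * S \<le> (2 * real p + 1) * ?s"
  proof -
    have "S = (\<Sum>i<2 * p + 1. y ^ i * x ^ (2 * p - i))"
      unfolding S_def by (rule sum.reindex_bij_witness[of _ "\<lambda>i. 2 * p - i" "\<lambda>i. 2 * p - i"]) auto
    then have "2 * S = (\<Sum>i<2 * p + 1. y ^ i * x ^ (2 * p - i) + y ^ (2 * p - i) * x ^ i)"
      unfolding sum.distrib by (simp add: S_def)
    also have "\<dots> \<le> (\<Sum>i<2 * p + 1. ?s)" by (intro sum_mono pair) auto
    finally show ?thesis by (simp add: algebra_simps)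
  qed
  then have "(x - y)\<^sup>2 * S \<le> (x - y)\<^sup>2 * ((2 * real p + 1) / 2 * ?s)" by (intro mult_left_mono) auto
  ultimately show ?thesis by (simp only: mult_ac)
qed

lemma bform_expand_right:
  assumes "onb n v" shows "bform n A x y = (\<Sum>l<n. ip n (v l) y * bform n A x (v l))"
proof -
  have "bform n A x y = bform n A x (\<lambda>i. \<Sum>l<n. ip n (v l) y * v l i)"
    using onb_expand[OF assms] by (intro bform_cong) auto
  then show ?thesis unfolding bform_sum_right .
qed

lemma bform_expand_left:
  assumes "onb n v" shows "bform n A x y = (\<Sum>l<n. cnj (ip n (v l) x) * bform n A (v l) y)"
proof -
  have "bform n A x y = bform n A (\<lambda>i. \<Sum>l<n. ip n (v l) x * v l i) y"
    using onb_expand[OF assms] by (intro bform_cong) auto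
  then show ?thesis unfolding bform_sum_left .
qed

definition mat_app :: "nat \<Rightarrow> (nat \<Rightarrow> nat \<Rightarrow> complex) \<Rightarrow> (nat \<Rightarrow> complex) \<Rightarrow> nat \<Rightarrow> complex" where
  "mat_app n A x i = (\<Sum>j<n. A i j * x j)"

lemma sqn_mat_app: "onb n v \<Longrightarrow> sqn n (mat_app n A x) = (\<Sum>l<n. (cmod (bform n A (v l) x))\<^sup>2)"
  by (simp add: onb_sqn bform_ip mat_app_def[abs_def])

text \<open>If \<open>X\<close> and \<open>Y\<close> differ by \<open>2 H\<close>, then in the eigenbases \<open>u\<close> of \<open>X\<close> and \<open>v\<close> of \<open>Y\<close> the entries of \<open>H\<close>
  are \<open>(x k - y l) / 2\<close> times those of the identity. This replaces noncommutative telescoping of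
  matrix powers by the scalar inequality \<open>power_diff_mult_le\<close>.\<close>

lemma trace_power_difference_le:
  assumes X: "eigsys n X u x" and Y: "eigsys n Y v y" and H: "herm n H"
    and d: "\<And>i j. i < n \<Longrightarrow> j < n \<Longrightarrow> X i j - Y i j = 2 * H i j"
  shows "(\<Sum>k<n. x k ^ (2 * p + 1) * qf n H (u k)) - (\<Sum>k<n. y k ^ (2 * p + 1) * qf n H (v k))
    \<le> (2 * real p + 1) * ((\<Sum>k<n. x k ^ (2 * p) * sqn n (mat_app n H (u k))) + (\<Sum>k<n. y k ^ (2 * p) * sqn n (mat_app n H (v k))))"
proof -
  note u = eigsys_onb[OF X] and v = eigsys_onb[OF Y]
  define c where "c k l = (cmod (ip n (u k) (v l)))\<^sup>2" for k l
  have b: "bform n H (u k) (v l) = complex_of_real ((x k - y l) / 2) * ip n (u k) (v l)" if "k < n" "l < n" for k l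
  proof -
    have "2 * bform n H (u k) (v l) = bform n X (u k) (v l) - bform n Y (u k) (v l)"
      unfolding bform_def sum_distrib_left sum_subtractf[symmetric]
    proof (intro sum.cong refl)
      fix i j assume "i \<in> {..<n}" "j \<in> {..<n}"
      then have "2 * H i j = X i j - Y i j" using d by simp
      then show "2 * (cnj (u k i) * H i j * v l j) = cnj (u k i) * X i j * v l j - cnj (u k i) * Y i j * v l j"
        by (metis (no_types, lifting) left_diff_distrib mult.assoc mult.left_commute right_diff_distrib)
    qed
    also have "\<dots> = complex_of_real (x k - y l) * ip n (u k) (v l)"
      using that by (simp add: eigsys_bform_left[OF X] eigsys_bform_right[OF Y] algebra_simps)
    finally show ?thesis by (simp add: field_simps)
  qed
  have qu: "qf n H (u k) = (\<Sum>l<n. (x k - y l) / 2 * c k l)" if k: "k < n" for k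
  proof -
    have "bform n H (u k) (u k) = (\<Sum>l<n. complex_of_real ((x k - y l) / 2 * c k l))"
      unfolding bform_expand_right[OF v, of H "u k" "u k"] c_def
    proof (intro sum.cong refl)
      fix l assume "l \<in> {..<n}"
      then show "ip n (v l) (u k) * bform n H (u k) (v l) = complex_of_real ((x k - y l) / 2 * (cmod (ip n (u k) (v l)))\<^sup>2)"
        using k by (simp only: b lessThan_iff of_real_mult cnj_mult_self(1)[symmetric] ip_cnj) (simp add: mult_ac)
    qed
    then show ?thesis by simp
  qed
  have qv: "qf n H (v l) = (\<Sum>k<n. (x k - y l) / 2 * c k l)" if l: "l < n" for l
  proof -
    have "bform n H (v l) (v l) = (\<Sum>k<n. complex_of_real ((x k - y l) / 2 * c k l))"
      unfolding bform_expand_left[OF u, of H "v l" "v l"] c_def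
    proof (intro sum.cong refl)
      fix k assume "k \<in> {..<n}"
      then show "cnj (ip n (u k) (v l)) * bform n H (u k) (v l) = complex_of_real ((x k - y l) / 2 * (cmod (ip n (u k) (v l)))\<^sup>2)"
        using l by (simp only: b lessThan_iff of_real_mult cnj_mult_self(1)[symmetric]) (simp add: mult_ac)
    qed
    then show ?thesis by simp
  qed
  \<comment> \<open>Squared overlaps weighted by the squared eigenvalue gap turn back into squared
    entries of \<open>H\<close>, whose row and column sums are the norms in the conclusion.\<close>
  have cb: "(x k - y l)\<^sup>2 * c k l = 4 * (cmod (bform n H (u k) (v l)))\<^sup>2" if "k < n" "l < n" for k l
    using that by (simp only: b c_def norm_mult norm_of_real power_mult_distrib power2_abs) (simp add: power_divide)
  have ru: "sqn n (mat_app n H (u k)) = (\<Sum>l<n. (cmod (bform n H (u k) (v l)))\<^sup>2)" for k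
    unfolding sqn_mat_app[OF v] by (intro sum.cong refl) (metis bform_cnj[OF H] complex_mod_cnj)
  have rv: "sqn n (mat_app n H (v l)) = (\<Sum>k<n. (cmod (bform n H (u k) (v l)))\<^sup>2)" for l
    unfolding sqn_mat_app[OF u] ..
  have "(\<Sum>k<n. x k ^ (2 * p + 1) * qf n H (u k)) - (\<Sum>l<n. y l ^ (2 * p + 1) * qf n H (v l))
    = (\<Sum>k<n. \<Sum>l<n. x k ^ (2 * p + 1) * ((x k - y l) / 2 * c k l)) - (\<Sum>l<n. \<Sum>k<n. y l ^ (2 * p + 1) * ((x k - y l) / 2 * c k l))"
    by (simp add: qu qv sum_distrib_left)
  also have "(\<Sum>l<n. \<Sum>k<n. y l ^ (2 * p + 1) * ((x k - y l) / 2 * c k l)) = (\<Sum>k<n. \<Sum>l<n. y l ^ (2 * p + 1) * ((x k - y l) / 2 * c k l))"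
    by (rule sum.swap)
  also have "(\<Sum>k<n. \<Sum>l<n. x k ^ (2 * p + 1) * ((x k - y l) / 2 * c k l)) - (\<Sum>k<n. \<Sum>l<n. y l ^ (2 * p + 1) * ((x k - y l) / 2 * c k l))
    = (\<Sum>k<n. \<Sum>l<n. ((x k - y l) * (x k ^ (2 * p + 1) - y l ^ (2 * p + 1))) * (c k l / 2))"
    unfolding sum_subtractf[symmetric] by (intro sum.cong refl) (simp add: field_simps)
  also have "\<dots> \<le> (\<Sum>k<n. \<Sum>l<n. ((2 * real p + 1) / 2 * ((x k - y l)\<^sup>2 * (x k ^ (2 * p) + y l ^ (2 * p)))) * (c k l / 2))"
    by (intro sum_mono mult_right_mono power_diff_mult_le) (simp add: c_def)
  also have "\<dots> = (\<Sum>k<n. \<Sum>l<n. (2 * real p + 1) * (x k ^ (2 * p) * (cmod (bform n H (u k) (v l)))\<^sup>2 + y l ^ (2 * p) * (cmod (bform n H (u k) (v l)))\<^sup>2))"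
  proof (intro sum.cong refl)
    fix k l assume "k \<in> {..<n}" "l \<in> {..<n}"
    then have 1: "(x k - y l)\<^sup>2 * c k l = 4 * (cmod (bform n H (u k) (v l)))\<^sup>2" using cb by simp
    have 2: "((2 * real p + 1) / 2 * ((x k - y l)\<^sup>2 * (x k ^ (2 * p) + y l ^ (2 * p)))) * (c k l / 2)
      = (2 * real p + 1) / 4 * (x k ^ (2 * p) + y l ^ (2 * p)) * ((x k - y l)\<^sup>2 * c k l)" by (simp add: field_simps)
    show "((2 * real p + 1) / 2 * ((x k - y l)\<^sup>2 * (x k ^ (2 * p) + y l ^ (2 * p)))) * (c k l / 2)
      = (2 * real p + 1) * (x k ^ (2 * p) * (cmod (bform n H (u k) (v l)))\<^sup>2 + y l ^ (2 * p) * (cmod (bform n H (u k) (v l)))\<^sup>2)"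
      unfolding 2 1 by (simp add: field_simps)
  qed
  also have "\<dots> = (2 * real p + 1) * ((\<Sum>k<n. \<Sum>l<n. x k ^ (2 * p) * (cmod (bform n H (u k) (v l)))\<^sup>2)
      + (\<Sum>k<n. \<Sum>l<n. y l ^ (2 * p) * (cmod (bform n H (u k) (v l)))\<^sup>2))"
    by (simp only: sum_distrib_left[symmetric] sum.distrib)
  also have "(\<Sum>k<n. \<Sum>l<n. y l ^ (2 * p) * (cmod (bform n H (u k) (v l)))\<^sup>2) = (\<Sum>l<n. \<Sum>k<n. y l ^ (2 * p) * (cmod (bform n H (u k) (v l)))\<^sup>2)"
    by (rule sum.swap)
  finally show ?thesis by (simp only: ru rv sum_distrib_left)
qed

section \<open>Moments of matrix Rademacher sums\<close>

definition signed_sum :: "nat \<Rightarrow> (nat \<Rightarrow> nat \<Rightarrow> nat \<Rightarrow> complex) \<Rightarrow> real list \<Rightarrow> nat \<Rightarrow> nat \<Rightarrow> complex" where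
  "signed_sum m A ss i j = (\<Sum>a<m. complex_of_real (ss ! a) * A a i j)"

lemma signed_sum_herm: "(\<And>a. a < m \<Longrightarrow> herm n (A a)) \<Longrightarrow> herm n (signed_sum m A ss)"
  unfolding herm_def[of n "signed_sum m A ss"] signed_sum_def by (simp add: hermD[of n])

lemma bform_signed_sum: "bform n (signed_sum m A ss) x y = (\<Sum>a<m. complex_of_real (ss ! a) * bform n (A a) x y)"
proof -
  have "bform n (signed_sum m A ss) x y = (\<Sum>i<n. \<Sum>j<n. \<Sum>a<m. complex_of_real (ss ! a) * (cnj (x i) * A a i j * y j))"
    unfolding bform_def signed_sum_def by (simp add: sum_distrib_left sum_distrib_right mult_ac)
  also have "\<dots> = (\<Sum>i<n. \<Sum>a<m. \<Sum>j<n. complex_of_real (ss ! a) * (cnj (x i) * A a i j * y j))"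
    by (intro sum.cong refl sum.swap)
  also have "\<dots> = (\<Sum>a<m. \<Sum>i<n. \<Sum>j<n. complex_of_real (ss ! a) * (cnj (x i) * A a i j * y j))"
    by (rule sum.swap)
  finally show ?thesis by (simp add: bform_def sum_distrib_left)
qed

text \<open>One factor of the trace of the power \<open>2 * p + 2\<close> is expanded into signed
  matrices. Averaging over the sign of the matrix \<open>A a\<close> leaves a difference of traces
  for two sums that differ by twice \<open>A a\<close>, which
  \<open>trace_power_difference_le\<close> bounds by squares of \<open>A a\<close> against the power
  \<open>2 * p\<close>. As a form, the sum of these squares is at most \<open>v\<close>.\<close>

lemma khintchine_step:
  assumes A: "\<And>a. a < m \<Longrightarrow> herm n (A a)"
    and S: "\<And>ss. eigsys n (signed_sum m A ss) (U ss) (L ss)"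
    and v: "\<And>x. sqn n x = 1 \<Longrightarrow> (\<Sum>a<m. sqn n (mat_app n (A a) x)) \<le> v"
  shows "sign_avg m (\<lambda>ss. \<Sum>k<n. L ss k ^ (2 * (p + 1))) \<le> (2 * real p + 1) * v * sign_avg m (\<lambda>ss. \<Sum>k<n. L ss k ^ (2 * p))"
proof -
  define t where "t a ss = (\<Sum>k<n. L ss k ^ (2 * p + 1) * qf n (A a) (U ss k))" for a ss
  define r where "r a ss = (\<Sum>k<n. L ss k ^ (2 * p) * sqn n (mat_app n (A a) (U ss k)))" for a ss
  have 1: "(\<Sum>k<n. L ss k ^ (2 * (p + 1))) = (\<Sum>a<m. ss ! a * t a ss)" for ss
  proof -
    have "(\<Sum>k<n. L ss k ^ (2 * (p + 1))) = (\<Sum>k<n. L ss k ^ (2 * p + 1) * qf n (signed_sum m A ss) (U ss k))"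
      by (intro sum.cong refl) (simp add: eigsys_bform_basis[OF S])
    also have "\<dots> = (\<Sum>k<n. \<Sum>a<m. ss ! a * (L ss k ^ (2 * p + 1) * qf n (A a) (U ss k)))"
      by (intro sum.cong refl) (simp add: bform_signed_sum sum_distrib_left mult_ac)
    also have "\<dots> = (\<Sum>a<m. ss ! a * t a ss)"
      unfolding t_def sum_distrib_left by (rule sum.swap)
    finally show ?thesis .
  qed
  have 2: "sign_avg m (\<lambda>ss. ss ! a * t a ss) \<le> (2 * real p + 1) * sign_avg m (r a)" if a: "a < m" for a
  proof -
    have "sign_avg m (\<lambda>ss. ss ! a * t a ss) = sign_avg m (\<lambda>ss. (ss[a := 1] ! a * t a (ss[a := 1]) + ss[a := - 1] ! a * t a (ss[a := - 1])) / 2)"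
      by (rule sign_avg_resample[OF a])
    also have "\<dots> \<le> sign_avg m (\<lambda>ss. (2 * real p + 1) * ((r a (ss[a := 1]) + r a (ss[a := - 1])) / 2))"
    proof (rule expect_mono[OF weights_sign])
      fix ss :: "real list" assume len: "length ss = m"
      have d: "signed_sum m A (ss[a := 1]) i j - signed_sum m A (ss[a := - 1]) i j = 2 * A a i j" for i j
      proof -
        have "signed_sum m A (ss[a := 1]) i j - signed_sum m A (ss[a := - 1]) i j = (\<Sum>b<m. if a = b then 2 * A a i j else 0)"
          unfolding signed_sum_def sum_subtractf[symmetric] using len by (intro sum.cong) (auto simp: nth_list_update)
        then show ?thesis using a by simp
      qed
      have "t a (ss[a := 1]) - t a (ss[a := - 1]) \<le> (2 * real p + 1) * (r a (ss[a := 1]) + r a (ss[a := - 1]))"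
        unfolding t_def r_def by (rule trace_power_difference_le[OF S S A[OF a] d])
      then show "(ss[a := 1] ! a * t a (ss[a := 1]) + ss[a := - 1] ! a * t a (ss[a := - 1])) / 2 \<le> (2 * real p + 1) * ((r a (ss[a := 1]) + r a (ss[a := - 1])) / 2)"
        using a len by simp
    qed
    also have "\<dots> = (2 * real p + 1) * sign_avg m (r a)"
      unfolding expect_cmult sign_avg_resample[OF a, of "r a"] ..
    finally show ?thesis .
  qed
  have 3: "(\<Sum>a<m. r a ss) \<le> v * (\<Sum>k<n. L ss k ^ (2 * p))" for ss
  proof -
    have "(\<Sum>a<m. r a ss) = (\<Sum>k<n. L ss k ^ (2 * p) * (\<Sum>a<m. sqn n (mat_app n (A a) (U ss k))))"
      unfolding r_def sum_distrib_left by (rule sum.swap)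
    also have "\<dots> \<le> (\<Sum>k<n. L ss k ^ (2 * p) * v)"
      by (intro sum_mono mult_left_mono v) (auto simp: onb_sqn1[OF eigsys_onb[OF S]])
    finally show ?thesis by (simp add: sum_distrib_left mult.commute)
  qed
  have "sign_avg m (\<lambda>ss. \<Sum>k<n. L ss k ^ (2 * (p + 1))) = (\<Sum>a<m. sign_avg m (\<lambda>ss. ss ! a * t a ss))"
    unfolding 1 expect_sum ..
  also have "\<dots> \<le> (\<Sum>a<m. (2 * real p + 1) * sign_avg m (r a))" by (intro sum_mono 2) auto
  also have "\<dots> = (2 * real p + 1) * sign_avg m (\<lambda>ss. \<Sum>a<m. r a ss)"
    by (simp add: expect_sum sum_distrib_left)
  also have "\<dots> \<le> (2 * real p + 1) * sign_avg m (\<lambda>ss. v * (\<Sum>k<n. L ss k ^ (2 * p)))"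
    by (intro mult_left_mono expect_mono[OF weights_sign] 3) auto
  finally show ?thesis by (simp add: expect_cmult mult.assoc)
qed

text \<open>Iterating the step multiplies by successive odd numbers. Below exponent \<open>p\<close>
  each of them is at most \<open>2 * p\<close>, which makes the bound a pure power.\<close>

lemma khintchine_moment:
  assumes A: "\<And>a. a < m \<Longrightarrow> herm n (A a)"
    and S: "\<And>ss. eigsys n (signed_sum m A ss) (U ss) (L ss)"
    and v: "\<And>x. sqn n x = 1 \<Longrightarrow> (\<Sum>a<m. sqn n (mat_app n (A a) x)) \<le> v" and v0: "0 \<le> v"
    and q: "q \<le> p"
  shows "sign_avg m (\<lambda>ss. \<Sum>k<n. L ss k ^ (2 * q)) \<le> (2 * real p * v) ^ q * real n"
  using q
proof (induction q)
  case 0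
  then show ?case by (simp add: expect_const[OF weights_sign])
next
  case (Suc q)
  have "sign_avg m (\<lambda>ss. \<Sum>k<n. L ss k ^ (2 * (q + 1))) \<le> (2 * real q + 1) * v * sign_avg m (\<lambda>ss. \<Sum>k<n. L ss k ^ (2 * q))"
    by (rule khintchine_step[OF A S v])
  also have "\<dots> \<le> (2 * real p * v) * ((2 * real p * v) ^ q * real n)"
  proof (intro mult_mono)
    have "0 \<le> sign_avg m (\<lambda>ss. 0)" by (simp add: expect_const[OF weights_sign])
    also have "\<dots> \<le> sign_avg m (\<lambda>ss. \<Sum>k<n. L ss k ^ (2 * q))"
      by (intro expect_mono[OF weights_sign] sum_nonneg) auto
    finally show "0 \<le> sign_avg m (\<lambda>ss. \<Sum>k<n. L ss k ^ (2 * q))" .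
  qed (use Suc v0 in auto)
  finally show ?case by (simp add: mult.assoc)
qed

text \<open>\<open>B\<close> stands for any quantity dominated by \<open>K\<close> times the
  spectral norm: later the supremum of a form over the sphere, or of traces against the
  cone.\<close>

lemma khintchine_norm:
  assumes A: "\<And>a. a < m \<Longrightarrow> herm n (A a)"
    and S: "\<And>ss. eigsys n (signed_sum m A ss) (U ss) (L ss)"
    and v: "\<And>x. sqn n x = 1 \<Longrightarrow> (\<Sum>a<m. sqn n (mat_app n (A a) x)) \<le> v" and v0: "0 < v"
    and p: "0 < p" "real n \<le> 3 ^ p"
    and B: "\<And>ss c. (\<And>k. k < n \<Longrightarrow> \<bar>L ss k\<bar> \<le> c) \<Longrightarrow> B ss \<le> K * c" and K: "0 \<le> K"
  shows "sign_avg m B \<le> 2 * K * sqrt (6 * real p * v)"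
proof -
  \<comment> \<open>The value \<open>6 * p * v\<close> is three times that of the moment bound; the
    resulting power of 3 absorbs the dimension \<open>n\<close>.\<close>
  define s where "s = sqrt (6 * real p * v)"
  have s: "s > 0" using v0 p by (simp add: s_def)
  have s2: "s ^ (2 * p) = (6 * real p * v) ^ p"
    using v0 by (simp add: s_def power_mult)
  have "sign_avg m B \<le> sign_avg m (\<lambda>ss. K * s * (1 + (\<Sum>k<n. L ss k ^ (2 * p)) / s ^ (2 * p)))"
  proof (rule expect_mono[OF weights_sign])
    fix ss :: "real list"
    have "\<bar>L ss k\<bar> \<le> s * (1 + (\<Sum>k<n. L ss k ^ (2 * p)) / s ^ (2 * p))" if k: "k < n" for k
    proof -
      define y where "y = \<bar>L ss k\<bar> / s"
      have y: "0 \<le> y" using s by (simp add: y_def)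
      \<comment> \<open>This elementary bound takes the place of Jensen's inequality for the root of
        order \<open>2 * p\<close>.\<close>
      have "y \<le> 1 + y ^ (2 * p)"
      proof (cases "y \<le> 1")
        case True
        then show ?thesis using y by (simp add: add_increasing2)
      next
        case False
        then have "y ^ 1 \<le> y ^ (2 * p)" using p by (intro power_increasing) auto
        then show ?thesis by simp
      qed
      also have "y ^ (2 * p) = L ss k ^ (2 * p) / s ^ (2 * p)"
        by (simp add: y_def power_divide power_even_abs)
      also have "L ss k ^ (2 * p) \<le> (\<Sum>k<n. L ss k ^ (2 * p))"
        using k by (intro member_le_sum) auto
      finally have "y \<le> 1 + (\<Sum>k<n. L ss k ^ (2 * p)) / s ^ (2 * p)" using s by (simp add: divide_right_mono)
      then show ?thesis using s unfolding y_def by (simp add: pos_divide_le_eq mult.commute)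
    qed
    then show "B ss \<le> K * s * (1 + (\<Sum>k<n. L ss k ^ (2 * p)) / s ^ (2 * p))"
      using B by (simp add: mult.assoc)
  qed
  also have "\<dots> = K * s * (1 + sign_avg m (\<lambda>ss. \<Sum>k<n. L ss k ^ (2 * p)) / s ^ (2 * p))"
    by (simp only: expect_cmult expect_add expect_divide expect_const[OF weights_sign])
  also have "\<dots> \<le> K * s * (1 + 1)"
  proof (intro mult_left_mono add_left_mono)
    have "sign_avg m (\<lambda>ss. \<Sum>k<n. L ss k ^ (2 * p)) \<le> (2 * real p * v) ^ p * real n"
      using v0 by (intro khintchine_moment[OF A S v]) auto
    also have "\<dots> \<le> (2 * real p * v) ^ p * 3 ^ p" using p v0 by (intro mult_left_mono) auto
    also have "\<dots> = s ^ (2 * p)" unfolding s2 power_mult_distrib[symmetric] by (simp add: mult_ac)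
    finally show "sign_avg m (\<lambda>ss. \<Sum>k<n. L ss k ^ (2 * p)) / s ^ (2 * p) \<le> 1" using s by simp
  qed (use K s in auto)
  finally show ?thesis by (simp add: s_def)
qed

section \<open>Unitarily invariant measures on projective space\<close>

lemma vec_l2_norm_eq_1: "w \<in> carrier_vec n \<Longrightarrow> vec_l2_norm w = 1 \<longleftrightarrow> sqn n (\<lambda>i. w $ i) = 1"
  by (simp add: vec_l2_norm_def L2_set_def sqn_def)

lemma fun_of_ket_bra: "w \<in> carrier_vec n \<Longrightarrow> i < n \<Longrightarrow> j < n \<Longrightarrow> fun_of_mat (ket_bra w) i j = w $ i * cnj (w $ j)"
  by (simp add: fun_of_mat_def ket_bra_def)

lemma bform_ket_bra:
  assumes "w \<in> carrier_vec n"
  shows "bform n (fun_of_mat (ket_bra w)) x y = ip n x (\<lambda>i. w $ i) * ip n (\<lambda>i. w $ i) y"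
proof -
  have "bform n (fun_of_mat (ket_bra w)) x y = (\<Sum>i<n. \<Sum>j<n. (cnj (x i) * w $ i) * (cnj (w $ j) * y j))"
    unfolding bform_def using assms by (intro sum.cong refl) (simp add: fun_of_ket_bra)
  then show ?thesis by (simp add: ip_def sum_product)
qed

lemma qf_ket_bra:
  assumes "w \<in> carrier_vec n"
  shows "bform n (fun_of_mat (ket_bra w)) x x = complex_of_real ((cmod (ip n x (\<lambda>i. w $ i)))\<^sup>2)"
  unfolding bform_ket_bra[OF assms] cnj_mult_self(2)[symmetric] ip_cnj ..

lemma proj_spaceE:
  assumes "P \<in> proj_space n"
  obtains w where "w \<in> carrier_vec n" "P = ket_bra w" "sqn n (\<lambda>i. w $ i) = 1"
  using assms vec_l2_norm_eq_1 by (auto simp: proj_space_def)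

text \<open>The last identity expresses rank one. It is what later converts squared off-diagonal
  entries into products of diagonal ones.\<close>

lemma proj_space_entry:
  assumes "P \<in> proj_space n" "i < n" "j < n"
  shows "cmod (fun_of_mat P i j) \<le> 1" "fun_of_mat P j i = cnj (fun_of_mat P i j)"
    "Re (fun_of_mat P i i) * Re (fun_of_mat P j j) = (Re (fun_of_mat P i j))\<^sup>2 + (Im (fun_of_mat P i j))\<^sup>2"
proof -
  obtain w where w: "w \<in> carrier_vec n" "P = ket_bra w" "sqn n (\<lambda>i. w $ i) = 1" using proj_spaceE[OF assms(1)] .
  have le: "cmod (w $ i) \<le> 1" if "i < n" for i
  proof -
    have "(cmod (w $ i))\<^sup>2 \<le> sqn n (\<lambda>i. w $ i)"
      unfolding sqn_def using that by (intro member_le_sum) auto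
    then show ?thesis using w by (simp add: power_le_one_iff)
  qed
  show "cmod (fun_of_mat P i j) \<le> 1"
    using w le assms by (simp add: fun_of_ket_bra norm_mult mult_le_one)
  show "fun_of_mat P j i = cnj (fun_of_mat P i j)" using w assms by (simp add: fun_of_ket_bra)
  have "Re (fun_of_mat P i i) * Re (fun_of_mat P j j) = (cmod (w $ i))\<^sup>2 * (cmod (w $ j))\<^sup>2"
    using w assms by (simp only: fun_of_ket_bra cnj_mult_self(2) Re_complex_of_real)
  also have "\<dots> = (cmod (fun_of_mat P i j))\<^sup>2" using w assms by (simp add: fun_of_ket_bra norm_mult power_mult_distrib)
  finally show "Re (fun_of_mat P i i) * Re (fun_of_mat P j j) = (Re (fun_of_mat P i j))\<^sup>2 + (Im (fun_of_mat P i j))\<^sup>2"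
    by (simp add: cmod_power2)
qed

lemma proj_space_trace:
  assumes "P \<in> proj_space n" shows "(\<Sum>i<n. Re (fun_of_mat P i i)) = 1"
proof -
  obtain w where w: "w \<in> carrier_vec n" "P = ket_bra w" "sqn n (\<lambda>i. w $ i) = 1" using proj_spaceE[OF assms] .
  have "(\<Sum>i<n. Re (fun_of_mat P i i)) = sqn n (\<lambda>i. w $ i)"
    unfolding sqn_def using w by (intro sum.cong refl) (simp only: fun_of_ket_bra lessThan_iff cnj_mult_self(2) Re_complex_of_real)
  then show ?thesis using w by simp
qed

section \<open>Change of basis as a unitary action\<close>

text \<open>The rows are conjugated basis vectors, so conjugating \<open>P\<close> by this matrix
  replaces its entries by the values of its form on the basis \<open>u\<close>.\<close>

definition conj_mat :: "nat \<Rightarrow> (nat \<Rightarrow> nat \<Rightarrow> complex) \<Rightarrow> complex mat" where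
  "conj_mat n u = mat n n (\<lambda>(k, i). cnj (u k i))"

lemma conj_mat_carrier [simp]: "conj_mat n u \<in> carrier_mat n n" "mat_adjoint (conj_mat n u) \<in> carrier_mat n n"
  by (auto simp: conj_mat_def)

lemma adjoint_conj_mat: "mat_adjoint (conj_mat n u) = mat n n (\<lambda>(i, k). u k i)"
  by (rule eq_matI) (auto simp: index_mat_adjoint conj_mat_def)

lemma conj_mat_unitary:
  assumes u: "onb n u" shows "conj_mat n u \<in> unitary_mats n"
proof -
  have "mat_adjoint (conj_mat n u) * conj_mat n u = 1\<^sub>m n"
    unfolding adjoint_conj_mat unfolding conj_mat_def using onb_complete[OF u]
    by (intro eq_matI) (auto simp: scalar_prod_def atLeast0LessThan)
  moreover have "conj_mat n u * mat_adjoint (conj_mat n u) = 1\<^sub>m n"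
    unfolding adjoint_conj_mat unfolding conj_mat_def using onb_ip[OF u] unfolding ip_def
    by (intro eq_matI) (auto simp: scalar_prod_def atLeast0LessThan)
  ultimately show ?thesis by (simp add: unitary_mats_def)
qed

lemma square_mat_mult_entry:
  "A \<in> carrier_mat n n \<Longrightarrow> B \<in> carrier_mat n n \<Longrightarrow> k < n \<Longrightarrow> l < n \<Longrightarrow> (A * B) $$ (k, l) = (\<Sum>j<n. A $$ (k, j) * B $$ (j, l))"
  by (simp add: scalar_prod_def atLeast0LessThan)

lemma conj_mat_entry:
  assumes P: "P \<in> carrier_mat n n" and k: "k < n" and l: "l < n"
  shows "(conj_mat n u * P * mat_adjoint (conj_mat n u)) $$ (k, l) = bform n (fun_of_mat P) (u k) (u l)"
proof -
  let ?U = "conj_mat n u"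
  have a: "mat_adjoint ?U $$ (i, k) = u k i" if "i < n" "k < n" for i k
    using that by (simp add: index_mat_adjoint conj_mat_def)
  have UP: "(?U * P) $$ (k, j) = (\<Sum>i<n. cnj (u k i) * fun_of_mat P i j)" if "j < n" for j
    using k that P by (simp add: scalar_prod_def atLeast0LessThan conj_mat_def fun_of_mat_def)
  have c: "?U * P \<in> carrier_mat n n" by (rule mult_carrier_mat[OF conj_mat_carrier(1) P])
  have "(?U * P * mat_adjoint ?U) $$ (k, l) = (\<Sum>j<n. (?U * P) $$ (k, j) * mat_adjoint ?U $$ (j, l))"
    by (rule square_mat_mult_entry[OF c conj_mat_carrier(2) k l])
  also have "\<dots> = (\<Sum>j<n. \<Sum>i<n. cnj (u k i) * fun_of_mat P i j * u l j)"
    using l by (intro sum.cong refl) (simp add: UP a sum_distrib_right)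
  also have "\<dots> = bform n (fun_of_mat P) (u k) (u l)" unfolding bform_def by (rule sum.swap)
  finally show ?thesis .
qed

lemma proj_space_carrier: "P \<in> proj_space n \<Longrightarrow> P \<in> carrier_mat n n"
  by (auto simp: proj_space_def ket_bra_def)

lemma conj_mat_proj_space:
  assumes P: "P \<in> proj_space n" and u: "onb n u"
  shows "conj_mat n u * P * mat_adjoint (conj_mat n u) \<in> proj_space n"
proof -
  obtain w where w: "w \<in> carrier_vec n" "P = ket_bra w" "sqn n (\<lambda>i. w $ i) = 1" using proj_spaceE[OF P] .
  define v where "v = vec n (\<lambda>k. ip n (u k) (\<lambda>i. w $ i))"
  have "conj_mat n u * P * mat_adjoint (conj_mat n u) = ket_bra v"
  proof (rule eq_matI)
    fix k l assume "k < dim_row (ket_bra v)" "l < dim_col (ket_bra v)"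
    then have kl: "k < n" "l < n" by (auto simp: ket_bra_def v_def)
    show "(conj_mat n u * P * mat_adjoint (conj_mat n u)) $$ (k, l) = ket_bra v $$ (k, l)"
    proof -
      have "ket_bra v $$ (k, l) = ip n (u k) (\<lambda>i. w $ i) * ip n (\<lambda>i. w $ i) (u l)"
        using kl by (simp add: ket_bra_def v_def ip_cnj)
      then show ?thesis
        unfolding conj_mat_entry[OF proj_space_carrier[OF P] kl] unfolding w(2) bform_ket_bra[OF w(1)] by simp
    qed
  qed (auto simp: conj_mat_def ket_bra_def v_def)
  moreover have "sqn n (\<lambda>k. v $ k) = 1"
  proof -
    have "sqn n (\<lambda>k. v $ k) = sqn n (\<lambda>i. w $ i)"
      unfolding onb_sqn[OF u, of "\<lambda>i. w $ i"] by (simp add: sqn_def v_def)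
    then show ?thesis using w by simp
  qed
  moreover have "v \<in> carrier_vec n" by (simp add: v_def)
  ultimately show ?thesis using vec_l2_norm_eq_1 by (auto simp: proj_space_def)
qed

section \<open>Integrals of bounded functions of the entries\<close>

context
  fixes n :: nat and \<mu> :: "complex mat measure"
  assumes inv: "unitarily_invariant_prob n \<mu>"
begin

lemma sets_haar: "sets \<mu> = sets (proj_space_borel n)"
  using inv by (simp add: unitarily_invariant_prob_def)

lemma space_haar: "space \<mu> = proj_space n"
  using sets_eq_imp_space_eq[OF sets_haar]
  by (simp add: proj_space_borel_def space_measure_of_conv)

lemma prob_haar: "prob_space \<mu>"
  using inv by (simp add: unitarily_invariant_prob_def)

lemma entry_measurable: "i < n \<Longrightarrow> j < n \<Longrightarrow> (\<lambda>P. fun_of_mat P i j) \<in> borel_measurable \<mu>"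
proof (rule measurableI)
  fix B :: "complex set" assume B: "B \<in> sets borel" and ij: "i < n" "j < n"
  have "{P \<in> proj_space n. P $$ (i, j) \<in> B} \<in> sets (proj_space_borel n)"
    unfolding proj_space_borel_def using ij B by (subst sets_measure_of) (auto intro!: sigma_sets.Basic)
  moreover have "(\<lambda>P. fun_of_mat P i j) -` B \<inter> space \<mu> = {P \<in> proj_space n. P $$ (i, j) \<in> B}"
    unfolding space_haar fun_of_mat_def by auto
  ultimately show "(\<lambda>P. fun_of_mat P i j) -` B \<inter> space \<mu> \<in> sets \<mu>" by (simp add: sets_haar)
qed simp

text \<open>Measurable bounded functions of the entries: integrable, and closed under sums and
  products. The first clause matters because entry functions also have values at indices beyond
  \<open>n\<close>, where a transformed matrix and the form describing it need not agree.\<close>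

definition adm :: "((nat \<Rightarrow> nat \<Rightarrow> complex) \<Rightarrow> real) \<Rightarrow> bool" where
  "adm F \<longleftrightarrow> (\<forall>A B. (\<forall>i<n. \<forall>j<n. A i j = B i j) \<longrightarrow> F A = F B) \<and>
     (\<lambda>P. F (fun_of_mat P)) \<in> borel_measurable \<mu> \<and> (\<exists>c. \<forall>P\<in>proj_space n. \<bar>F (fun_of_mat P)\<bar> \<le> c)"

definition haar_mean :: "((nat \<Rightarrow> nat \<Rightarrow> complex) \<Rightarrow> real) \<Rightarrow> real" where
  "haar_mean F = (\<integral>P. F (fun_of_mat P) \<partial>\<mu>)"

lemma adm_cong: "adm F \<Longrightarrow> \<forall>i<n. \<forall>j<n. A i j = B i j \<Longrightarrow> F A = F B"
  unfolding adm_def by (drule conjunct1, drule spec[of _ A], drule spec[of _ B], erule mp)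

lemma adm_const: "adm (\<lambda>_. c)"
  by (auto simp: adm_def)

lemma adm_add:
  assumes "adm F" "adm G" shows "adm (\<lambda>A. F A + G A)"
proof -
  from assms obtain c d where "\<forall>P\<in>proj_space n. \<bar>F (fun_of_mat P)\<bar> \<le> c" "\<forall>P\<in>proj_space n. \<bar>G (fun_of_mat P)\<bar> \<le> d"
    unfolding adm_def by blast
  then have "\<forall>P\<in>proj_space n. \<bar>F (fun_of_mat P) + G (fun_of_mat P)\<bar> \<le> c + d"
    by (meson abs_triangle_ineq add_mono order_trans)
  then have "\<exists>c. \<forall>P\<in>proj_space n. \<bar>F (fun_of_mat P) + G (fun_of_mat P)\<bar> \<le> c" by blast
  moreover have "F A + G A = F B + G B" if "\<forall>i<n. \<forall>j<n. A i j = B i j" for A B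
    using adm_cong[OF assms(1) that] adm_cong[OF assms(2) that] by simp
  ultimately show ?thesis using assms unfolding adm_def by (auto intro: borel_measurable_add)
qed

lemma adm_mult:
  assumes "adm F" "adm G" shows "adm (\<lambda>A. F A * G A)"
proof -
  from assms obtain c d where cd: "\<forall>P\<in>proj_space n. \<bar>F (fun_of_mat P)\<bar> \<le> c" "\<forall>P\<in>proj_space n. \<bar>G (fun_of_mat P)\<bar> \<le> d"
    unfolding adm_def by blast
  have "\<bar>F (fun_of_mat P) * G (fun_of_mat P)\<bar> \<le> c * d" if "P \<in> proj_space n" for P
    unfolding abs_mult using cd that by (intro mult_mono) force+
  then have "\<exists>c. \<forall>P\<in>proj_space n. \<bar>F (fun_of_mat P) * G (fun_of_mat P)\<bar> \<le> c" by blast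
  moreover have "F A * G A = F B * G B" if "\<forall>i<n. \<forall>j<n. A i j = B i j" for A B
    using adm_cong[OF assms(1) that] adm_cong[OF assms(2) that] by simp
  ultimately show ?thesis using assms unfolding adm_def by (auto intro: borel_measurable_times)
qed

lemma adm_power: "adm F \<Longrightarrow> adm (\<lambda>A. F A ^ k)"
  by (induction k) (auto intro: adm_const adm_mult)

lemma adm_Re:
  assumes "i < n" "j < n" shows "adm (\<lambda>A. Re (A i j))"
proof -
  have "\<bar>Re (fun_of_mat P i j)\<bar> \<le> 1" if "P \<in> proj_space n" for P
    using proj_space_entry(1)[OF that assms] abs_Re_le_cmod order_trans by blast
  then show ?thesis using entry_measurable[OF assms] assms unfolding adm_def by (auto intro!: borel_measurable_Re)
qed

lemma adm_Im:
  assumes "i < n" "j < n" shows "adm (\<lambda>A. Im (A i j))"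
proof -
  have "\<bar>Im (fun_of_mat P i j)\<bar> \<le> 1" if "P \<in> proj_space n" for P
    using proj_space_entry(1)[OF that assms] abs_Im_le_cmod order_trans by blast
  then show ?thesis using entry_measurable[OF assms] assms unfolding adm_def by (auto intro!: borel_measurable_Im)
qed

lemma adm_cmult: "adm F \<Longrightarrow> adm (\<lambda>A. c * F A)"
  by (intro adm_mult adm_const)

lemma adm_sum: "finite I \<Longrightarrow> (\<And>i. i \<in> I \<Longrightarrow> adm (F i)) \<Longrightarrow> adm (\<lambda>A. \<Sum>i\<in>I. F i A)"
  by (induction I rule: finite_induct) (auto intro: adm_const adm_add)

lemma adm_integrable: "adm F \<Longrightarrow> integrable \<mu> (\<lambda>P. F (fun_of_mat P))"
proof -
  interpret prob_space \<mu> by (rule prob_haar)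
  assume "adm F"
  then show ?thesis unfolding adm_def space_haar[symmetric]
    by (auto intro!: integrable_const_bound AE_I2)
qed

lemma haar_mean_add: "adm F \<Longrightarrow> adm G \<Longrightarrow> haar_mean (\<lambda>A. F A + G A) = haar_mean F + haar_mean G"
  unfolding haar_mean_def by (intro Bochner_Integration.integral_add adm_integrable)

lemma haar_mean_cmult: "haar_mean (\<lambda>A. c * F A) = c * haar_mean F"
  unfolding haar_mean_def by simp

lemma haar_mean_const: "haar_mean (\<lambda>_. c) = c"
proof -
  interpret prob_space \<mu> by (rule prob_haar)
  show ?thesis unfolding haar_mean_def by (simp add: prob_space)
qed

lemma haar_mean_sum: "finite I \<Longrightarrow> (\<And>i. i \<in> I \<Longrightarrow> adm (F i)) \<Longrightarrow> haar_mean (\<lambda>A. \<Sum>i\<in>I. F i A) = (\<Sum>i\<in>I. haar_mean (F i))"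
  by (induction I rule: finite_induct) (auto simp: haar_mean_const haar_mean_add adm_sum)

lemma haar_mean_cong: "(\<And>P. P \<in> proj_space n \<Longrightarrow> F (fun_of_mat P) = G (fun_of_mat P)) \<Longrightarrow> haar_mean F = haar_mean G"
  unfolding haar_mean_def by (intro Bochner_Integration.integral_cong) (auto simp: space_haar)

text \<open>Conjugation by \<open>conj_mat n u\<close> preserves the measure. Its measurability is
  checked on the generating sets, since the new entries are linear combinations of the old
  ones.\<close>

lemma haar_mean_change_basis:
  assumes F: "adm F" and u: "onb n u"
  shows "haar_mean (\<lambda>A. F (\<lambda>k l. bform n A (u k) (u l))) = haar_mean F"
proof -
  let ?T = "\<lambda>P. conj_mat n u * P * mat_adjoint (conj_mat n u)"
  have T_entry: "fun_of_mat (?T P) k l = bform n (fun_of_mat P) (u k) (u l)" if "P \<in> proj_space n" "k < n" "l < n" for P k l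
    using conj_mat_entry[OF proj_space_carrier[OF that(1)] that(2,3)] by (simp add: fun_of_mat_def)
  have "?T \<in> measurable \<mu> (proj_space_borel n)"
    unfolding proj_space_borel_def
  proof (rule measurable_measure_of)
    show "?T \<in> space \<mu> \<rightarrow> proj_space n" using conj_mat_proj_space[OF _ u] by (auto simp: space_haar)
    fix Y assume "Y \<in> {{P \<in> proj_space n. P $$ (i, j) \<in> B} | i j B. i < n \<and> j < n \<and> B \<in> sets borel}"
    then obtain i j B where Y: "Y = {P \<in> proj_space n. P $$ (i, j) \<in> B}" "i < n" "j < n" "B \<in> sets borel" by blast
    have "(\<lambda>P. bform n (fun_of_mat P) (u i) (u j)) \<in> borel_measurable \<mu>"
      unfolding bform_def using entry_measurable by (intro borel_measurable_sum borel_measurable_times) auto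
    then have "(\<lambda>P. bform n (fun_of_mat P) (u i) (u j)) -` B \<inter> space \<mu> \<in> sets \<mu>" using Y by (intro measurable_sets)
    moreover have "(\<lambda>P. bform n (fun_of_mat P) (u i) (u j)) -` B \<inter> space \<mu> = ?T -` Y \<inter> space \<mu>"
      using Y T_entry conj_mat_proj_space[OF _ u] by (auto simp: space_haar fun_of_mat_def)
    ultimately show "?T -` Y \<inter> space \<mu> \<in> sets \<mu>" by simp
  qed auto
  then have T: "?T \<in> measurable \<mu> \<mu>" using sets_haar by (simp cong: measurable_cong_sets)
  have "haar_mean F = (\<integral>P. F (fun_of_mat P) \<partial>distr \<mu> \<mu> ?T)"
    using inv conj_mat_unitary[OF u] by (simp add: haar_mean_def unitarily_invariant_prob_def)
  also have "\<dots> = (\<integral>P. F (fun_of_mat (?T P)) \<partial>\<mu>)"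
    using F by (intro integral_distr T) (simp add: adm_def)
  also have "\<dots> = haar_mean (\<lambda>A. F (\<lambda>k l. bform n A (u k) (u l)))"
    unfolding haar_mean_def
  proof (intro Bochner_Integration.integral_cong refl)
    fix P assume "P \<in> space \<mu>"
    then have "\<forall>i<n. \<forall>j<n. fun_of_mat (?T P) i j = bform n (fun_of_mat P) (u i) (u j)"
      using T_entry by (simp add: space_haar)
    then show "F (fun_of_mat (?T P)) = F (\<lambda>k l. bform n (fun_of_mat P) (u k) (u l))" by (rule adm_cong[OF F])
  qed
  finally show ?thesis by simp
qed

end

section \<open>Fourth moments of the invariant measure\<close>

definition kron :: "nat \<Rightarrow> nat \<Rightarrow> real" where
  "kron i j = (if i = j then 1 else 0)"

text \<open>The number of permutations of four positions that fix the tuple \<open>(i, j, k, l)\<close>.\<close>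

definition s24 :: "nat \<Rightarrow> nat \<Rightarrow> nat \<Rightarrow> nat \<Rightarrow> real" where
  "s24 i j k l = (1 + kron i j) * (1 + kron i k + kron j k) * (1 + kron i l + kron j l + kron k l)"

lemma s24_nonneg: "0 \<le> s24 i j k l"
  by (simp add: s24_def kron_def)

lemma s24_le: "s24 i j k l \<le> 24"
  by (simp add: s24_def kron_def)

section \<open>Bases obtained from phases and from a plane rotation\<close>

lemma bform_std:
  assumes "k < n" "l < n"
  shows "bform n A (\<lambda>i. if i = k then 1 else 0) (\<lambda>i. if i = l then 1 else 0) = A k l"
proof -
  have "bform n A (\<lambda>i. if i = k then 1 else 0) (\<lambda>i. if i = l then 1 else 0) = (\<Sum>i<n. \<Sum>j<n. if l = j then (if k = i then A k l else 0) else 0)"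
    unfolding bform_def by (intro sum.cong refl) auto
  then show ?thesis using assms by simp
qed

lemma onb_phase:
  assumes "\<And>k. cmod (\<omega> k) = 1"
  shows "onb n (\<lambda>k i. \<omega> k * (if i = k then 1 else 0))"
proof -
  have p: "cnj (\<omega> k) * \<omega> k = 1" "\<omega> k * cnj (\<omega> k) = 1" for k using assms by (simp_all add: cnj_mult_self)
  have 1: "ip n (\<lambda>i. \<omega> k * (if i = k then 1 else 0)) (\<lambda>i. \<omega> l * (if i = l then 1 else 0)) = (if k = l then 1 else 0)"
    if "k < n" "l < n" for k l
    unfolding ip_scale_left ip_scale_right using onb_ip[OF onb_std that] p by simp
  have 2: "(\<Sum>k<n. \<omega> k * (if i = k then 1 else 0) * cnj (\<omega> k * (if j = k then 1 else 0))) = (if i = j then 1 else 0)"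
    if "i < n" "j < n" for i j
  proof -
    have "(\<Sum>k<n. \<omega> k * (if i = k then 1 else 0) * cnj (\<omega> k * (if j = k then 1 else 0))) = (\<Sum>k<n. if i = k then (if i = j then 1 else 0) else 0)"
      using p by (intro sum.cong refl) auto
    then show ?thesis using that by simp
  qed
  show ?thesis unfolding onb_def using 1 2 by blast
qed

lemma ip_two:
  assumes "k < n" "k' < n"
  shows "ip n (\<lambda>i. c * (if i = k then 1 else 0) + d * (if i = k' then 1 else 0)) z = cnj c * z k + cnj d * z k'"
proof -
  have "ip n (\<lambda>i. c * (if i = k then 1 else 0) + d * (if i = k' then 1 else 0)) z
     = (\<Sum>i<n. (if k = i then cnj c * z k else 0) + (if k' = i then cnj d * z k' else 0))"
    unfolding ip_def by (intro sum.cong refl) (auto simp: algebra_simps)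
  then show ?thesis using assms by (simp add: sum.distrib)
qed

lemma bform_two:
  assumes "k < n" "k' < n"
  shows "bform n A (\<lambda>i. c * (if i = k then 1 else 0) + d * (if i = k' then 1 else 0)) (\<lambda>i. c * (if i = k then 1 else 0) + d * (if i = k' then 1 else 0))
    = cnj c * (c * A k k + d * A k k') + cnj d * (c * A k' k + d * A k' k')"
proof -
  have "(\<Sum>j<n. A i j * (c * (if j = k then 1 else 0) + d * (if j = k' then 1 else 0))) = c * A i k + d * A i k'" for i
  proof -
    have "(\<Sum>j<n. A i j * (c * (if j = k then 1 else 0) + d * (if j = k' then 1 else 0)))
      = (\<Sum>j<n. (if k = j then c * A i k else 0) + (if k' = j then d * A i k' else 0))"
      by (intro sum.cong refl) (auto simp: algebra_simps)
    then show ?thesis using assms by (simp add: sum.distrib)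
  qed
  then show ?thesis unfolding bform_ip ip_two[OF assms] by simp
qed

text \<open>Acts on the plane of \<open>a\<close> and \<open>b\<close> by the 2 by 2 Hadamard matrix
  and fixes the other unit vectors. Each vector is written with two terms, the second having
  coefficient 0 outside the plane, so that \<open>ip_two\<close> and \<open>bform_two\<close> apply
  uniformly.\<close>

definition hada :: "nat \<Rightarrow> nat \<Rightarrow> nat \<Rightarrow> nat \<Rightarrow> complex" where
  "hada a b k = (\<lambda>i. (if k = b then - complex_of_real (sqrt (1/2)) else if k = a then complex_of_real (sqrt (1/2)) else 1) * (if i = k then 1 else 0)
     + (if k = a \<or> k = b then complex_of_real (sqrt (1/2)) else 0) * (if i = (if k = a then b else if k = b then a else k) then 1 else 0))"

lemma onb_hada:
  assumes "a < n" "b < n" "a \<noteq> b" shows "onb n (hada a b)"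
proof -
  have r: "complex_of_real (sqrt (1/2)) * complex_of_real (sqrt (1/2)) = 1/2"
    unfolding of_real_mult[symmetric] by simp
  have o: "ip n (hada a b k) (hada a b l) = (if k = l then 1 else 0)" if kl: "k < n" "l < n" for k l
  proof -
    have *: "k < n" "(if k = a then b else if k = b then a else k) < n" using kl assms by auto
    show ?thesis
      unfolding hada_def[of a b k] ip_two[OF *] unfolding hada_def
      using assms r by (auto simp: r algebra_simps)
  qed
  have sym: "cnj (hada a b k i) = hada a b i k" for k i
    unfolding hada_def using assms(3) by auto
  have "(\<Sum>k<n. hada a b k i * cnj (hada a b k j)) = (if i = j then 1 else 0)" if "i < n" "j < n" for i j
  proof -
    have "(\<Sum>k<n. hada a b k i * cnj (hada a b k j)) = ip n (hada a b i) (hada a b j)"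
      unfolding ip_def sym using sym[of _ i] by (metis (no_types, lifting) complex_cnj_cnj)
    then show ?thesis using o that by simp
  qed
  then show ?thesis unfolding onb_def using o by blast
qed

lemma bform_hada:
  assumes "a < n" "b < n" "a \<noteq> b" "k < n"
  shows "bform n A (hada a b k) (hada a b k) = (if k = a then (A a a + A b b) / 2 + (A a b + A b a) / 2
     else if k = b then (A a a + A b b) / 2 - (A a b + A b a) / 2 else A k k)"
proof -
  have r: "complex_of_real (sqrt (1/2)) * complex_of_real (sqrt (1/2)) = 1/2"
    unfolding of_real_mult[symmetric] by simp
  then have r': "complex_of_real (sqrt (1/2)) * (complex_of_real (sqrt (1/2)) * z) = z / 2" for z
  proof -
    have "complex_of_real (sqrt (1/2)) * (complex_of_real (sqrt (1/2)) * z) = complex_of_real (sqrt (1/2)) * complex_of_real (sqrt (1/2)) * z"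
      by (simp only: mult.assoc)
    then show ?thesis unfolding r by simp
  qed
  have *: "k < n" "(if k = a then b else if k = b then a else k) < n" using assms by auto
  show ?thesis unfolding hada_def[of a b k] bform_two[OF *]
    using assms(3) by (auto simp: r r' algebra_simps add_divide_distrib diff_divide_distrib)
qed

section \<open>Linear relations between diagonal moments\<close>

context
  fixes n :: nat and \<mu> :: "complex mat measure"
  assumes inv: "unitarily_invariant_prob n \<mu>"
begin

lemmas adm_rules = adm_const[OF inv] adm_add[OF inv] adm_mult[OF inv] adm_power[OF inv] adm_Re[OF inv] adm_Im[OF inv]

abbreviation diag_re :: "(nat \<Rightarrow> nat \<Rightarrow> complex) \<Rightarrow> nat \<Rightarrow> real" where
  "diag_re A i \<equiv> Re (A i i)"

text \<open>Functions of the diagonal alone. Diagonal phases do not change them, so they pass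
  through \<open>haar_mean_phase\<close> as weights.\<close>

definition dadm :: "((nat \<Rightarrow> nat \<Rightarrow> complex) \<Rightarrow> real) \<Rightarrow> bool" where
  "dadm K \<longleftrightarrow> adm n \<mu> K \<and> (\<forall>A B. (\<forall>i<n. A i i = B i i) \<longrightarrow> K A = K B)"

lemma dadm_adm: "dadm K \<Longrightarrow> adm n \<mu> K"
  by (simp add: dadm_def)

lemma dadm_cong: "dadm F \<Longrightarrow> \<forall>i<n. A i i = B i i \<Longrightarrow> F A = F B"
  unfolding dadm_def by (drule conjunct2, drule spec[of _ A], drule spec[of _ B], erule mp)

lemma dadm_const: "dadm (\<lambda>_. c)"
  by (simp add: dadm_def adm_rules)

lemma dadm_t: "i < n \<Longrightarrow> dadm (\<lambda>A. diag_re A i)"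
  by (simp add: dadm_def adm_rules)

lemma dadm_add:
  assumes "dadm F" "dadm G" shows "dadm (\<lambda>A. F A + G A)"
proof -
  have "F A + G A = F B + G B" if "\<forall>i<n. A i i = B i i" for A B
    using dadm_cong[of F A B, OF assms(1) that] dadm_cong[of G A B, OF assms(2) that] by simp
  then show ?thesis using assms unfolding dadm_def by (auto intro: adm_rules)
qed

lemma dadm_mult:
  assumes "dadm F" "dadm G" shows "dadm (\<lambda>A. F A * G A)"
proof -
  have "F A * G A = F B * G B" if "\<forall>i<n. A i i = B i i" for A B
    using dadm_cong[of F A B, OF assms(1) that] dadm_cong[of G A B, OF assms(2) that] by simp
  then show ?thesis using assms unfolding dadm_def by (auto intro: adm_rules)
qed

lemma dadm_power: "dadm F \<Longrightarrow> dadm (\<lambda>A. F A ^ k)"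
  by (induction k) (auto intro: dadm_const dadm_mult)

lemmas dadm_rules = dadm_const dadm_add dadm_mult dadm_power dadm_t

text \<open>The diagonal unitary with phase \<open>z\<close> at \<open>b\<close> multiplies the
  entry at row \<open>a\<close> and column \<open>b\<close> by \<open>z\<close> and leaves the
  diagonal alone.\<close>

lemma haar_mean_phase:
  assumes K: "dadm K" and ab: "a < n" "b < n" "a \<noteq> b" and z: "cmod z = 1"
  shows "haar_mean \<mu> (\<lambda>A. K A * Re (z * A a b) ^ q) = haar_mean \<mu> (\<lambda>A. K A * Re (A a b) ^ q)"
proof -
  define \<omega> where "\<omega> k = (if k = b then z else 1)" for k :: nat
  have \<omega>: "cmod (\<omega> k) = 1" for k using z by (simp add: \<omega>_def)
  have adm: "adm n \<mu> (\<lambda>A. K A * Re (A a b) ^ q)" using K ab by (intro adm_rules dadm_adm)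
  let ?u = "\<lambda>k i. \<omega> k * (if i = k then 1 else 0 :: complex)"
  have e: "bform n A (?u k) (?u l) = cnj (\<omega> k) * \<omega> l * A k l" if "k < n" "l < n" for A k l
  proof -
    have "bform n A (?u k) (?u l) = cnj (\<omega> k) * \<omega> l * bform n A (\<lambda>i. if i = k then 1 else 0) (\<lambda>i. if i = l then 1 else 0)"
      unfolding bform_def sum_distrib_left by (intro sum.cong refl) simp
    then show ?thesis by (simp add: bform_std that)
  qed
  have "haar_mean \<mu> (\<lambda>A. K A * Re (A a b) ^ q) = haar_mean \<mu> (\<lambda>A. K (\<lambda>k l. bform n A (?u k) (?u l)) * Re (bform n A (?u a) (?u b)) ^ q)"
    using haar_mean_change_basis[OF inv adm onb_phase[of \<omega>, OF \<omega>]] by simp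
  also have "\<dots> = haar_mean \<mu> (\<lambda>A. K A * Re (z * A a b) ^ q)"
  proof (rule haar_mean_cong[OF inv])
    fix P
    have "K (\<lambda>k l. bform n (fun_of_mat P) (?u k) (?u l)) = K (fun_of_mat P)"
    proof (rule dadm_cong[OF K], intro allI impI)
      fix i assume "i < n"
      have "cnj (\<omega> i) * \<omega> i = 1" using \<omega> by (simp add: cnj_mult_self)
      then show "bform n (fun_of_mat P) (?u i) (?u i) = fun_of_mat P i i" using \<open>i < n\<close> by (simp add: e)
    qed
    moreover have "bform n (fun_of_mat P) (?u a) (?u b) = z * fun_of_mat P a b"
      using ab by (simp add: e) (simp add: \<omega>_def)
    ultimately show "K (\<lambda>k l. bform n (fun_of_mat P) (?u k) (?u l)) * Re (bform n (fun_of_mat P) (?u a) (?u b)) ^ q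
      = K (fun_of_mat P) * Re (z * fun_of_mat P a b) ^ q" by simp
  qed
  finally show ?thesis by simp
qed

text \<open>The phase -1 makes each of these means equal to its own negative.\<close>

lemma haar_mean_odd:
  assumes "dadm K" "a < n" "b < n" "a \<noteq> b"
  shows "haar_mean \<mu> (\<lambda>A. K A * Re (A a b)) = 0" "haar_mean \<mu> (\<lambda>A. K A * Re (A a b) ^ 3) = 0"
proof -
  have "haar_mean \<mu> (\<lambda>A. K A * Re (A a b)) = - haar_mean \<mu> (\<lambda>A. K A * Re (A a b))"
    using haar_mean_phase[OF assms, of "-1" 1] haar_mean_cmult[OF inv, of "-1" "\<lambda>A. K A * Re (A a b)"] by simp
  then show "haar_mean \<mu> (\<lambda>A. K A * Re (A a b)) = 0" by simp
  have "haar_mean \<mu> (\<lambda>A. K A * Re (A a b) ^ 3) = - haar_mean \<mu> (\<lambda>A. K A * Re (A a b) ^ 3)"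
    using haar_mean_phase[OF assms, of "-1" 3] haar_mean_cmult[OF inv, of "-1" "\<lambda>A. K A * Re (A a b) ^ 3"] by simp
  then show "haar_mean \<mu> (\<lambda>A. K A * Re (A a b) ^ 3) = 0" by simp
qed

text \<open>The phase i exchanges real and imaginary parts up to sign, and the two squares add up to
  the product of the diagonal entries.\<close>

lemma haar_mean_square:
  assumes K: "dadm K" and ab: "a < n" "b < n" "a \<noteq> b"
  shows "haar_mean \<mu> (\<lambda>A. K A * Re (A a b) ^ 2) = haar_mean \<mu> (\<lambda>A. K A * (diag_re A a * diag_re A b)) / 2"
proof -
  have "haar_mean \<mu> (\<lambda>A. K A * Im (A a b) ^ 2) = haar_mean \<mu> (\<lambda>A. K A * Re (A a b) ^ 2)"
    using haar_mean_phase[OF assms, of \<i> 2] by simp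
  moreover have "haar_mean \<mu> (\<lambda>A. K A * Re (A a b) ^ 2 + K A * Im (A a b) ^ 2) = haar_mean \<mu> (\<lambda>A. K A * Re (A a b) ^ 2) + haar_mean \<mu> (\<lambda>A. K A * Im (A a b) ^ 2)"
    using K ab by (intro haar_mean_add[OF inv] adm_rules dadm_adm)
  moreover have "haar_mean \<mu> (\<lambda>A. K A * Re (A a b) ^ 2 + K A * Im (A a b) ^ 2) = haar_mean \<mu> (\<lambda>A. K A * (diag_re A a * diag_re A b))"
    using ab by (intro haar_mean_cong[OF inv]) (simp add: proj_space_entry(3) distrib_left)
  ultimately show ?thesis by simp
qed

text \<open>The factor 3/8 is the circular mean of the fourth power of the cosine. Four phases, at
  angles 0, 90 and plus or minus 45 degrees, already average to it, so no integral over the circle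
  is taken.\<close>

lemma haar_mean_fourth:
  assumes K: "dadm K" and ab: "a < n" "b < n" "a \<noteq> b"
  shows "haar_mean \<mu> (\<lambda>A. K A * Re (A a b) ^ 4) = 3 / 8 * haar_mean \<mu> (\<lambda>A. K A * (diag_re A a * diag_re A b)^2)"
proof -
  let ?r = "sqrt (1/2)"
  have r4: "?r ^ 4 = 1 / 4"
  proof -
    have "?r ^ (2 * 2) = (?r ^ 2) ^ 2" by (rule power_mult)
    also have "?r ^ 2 = 1 / 2" by (rule real_sqrt_pow2) simp
    finally show ?thesis by (simp add: power2_eq_square[of "1 / 2"])
  qed
  have c: "cmod (Complex ?r ?r) = 1" "cmod (Complex ?r (- ?r)) = 1"
    by (simp_all add: cmod_def)
  have 1: "haar_mean \<mu> (\<lambda>A. K A * Im (A a b) ^ 4) = haar_mean \<mu> (\<lambda>A. K A * Re (A a b) ^ 4)"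
    using haar_mean_phase[OF assms, of \<i> 4] by simp
  have 2: "haar_mean \<mu> (\<lambda>A. 1 / 4 * (K A * (Re (A a b) - Im (A a b)) ^ 4)) = haar_mean \<mu> (\<lambda>A. K A * Re (A a b) ^ 4)"
  proof -
    have "Re (Complex ?r ?r * x) ^ 4 = 1 / 4 * (Re x - Im x) ^ 4" for x
    proof -
      have "Re (Complex ?r ?r * x) = ?r * (Re x - Im x)" by (simp add: algebra_simps)
      then show ?thesis by (simp only: power_mult_distrib r4)
    qed
    then show ?thesis using haar_mean_phase[OF assms c(1), of 4] by (simp only: mult.left_commute[of "1/4"])
  qed
  have 3: "haar_mean \<mu> (\<lambda>A. 1 / 4 * (K A * (Re (A a b) + Im (A a b)) ^ 4)) = haar_mean \<mu> (\<lambda>A. K A * Re (A a b) ^ 4)"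
  proof -
    have "Re (Complex ?r (- ?r) * x) ^ 4 = 1 / 4 * (Re x + Im x) ^ 4" for x
    proof -
      have "Re (Complex ?r (- ?r) * x) = ?r * (Re x + Im x)" by (simp add: algebra_simps)
      then show ?thesis by (simp only: power_mult_distrib r4)
    qed
    then show ?thesis using haar_mean_phase[OF assms c(2), of 4] by (simp only: mult.left_commute[of "1/4"])
  qed
  have sub: "adm n \<mu> (\<lambda>A. Re (A a b) - Im (A a b))"
    using adm_add[OF inv adm_Re[OF inv] adm_cmult[OF inv adm_Im[OF inv], of a b "-1"], of a b] ab by simp
  have "haar_mean \<mu> (\<lambda>A. (K A * Re (A a b) ^ 4 + K A * Im (A a b) ^ 4) + (1 / 4 * (K A * (Re (A a b) - Im (A a b)) ^ 4) + 1 / 4 * (K A * (Re (A a b) + Im (A a b)) ^ 4)))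
    = 4 * haar_mean \<mu> (\<lambda>A. K A * Re (A a b) ^ 4)"
  proof -
    have A: "adm n \<mu> (\<lambda>A. K A * Re (A a b) ^ 4)" "adm n \<mu> (\<lambda>A. K A * Im (A a b) ^ 4)"
      "adm n \<mu> (\<lambda>A. 1 / 4 * (K A * (Re (A a b) - Im (A a b)) ^ 4))"
      "adm n \<mu> (\<lambda>A. 1 / 4 * (K A * (Re (A a b) + Im (A a b)) ^ 4))"
      by (intro adm_rules dadm_adm[OF K] ab sub adm_power[OF inv sub])+
    show ?thesis
      unfolding haar_mean_add[OF inv adm_add[OF inv A(1,2)] adm_add[OF inv A(3,4)]] haar_mean_add[OF inv A(1,2)] haar_mean_add[OF inv A(3,4)] 1 2 3
      by simp
  qed
  moreover have "haar_mean \<mu> (\<lambda>A. (K A * Re (A a b) ^ 4 + K A * Im (A a b) ^ 4) + (1 / 4 * (K A * (Re (A a b) - Im (A a b)) ^ 4) + 1 / 4 * (K A * (Re (A a b) + Im (A a b)) ^ 4)))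
    = haar_mean \<mu> (\<lambda>A. 3 / 2 * (K A * (diag_re A a * diag_re A b)^2))"
  proof (intro haar_mean_cong[OF inv])
    fix P assume P: "P \<in> proj_space n"
    have poly: "(k * x ^ 4 + k * y ^ 4) + (1 / 4 * (k * (x - y) ^ 4) + 1 / 4 * (k * (x + y) ^ 4)) = 3 / 2 * (k * (x\<^sup>2 + y\<^sup>2)^2)" for k x y :: real
      by (simp add: power2_eq_square power4_eq_xxxx field_simps)
    show "(K (fun_of_mat P) * Re (fun_of_mat P a b) ^ 4 + K (fun_of_mat P) * Im (fun_of_mat P a b) ^ 4) + (1 / 4 * (K (fun_of_mat P) * (Re (fun_of_mat P a b) - Im (fun_of_mat P a b)) ^ 4) + 1 / 4 * (K (fun_of_mat P) * (Re (fun_of_mat P a b) + Im (fun_of_mat P a b)) ^ 4))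
      = 3 / 2 * (K (fun_of_mat P) * (diag_re (fun_of_mat P) a * diag_re (fun_of_mat P) b)^2)"
      unfolding poly proj_space_entry(3)[OF P ab(1,2)] ..
  qed
  ultimately have "4 * haar_mean \<mu> (\<lambda>A. K A * Re (A a b) ^ 4) = haar_mean \<mu> (\<lambda>A. 3 / 2 * (K A * (diag_re A a * diag_re A b)^2))"
    by (simp only:)
  then show ?thesis unfolding haar_mean_cmult[OF inv] by simp
qed

text \<open>After the rotation the two diagonal entries become their mean plus and minus
  \<open>x\<close>, the real part of the entry between \<open>a\<close> and \<open>b\<close>. Odd
  powers of \<open>x\<close> average out and even ones return to the diagonal, which yields a
  relation among diagonal moments. \<open>K0\<close> to \<open>K4\<close> are the coefficients of
  the polynomial in \<open>x\<close>.\<close>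

lemma haar_mean_hada:
  assumes ab: "a < n" "b < n" "a \<noteq> b" and F: "adm n \<mu> (\<lambda>A. f (diag_re A a) (diag_re A b) * G A)"
    and G: "\<And>A B. (\<And>k. k < n \<Longrightarrow> k \<noteq> a \<Longrightarrow> k \<noteq> b \<Longrightarrow> A k k = B k k) \<Longrightarrow> G A = G B"
    and K: "dadm K0" "dadm K1" "dadm K2" "dadm K3" "dadm K4"
    and eq: "\<And>A x. f ((diag_re A a + diag_re A b) / 2 + x) ((diag_re A a + diag_re A b) / 2 - x) * G A = K0 A + K1 A * x + K2 A * x^2 + K3 A * x^3 + K4 A * x^4"
  shows "haar_mean \<mu> (\<lambda>A. f (diag_re A a) (diag_re A b) * G A) = haar_mean \<mu> (\<lambda>A. K0 A + 1 / 2 * (K2 A * (diag_re A a * diag_re A b)) + 3 / 8 * (K4 A * (diag_re A a * diag_re A b)^2))"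
proof -
  let ?h = "hada a b"
  have "haar_mean \<mu> (\<lambda>A. f (diag_re A a) (diag_re A b) * G A) = haar_mean \<mu> (\<lambda>A. f (Re (bform n A (?h a) (?h a))) (Re (bform n A (?h b) (?h b))) * G (\<lambda>k l. bform n A (?h k) (?h l)))"
    using haar_mean_change_basis[OF inv F onb_hada[OF ab]] by simp
  also have "\<dots> = haar_mean \<mu> (\<lambda>A. (((K0 A + K1 A * Re (A a b)) + K2 A * Re (A a b)^2) + K3 A * Re (A a b)^3) + K4 A * Re (A a b)^4)"
  proof (rule haar_mean_cong[OF inv])
    fix P assume P: "P \<in> proj_space n"
    let ?A = "fun_of_mat P"
    have "?A b a = cnj (?A a b)" by (rule proj_space_entry(2)[OF P ab(1,2)])
    then have "Re (bform n ?A (?h a) (?h a)) = (diag_re ?A a + diag_re ?A b) / 2 + Re (?A a b)" "Re (bform n ?A (?h b) (?h b)) = (diag_re ?A a + diag_re ?A b) / 2 - Re (?A a b)"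
      using ab by (simp_all add: bform_hada)
    moreover have "G (\<lambda>k l. bform n ?A (?h k) (?h l)) = G ?A"
      using ab by (intro G) (simp add: bform_hada)
    ultimately show "f (Re (bform n ?A (?h a) (?h a))) (Re (bform n ?A (?h b) (?h b))) * G (\<lambda>k l. bform n ?A (?h k) (?h l))
      = (((K0 ?A + K1 ?A * Re (?A a b)) + K2 ?A * Re (?A a b)^2) + K3 ?A * Re (?A a b)^3) + K4 ?A * Re (?A a b)^4"
      using eq by simp
  qed
  also have "\<dots> = haar_mean \<mu> K0 + haar_mean \<mu> (\<lambda>A. K1 A * Re (A a b)) + haar_mean \<mu> (\<lambda>A. K2 A * Re (A a b)^2) + haar_mean \<mu> (\<lambda>A. K3 A * Re (A a b)^3) + haar_mean \<mu> (\<lambda>A. K4 A * Re (A a b)^4)"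
    using K ab by (simp add: haar_mean_add[OF inv] adm_rules dadm_adm)
  also have "\<dots> = haar_mean \<mu> K0 + haar_mean \<mu> (\<lambda>A. K2 A * (diag_re A a * diag_re A b)) / 2 + 3 / 8 * haar_mean \<mu> (\<lambda>A. K4 A * (diag_re A a * diag_re A b)^2)"
    using K ab by (simp add: haar_mean_odd haar_mean_square haar_mean_fourth)
  also have "\<dots> = haar_mean \<mu> (\<lambda>A. K0 A + 1 / 2 * (K2 A * (diag_re A a * diag_re A b)) + 3 / 8 * (K4 A * (diag_re A a * diag_re A b)^2))"
    using K ab by (simp add: haar_mean_add[OF inv] haar_mean_cmult[OF inv] adm_rules dadm_adm del: times_divide_eq_left)
  finally show ?thesis .
qed

definition haar_moment :: "nat \<Rightarrow> nat \<Rightarrow> nat \<Rightarrow> nat \<Rightarrow> real" where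
  "haar_moment i j k l = haar_mean \<mu> (\<lambda>A. diag_re A i * diag_re A j * diag_re A k * diag_re A l)"

lemma haar_moment_comm: "haar_moment j i k l = haar_moment i j k l" "haar_moment i k j l = haar_moment i j k l" "haar_moment i j l k = haar_moment i j k l"
  by (simp_all add: haar_moment_def mult_ac)

text \<open>Five terms fit the longest relation below; shorter ones are padded with zero
  coefficients.\<close>

lemma haar_mean_expand5:
  assumes "i1 < n" "i2 < n" "i3 < n" "i4 < n" "j1 < n" "j2 < n" "j3 < n" "j4 < n" "k1 < n" "k2 < n" "k3 < n" "k4 < n"
    "l1 < n" "l2 < n" "l3 < n" "l4 < n" "m1 < n" "m2 < n" "m3 < n" "m4 < n"
  shows "haar_mean \<mu> (\<lambda>A. c1 * (diag_re A i1 * diag_re A i2 * diag_re A i3 * diag_re A i4) + (c2 * (diag_re A j1 * diag_re A j2 * diag_re A j3 * diag_re A j4) + (c3 * (diag_re A k1 * diag_re A k2 * diag_re A k3 * diag_re A k4)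
     + (c4 * (diag_re A l1 * diag_re A l2 * diag_re A l3 * diag_re A l4) + c5 * (diag_re A m1 * diag_re A m2 * diag_re A m3 * diag_re A m4)))))
    = c1 * haar_moment i1 i2 i3 i4 + c2 * haar_moment j1 j2 j3 j4 + c3 * haar_moment k1 k2 k3 k4 + c4 * haar_moment l1 l2 l3 l4 + c5 * haar_moment m1 m2 m3 m4"
  using assms by (simp add: haar_mean_add[OF inv] haar_mean_cmult[OF inv] adm_rules haar_moment_def)

text \<open>The first of the relations that determine all moments up to a common factor: rotate in
  the plane of \<open>a\<close> and \<open>b\<close> and keep the other indices as
  spectators.\<close>

lemma haar_moment_rotation2:
  assumes ab: "a < n" "b < n" "a \<noteq> b" and k: "k < n" "k \<noteq> a" "k \<noteq> b" and l: "l < n" "l \<noteq> a" "l \<noteq> b"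
  shows "haar_moment a a k l = 1 / 4 * haar_moment a a k l + haar_moment a b k l + 1 / 4 * haar_moment b b k l"
proof -
  have "haar_moment a a k l = haar_mean \<mu> (\<lambda>A. (\<lambda>x y. x * x) (diag_re A a) (diag_re A b) * (diag_re A k * diag_re A l))" by (simp add: haar_moment_def mult_ac)
  also have "\<dots> = haar_mean \<mu> (\<lambda>A. (diag_re A a + diag_re A b) ^ 2 * (1 / 4 * (diag_re A k * diag_re A l)) + 1 / 2 * ((diag_re A k * diag_re A l) * (diag_re A a * diag_re A b)) + 3 / 8 * (0 * (diag_re A a * diag_re A b)^2))"
    \<comment> \<open>The odd coefficients do not occur in the conclusion of the rule, so they are
      supplied explicitly.\<close>
    by (rule haar_mean_hada[OF ab, where ?K1.0 = "\<lambda>A. (diag_re A a + diag_re A b) * (diag_re A k * diag_re A l)" and ?K3.0 = "\<lambda>_. 0"];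
       ((intro adm_rules dadm_rules ab k(1) l(1); fail) | (simp add: k l; fail) | (simp add: power2_eq_square power3_eq_cube power4_eq_xxxx field_simps; fail)))
  also have "\<dots> = haar_mean \<mu> (\<lambda>A. (1/4) * (diag_re A a * diag_re A a * diag_re A k * diag_re A l) + (1 * (diag_re A a * diag_re A b * diag_re A k * diag_re A l) + ((1/4) * (diag_re A b * diag_re A b * diag_re A k * diag_re A l)
     + (0 * (diag_re A a * diag_re A a * diag_re A a * diag_re A a) + 0 * (diag_re A a * diag_re A a * diag_re A a * diag_re A a)))))"
    by (rule arg_cong[of _ _ "haar_mean \<mu>"]) (simp add: fun_eq_iff power2_eq_square field_simps)
  also have "\<dots> = 1 / 4 * haar_moment a a k l + haar_moment a b k l + 1 / 4 * haar_moment b b k l"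
    using ab k l by (subst haar_mean_expand5) auto
  finally show ?thesis .
qed

lemma haar_moment_rotation3:
  assumes ab: "a < n" "b < n" "a \<noteq> b" and l: "l < n" "l \<noteq> a" "l \<noteq> b"
  shows "haar_moment a a a l = 1 / 8 * haar_moment a a a l + 9 / 8 * haar_moment a a b l + 9 / 8 * haar_moment a b b l + 1 / 8 * haar_moment b b b l"
    and "haar_moment a a b l = 1 / 8 * haar_moment a a a l + 1 / 8 * haar_moment a a b l + 1 / 8 * haar_moment a b b l + 1 / 8 * haar_moment b b b l"
proof -
  have "haar_moment a a a l = haar_mean \<mu> (\<lambda>A. (\<lambda>x y. x * x * x) (diag_re A a) (diag_re A b) * diag_re A l)" by (simp add: haar_moment_def mult_ac)
  also have "\<dots> = haar_mean \<mu> (\<lambda>A. (diag_re A a + diag_re A b) ^ 3 * (1 / 8 * diag_re A l) + 1 / 2 * (((diag_re A a + diag_re A b) * (3 / 2 * diag_re A l)) * (diag_re A a * diag_re A b)) + 3 / 8 * (0 * (diag_re A a * diag_re A b)^2))"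
    by (rule haar_mean_hada[OF ab, where ?K1.0 = "\<lambda>A. (diag_re A a + diag_re A b)^2 * (3 / 4 * diag_re A l)" and ?K3.0 = "\<lambda>A. diag_re A l"];
       ((intro adm_rules dadm_rules ab l(1); fail) | (simp add: l; fail) | (simp add: power2_eq_square power3_eq_cube power4_eq_xxxx field_simps; fail)))
  also have "\<dots> = haar_mean \<mu> (\<lambda>A. (1/8) * (diag_re A a * diag_re A a * diag_re A a * diag_re A l) + ((9/8) * (diag_re A a * diag_re A a * diag_re A b * diag_re A l) + ((9/8) * (diag_re A a * diag_re A b * diag_re A b * diag_re A l)
     + ((1/8) * (diag_re A b * diag_re A b * diag_re A b * diag_re A l) + 0 * (diag_re A a * diag_re A a * diag_re A a * diag_re A a)))))"
    by (rule arg_cong[of _ _ "haar_mean \<mu>"]) (simp add: fun_eq_iff power2_eq_square power3_eq_cube field_simps)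
  also have "\<dots> = 1 / 8 * haar_moment a a a l + 9 / 8 * haar_moment a a b l + 9 / 8 * haar_moment a b b l + 1 / 8 * haar_moment b b b l"
    using ab l by (subst haar_mean_expand5) auto
  finally show "haar_moment a a a l = 1 / 8 * haar_moment a a a l + 9 / 8 * haar_moment a a b l + 9 / 8 * haar_moment a b b l + 1 / 8 * haar_moment b b b l" .
  have "haar_moment a a b l = haar_mean \<mu> (\<lambda>A. (\<lambda>x y. x * x * y) (diag_re A a) (diag_re A b) * diag_re A l)" by (simp add: haar_moment_def mult_ac)
  also have "\<dots> = haar_mean \<mu> (\<lambda>A. (diag_re A a + diag_re A b) ^ 3 * (1 / 8 * diag_re A l) + 1 / 2 * (((diag_re A a + diag_re A b) * (- 1 / 2 * diag_re A l)) * (diag_re A a * diag_re A b)) + 3 / 8 * (0 * (diag_re A a * diag_re A b)^2))"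
    by (rule haar_mean_hada[OF ab, where ?K1.0 = "\<lambda>A. (diag_re A a + diag_re A b)^2 * (1 / 4 * diag_re A l)" and ?K3.0 = "\<lambda>A. - 1 * diag_re A l"];
       ((intro adm_rules dadm_rules ab l(1); fail) | (simp add: l; fail) | (simp add: power2_eq_square power3_eq_cube power4_eq_xxxx field_simps; fail)))
  also have "\<dots> = haar_mean \<mu> (\<lambda>A. (1/8) * (diag_re A a * diag_re A a * diag_re A a * diag_re A l) + ((1/8) * (diag_re A a * diag_re A a * diag_re A b * diag_re A l) + ((1/8) * (diag_re A a * diag_re A b * diag_re A b * diag_re A l)
     + ((1/8) * (diag_re A b * diag_re A b * diag_re A b * diag_re A l) + 0 * (diag_re A a * diag_re A a * diag_re A a * diag_re A a)))))"
    by (rule arg_cong[of _ _ "haar_mean \<mu>"]) (simp add: fun_eq_iff power2_eq_square power3_eq_cube field_simps)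
  also have "\<dots> = 1 / 8 * haar_moment a a a l + 1 / 8 * haar_moment a a b l + 1 / 8 * haar_moment a b b l + 1 / 8 * haar_moment b b b l"
    using ab l by (subst haar_mean_expand5) auto
  finally show "haar_moment a a b l = 1 / 8 * haar_moment a a a l + 1 / 8 * haar_moment a a b l + 1 / 8 * haar_moment a b b l + 1 / 8 * haar_moment b b b l" .
qed

lemma haar_moment_rotation4:
  assumes ab: "a < n" "b < n" "a \<noteq> b"
  shows "haar_moment a a a a = 1 / 16 * haar_moment a a a a + haar_moment a a a b + 9 / 4 * haar_moment a a b b + haar_moment a b b b + 1 / 16 * haar_moment b b b b"
    and "haar_moment a a a b = 1 / 16 * haar_moment a a a a + 1 / 4 * haar_moment a a a b + 0 * haar_moment a a b b + 1 / 4 * haar_moment a b b b + 1 / 16 * haar_moment b b b b"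
    and "haar_moment a a b b = 1 / 16 * haar_moment a a a a + 0 * haar_moment a a a b + 1 / 4 * haar_moment a a b b + 0 * haar_moment a b b b + 1 / 16 * haar_moment b b b b"
proof -
  have "haar_moment a a a a = haar_mean \<mu> (\<lambda>A. (\<lambda>x y. x * x * x * x) (diag_re A a) (diag_re A b) * 1)" by (simp add: haar_moment_def mult_ac)
  also have "\<dots> = haar_mean \<mu> (\<lambda>A. (diag_re A a + diag_re A b) ^ 4 * (1 / 16) + 1 / 2 * (((diag_re A a + diag_re A b)^2 * (3 / 2)) * (diag_re A a * diag_re A b)) + 3 / 8 * (1 * (diag_re A a * diag_re A b)^2))"
    by (rule haar_mean_hada[OF ab, where ?K1.0 = "\<lambda>A. (diag_re A a + diag_re A b)^3 * (1 / 2)" and ?K3.0 = "\<lambda>A. (diag_re A a + diag_re A b) * 2"];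
       ((intro adm_rules dadm_rules ab; fail) | (simp; fail) | (simp add: power2_eq_square power3_eq_cube power4_eq_xxxx field_simps; fail)))
  also have "\<dots> = haar_mean \<mu> (\<lambda>A. (1/16) * (diag_re A a * diag_re A a * diag_re A a * diag_re A a) + (1 * (diag_re A a * diag_re A a * diag_re A a * diag_re A b) + ((9/4) * (diag_re A a * diag_re A a * diag_re A b * diag_re A b)
     + (1 * (diag_re A a * diag_re A b * diag_re A b * diag_re A b) + (1/16) * (diag_re A b * diag_re A b * diag_re A b * diag_re A b)))))"
    by (rule arg_cong[of _ _ "haar_mean \<mu>"]) (simp add: fun_eq_iff power2_eq_square power4_eq_xxxx field_simps)
  also have "\<dots> = 1 / 16 * haar_moment a a a a + haar_moment a a a b + 9 / 4 * haar_moment a a b b + haar_moment a b b b + 1 / 16 * haar_moment b b b b"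
    using ab by (subst haar_mean_expand5) auto
  finally show "haar_moment a a a a = 1 / 16 * haar_moment a a a a + haar_moment a a a b + 9 / 4 * haar_moment a a b b + haar_moment a b b b + 1 / 16 * haar_moment b b b b" .
  have "haar_moment a a a b = haar_mean \<mu> (\<lambda>A. (\<lambda>x y. x * x * x * y) (diag_re A a) (diag_re A b) * 1)" by (simp add: haar_moment_def mult_ac)
  also have "\<dots> = haar_mean \<mu> (\<lambda>A. (diag_re A a + diag_re A b) ^ 4 * (1 / 16) + 1 / 2 * (0 * (diag_re A a * diag_re A b)) + 3 / 8 * ((- 1) * (diag_re A a * diag_re A b)^2))"
    by (rule haar_mean_hada[OF ab, where ?K1.0 = "\<lambda>A. (diag_re A a + diag_re A b)^3 * (1 / 4)" and ?K3.0 = "\<lambda>A. (diag_re A a + diag_re A b) * (- 1)"];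
       ((intro adm_rules dadm_rules ab; fail) | (simp; fail) | (simp add: power2_eq_square power3_eq_cube power4_eq_xxxx field_simps; fail)))
  also have "\<dots> = haar_mean \<mu> (\<lambda>A. (1/16) * (diag_re A a * diag_re A a * diag_re A a * diag_re A a) + ((1/4) * (diag_re A a * diag_re A a * diag_re A a * diag_re A b) + (0 * (diag_re A a * diag_re A a * diag_re A b * diag_re A b)
     + ((1/4) * (diag_re A a * diag_re A b * diag_re A b * diag_re A b) + (1/16) * (diag_re A b * diag_re A b * diag_re A b * diag_re A b)))))"
    by (rule arg_cong[of _ _ "haar_mean \<mu>"]) (simp add: fun_eq_iff power2_eq_square power4_eq_xxxx field_simps)
  also have "\<dots> = 1 / 16 * haar_moment a a a a + 1 / 4 * haar_moment a a a b + 0 * haar_moment a a b b + 1 / 4 * haar_moment a b b b + 1 / 16 * haar_moment b b b b"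
    using ab by (subst haar_mean_expand5) auto
  finally show "haar_moment a a a b = 1 / 16 * haar_moment a a a a + 1 / 4 * haar_moment a a a b + 0 * haar_moment a a b b + 1 / 4 * haar_moment a b b b + 1 / 16 * haar_moment b b b b" .
  have "haar_moment a a b b = haar_mean \<mu> (\<lambda>A. (\<lambda>x y. x * x * y * y) (diag_re A a) (diag_re A b) * 1)" by (simp add: haar_moment_def mult_ac)
  also have "\<dots> = haar_mean \<mu> (\<lambda>A. (diag_re A a + diag_re A b) ^ 4 * (1 / 16) + 1 / 2 * (((diag_re A a + diag_re A b)^2 * (- 1 / 2)) * (diag_re A a * diag_re A b)) + 3 / 8 * (1 * (diag_re A a * diag_re A b)^2))"
    by (rule haar_mean_hada[OF ab, where ?K1.0 = "\<lambda>A. 0" and ?K3.0 = "\<lambda>A. 0"];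
       ((intro adm_rules dadm_rules ab; fail) | (simp; fail) | (simp add: power2_eq_square power3_eq_cube power4_eq_xxxx field_simps; fail)))
  also have "\<dots> = haar_mean \<mu> (\<lambda>A. (1/16) * (diag_re A a * diag_re A a * diag_re A a * diag_re A a) + (0 * (diag_re A a * diag_re A a * diag_re A a * diag_re A b) + ((1/4) * (diag_re A a * diag_re A a * diag_re A b * diag_re A b)
     + (0 * (diag_re A a * diag_re A b * diag_re A b * diag_re A b) + (1/16) * (diag_re A b * diag_re A b * diag_re A b * diag_re A b)))))"
    by (rule arg_cong[of _ _ "haar_mean \<mu>"]) (simp add: fun_eq_iff power2_eq_square power4_eq_xxxx field_simps)
  also have "\<dots> = 1 / 16 * haar_moment a a a a + 0 * haar_moment a a a b + 1 / 4 * haar_moment a a b b + 0 * haar_moment a b b b + 1 / 16 * haar_moment b b b b"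
    using ab by (subst haar_mean_expand5) auto
  finally show "haar_moment a a b b = 1 / 16 * haar_moment a a a a + 0 * haar_moment a a a b + 1 / 4 * haar_moment a a b b + 0 * haar_moment a b b b + 1 / 16 * haar_moment b b b b" .
qed

text \<open>Solves the relations from both orders of \<open>a\<close> and \<open>b\<close>. The
  ratios 24 : 6 : 4 are the numbers of permutations that fix the respective index pattern.\<close>

lemma haar_moment_values:
  assumes ab: "a < n" "b < n" "a \<noteq> b"
  shows "haar_moment b b b b = haar_moment a a a a" "haar_moment a a a b = haar_moment a a a a / 4" "haar_moment a a b b = haar_moment a a a a / 6"
proof -
  have c: "haar_moment b b b a = haar_moment a b b b" "haar_moment b a a a = haar_moment a a a b" "haar_moment b b a a = haar_moment a a b b" by (metis haar_moment_comm)+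
  note r = haar_moment_rotation4[OF ab] haar_moment_rotation4[OF ab(2,1) ab(3)[symmetric], unfolded c]
  show "haar_moment b b b b = haar_moment a a a a" "haar_moment a a a b = haar_moment a a a a / 4" "haar_moment a a b b = haar_moment a a a a / 6" using r by linarith+
qed

lemma haar_moment_values3:
  assumes ab: "a < n" "b < n" "a \<noteq> b" and l: "l < n" "l \<noteq> a" "l \<noteq> b"
  shows "haar_moment a a b l = haar_moment a a a a / 12"
proof -
  have c: "haar_moment b a a l = haar_moment a a b l" "haar_moment b b a l = haar_moment a b b l" by (metis haar_moment_comm)+
  have "haar_moment a a a l = 3 * haar_moment a a b l"
    using haar_moment_rotation3[OF ab l] haar_moment_rotation3[OF ab(2,1) ab(3)[symmetric] l(1,3,2), unfolded c] by linarith
  then show ?thesis using haar_moment_values(2)[OF ab(1) l(1) l(2)[symmetric]] by simp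
qed

lemma haar_moment_values4:
  assumes "a < n" "b < n" "k < n" "l < n" "distinct [a, b, k, l]"
  shows "haar_moment a b k l = haar_moment a a a a / 24"
proof -
  have c: "haar_moment b a k l = haar_moment a b k l" by (metis haar_moment_comm)
  have "haar_moment a a k l = 2 * haar_moment a b k l"
    using haar_moment_rotation2[of a b k l] haar_moment_rotation2[of b a k l] assms unfolding c by auto
  then show ?thesis using haar_moment_values3[of a k l] assms by auto
qed

text \<open>Commuting the factors reduces every coincidence pattern of four indices to a solved
  case. The divisor 24 is the value of \<open>s24\<close> at four equal indices.\<close>

lemma haar_moment_eq_diag:
  assumes z: "z < n" and ijkl: "i < n" "j < n" "k < n" "l < n"
  shows "haar_moment i j k l = haar_moment z z z z / 24 * s24 i j k l"
proof -
  have d: "haar_moment a a a a = haar_moment z z z z" if "a < n" for a using haar_moment_values(1)[of z a] z that by (cases "a = z") auto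
  have v2: "haar_moment a a a b = haar_moment z z z z / 4" "haar_moment a a b b = haar_moment z z z z / 6" if "a < n" "b < n" "a \<noteq> b" for a b
    using haar_moment_values[OF that] d that by auto
  have v3: "haar_moment a a b c = haar_moment z z z z / 12" if "a < n" "b < n" "c < n" "a \<noteq> b" "c \<noteq> a" "c \<noteq> b" for a b c
    using haar_moment_values3[of a b c] d that by auto
  have tensor4: "haar_moment a b c e = haar_moment z z z z / 24" if "a < n" "b < n" "c < n" "e < n" "distinct [a, b, c, e]" for a b c e
    using haar_moment_values4[OF that] d that by auto
  show ?thesis
  proof (cases "i = j")
    case ij: True
    show ?thesis
    proof (cases "i = k")
      case ik: True
      show ?thesis using ij ik d ijkl v2(1)[of i l] by (cases "i = l") (auto simp: s24_def kron_def)
    next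
      case ik: False
      show ?thesis using ij ik ijkl v2(1)[of i k] v2(2)[of i k] v3[of i k l] haar_moment_comm(3)[of i i k i]
        by (cases "i = l"; cases "k = l") (auto simp: s24_def kron_def)
    qed
  next
    case ij: False
    show ?thesis
    proof (cases "i = k")
      case ik: True
      have c: "haar_moment i j i l = haar_moment i i j l" "haar_moment i i j i = haar_moment i i i j" "haar_moment i j i j = haar_moment i i j j" by (metis haar_moment_comm)+
      show ?thesis using ij ik ijkl v2(1)[of i j] v2(2)[of i j] v3[of i j l] c
        by (cases "i = l"; cases "j = l") (auto simp: s24_def kron_def)
    next
      case ik: False
      show ?thesis
      proof (cases "j = k")
        case jk: True
        have c: "haar_moment i j j l = haar_moment j j i l" "haar_moment j j i i = haar_moment i i j j" "haar_moment j j i j = haar_moment j j j i" by (metis haar_moment_comm)+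
        show ?thesis using ij ik jk ijkl v2(1)[of j i] v2(2)[of i j] v3[of j i l] c
          by (cases "i = l"; cases "j = l") (auto simp: s24_def kron_def)
      next
        case jk: False
        have c: "haar_moment i j k i = haar_moment i i j k" "haar_moment i j k j = haar_moment j j i k" "haar_moment i j k k = haar_moment k k i j" by (metis haar_moment_comm)+
        consider "i = l" | "j = l" | "k = l" | "i \<noteq> l" "j \<noteq> l" "k \<noteq> l" by blast
        then show ?thesis
        proof cases
          case 1
          have "haar_moment i j k l = haar_moment z z z z / 12" using c(1) v3[of i j k] 1 ij ik jk ijkl by simp
          then show ?thesis using 1 ij ik jk by (simp add: s24_def kron_def)
        next
          case 2
          have "haar_moment i j k l = haar_moment z z z z / 12" using c(2) v3[of j i k] 2 ij ik jk ijkl by simp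
          then show ?thesis using 2 ij ik jk by (simp add: s24_def kron_def)
        next
          case 3
          have "haar_moment i j k l = haar_moment z z z z / 12" using c(3) v3[of k i j] 3 ij ik jk ijkl by simp
          then show ?thesis using 3 ij ik jk by (simp add: s24_def kron_def)
        next
          case 4
          have "haar_moment i j k l = haar_moment z z z z / 24" using tensor4[of i j k l] 4 ij ik jk ijkl by simp
          then show ?thesis using 4 ij ik jk by (simp add: s24_def kron_def)
        qed
      qed
    qed
  qed
qed

end

section \<open>Sums of permutation counts\<close>

lemma sum_kron: "i < n \<Longrightarrow> (\<Sum>j<n. kron i j * f j) = f i"
  by (simp add: kron_def if_distrib[of "\<lambda>z. z * _"] cong: if_cong)

text \<open>Only the last factor of \<open>s24\<close> depends on \<open>l\<close>, and each
  Kronecker term picks out one value of \<open>x\<close>. Peeling off one index after another in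
  this way produces the rising factorial in \<open>sum_s24_total\<close>.\<close>

lemma sum_s24_inner:
  assumes "i < n" "j < n" "k < n"
  shows "(\<Sum>l<n. x l * s24 i j k l) = (1 + kron i j) * (1 + kron i k + kron j k) * (sum x {..<n} + x i + x j + x k)"
proof -
  have "(\<Sum>l<n. x l * s24 i j k l) = (1 + kron i j) * (1 + kron i k + kron j k) * (\<Sum>l<n. x l + kron i l * x l + kron j l * x l + kron k l * x l)"
    unfolding sum_distrib_left s24_def by (intro sum.cong refl) (simp add: algebra_simps)
  also have "(\<Sum>l<n. x l + kron i l * x l + kron j l * x l + kron k l * x l) = sum x {..<n} + x i + x j + x k"
    using assms by (simp add: sum.distrib sum_kron)
  finally show ?thesis .
qed

lemma sum_s24_inner2:
  assumes "i < n" "j < n"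
  shows "(\<Sum>k<n. \<Sum>l<n. s24 i j k l) = (1 + kron i j) * ((real n + 2) * (real n + 3))"
proof -
  have "(\<Sum>k<n. \<Sum>l<n. s24 i j k l) = (\<Sum>k<n. (1 + kron i j) * (real n + 3) * (1 + kron i k * 1 + kron j k * 1))"
    using sum_s24_inner[OF assms, of _ "\<lambda>_. 1"] by (intro sum.cong refl) (simp add: algebra_simps)
  also have "\<dots> = (1 + kron i j) * (real n + 3) * (real n + 1 + 1)"
    using assms unfolding sum_distrib_left[symmetric] sum.distrib by (simp add: sum_kron[of _ _ "\<lambda>_. 1", simplified])
  finally show ?thesis by (simp add: algebra_simps)
qed

lemma sum_s24_total: "(\<Sum>i<n. \<Sum>j<n. \<Sum>k<n. \<Sum>l<n. s24 i j k l) = real n * (real n + 1) * (real n + 2) * (real n + 3)"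
proof -
  have "(\<Sum>i<n. \<Sum>j<n. \<Sum>k<n. \<Sum>l<n. s24 i j k l) = (\<Sum>i<n. \<Sum>j<n. (1 + kron i j * 1) * ((real n + 2) * (real n + 3)))"
    using sum_s24_inner2 by (intro sum.cong refl) simp
  also have "\<dots> = (\<Sum>i<n. (real n + 1) * ((real n + 2) * (real n + 3)))"
  proof (intro sum.cong refl)
    fix i assume "i \<in> {..<n}"
    then show "(\<Sum>j<n. (1 + kron i j * 1) * ((real n + 2) * (real n + 3))) = (real n + 1) * ((real n + 2) * (real n + 3))"
      unfolding sum_distrib_right[symmetric] sum.distrib using sum_kron[of i n "\<lambda>_. 1"] by simp
  qed
  finally show ?thesis by (simp add: algebra_simps)
qed

text \<open>The common factor left open by the relations is fixed by trace 1: all moments together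
  sum to the mean of the fourth power of the trace, and the total of \<open>s24\<close> becomes the
  denominator. Invariance carries the value to an arbitrary basis.\<close>

lemma haar_fourth_moment:
  assumes inv: "unitarily_invariant_prob n \<mu>" and n: "0 < n" and u: "onb n u"
    and ijkl: "i < n" "j < n" "k < n" "l < n"
  shows "(\<integral>P. qf n (fun_of_mat P) (u i) * qf n (fun_of_mat P) (u j) * qf n (fun_of_mat P) (u k) * qf n (fun_of_mat P) (u l) \<partial>\<mu>)
    = s24 i j k l / (real n * (real n + 1) * (real n + 2) * (real n + 3))"
proof -
  let ?m = "haar_moment \<mu>"
  let ?F = "\<lambda>i j k l A. Re (A i i) * Re (A j j) * Re (A k k) * Re (A l l)"
  have adm: "adm n \<mu> (?F i j k l)" if "i < n" "j < n" "k < n" "l < n" for i j k l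
    using that by (intro adm_mult[OF inv] adm_Re[OF inv])
  have eq: "?m i j k l = ?m 0 0 0 0 / 24 * s24 i j k l" if "i < n" "j < n" "k < n" "l < n" for i j k l
    using haar_moment_eq_diag[OF inv n that] .
  have "(\<Sum>i<n. \<Sum>j<n. \<Sum>k<n. \<Sum>l<n. ?m i j k l) = haar_mean \<mu> (\<lambda>A. \<Sum>i<n. \<Sum>j<n. \<Sum>k<n. \<Sum>l<n. ?F i j k l A)"
  proof -
    have "haar_mean \<mu> (\<lambda>A. \<Sum>i<n. \<Sum>j<n. \<Sum>k<n. \<Sum>l<n. ?F i j k l A) = (\<Sum>i<n. haar_mean \<mu> (\<lambda>A. \<Sum>j<n. \<Sum>k<n. \<Sum>l<n. ?F i j k l A))"
      by (rule haar_mean_sum[OF inv]) (simp, (intro adm_sum[OF inv] finite_lessThan adm; simp))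
    also have "\<dots> = (\<Sum>i<n. \<Sum>j<n. haar_mean \<mu> (\<lambda>A. \<Sum>k<n. \<Sum>l<n. ?F i j k l A))"
      by (rule sum.cong[OF refl], rule haar_mean_sum[OF inv]) (simp, (intro adm_sum[OF inv] finite_lessThan adm; simp))
    also have "\<dots> = (\<Sum>i<n. \<Sum>j<n. \<Sum>k<n. haar_mean \<mu> (\<lambda>A. \<Sum>l<n. ?F i j k l A))"
      by (rule sum.cong[OF refl], rule sum.cong[OF refl], rule haar_mean_sum[OF inv]) (simp, (intro adm_sum[OF inv] finite_lessThan adm; simp))
    also have "\<dots> = (\<Sum>i<n. \<Sum>j<n. \<Sum>k<n. \<Sum>l<n. haar_mean \<mu> (?F i j k l))"
      by (rule sum.cong[OF refl], rule sum.cong[OF refl], rule sum.cong[OF refl], rule haar_mean_sum[OF inv]) (simp, (intro adm; simp))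
    finally show ?thesis unfolding haar_moment_def[OF inv, abs_def] by (rule sym)
  qed
  also have "\<dots> = haar_mean \<mu> (\<lambda>_. 1)"
  proof (rule haar_mean_cong[OF inv])
    fix P assume "P \<in> proj_space n"
    then have "(\<Sum>i<n. Re (fun_of_mat P i i)) = 1" by (rule proj_space_trace)
    then show "(\<Sum>i<n. \<Sum>j<n. \<Sum>k<n. \<Sum>l<n. ?F i j k l (fun_of_mat P)) = 1"
      by (simp flip: sum_distrib_left sum_distrib_right)
  qed
  finally have one: "(\<Sum>i<n. \<Sum>j<n. \<Sum>k<n. \<Sum>l<n. ?m i j k l) = 1" by (simp add: haar_mean_const[OF inv])
  define c where "c = ?m 0 0 0 0 / 24"
  have "(\<Sum>i<n. \<Sum>j<n. \<Sum>k<n. \<Sum>l<n. ?m i j k l) = (\<Sum>i<n. \<Sum>j<n. \<Sum>k<n. \<Sum>l<n. c * s24 i j k l)"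
    unfolding c_def by (intro sum.cong refl eq) auto
  also have "\<dots> = c * (real n * (real n + 1) * (real n + 2) * (real n + 3))"
    unfolding sum_s24_total[symmetric] sum_distrib_left ..
  finally have "c * (real n * (real n + 1) * (real n + 2) * (real n + 3)) = 1" using one by simp
  then have "?m 0 0 0 0 / 24 * (real n * (real n + 1) * (real n + 2) * (real n + 3)) = 1"
    by (simp only: c_def)
  then have m0: "?m 0 0 0 0 / 24 = 1 / (real n * (real n + 1) * (real n + 2) * (real n + 3))"
    using n by (intro eq_divide_imp) auto
  have "(\<integral>P. qf n (fun_of_mat P) (u i) * qf n (fun_of_mat P) (u j) * qf n (fun_of_mat P) (u k) * qf n (fun_of_mat P) (u l) \<partial>\<mu>)
    = haar_mean \<mu> (\<lambda>A. ?F i j k l (\<lambda>k l. bform n A (u k) (u l)))"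
    by (simp add: haar_mean_def[OF inv])
  also have "\<dots> = ?m i j k l" unfolding haar_moment_def[OF inv] by (rule haar_mean_change_basis[OF inv adm[OF ijkl] u])
  also have "\<dots> = s24 i j k l / (real n * (real n + 1) * (real n + 2) * (real n + 3))"
    unfolding eq[OF ijkl] m0 by simp
  finally show ?thesis .
qed

section \<open>Approximate four-designs\<close>

text \<open>Spelled out over all 24 permutations, so that the symmetric group enters only through
  finite checks by simplification.\<close>

definition sym4 :: "(nat \<Rightarrow> nat \<Rightarrow> nat \<Rightarrow> nat \<Rightarrow> 'a::comm_monoid_add) \<Rightarrow> nat \<Rightarrow> nat \<Rightarrow> nat \<Rightarrow> nat \<Rightarrow> 'a" where
  "sym4 f i j k l =
     (f i j k l + f i j l k + f i k j l + f i k l j + f i l j k + f i l k j) +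
     (f j i k l + f j i l k + f j k i l + f j k l i + f j l i k + f j l k i) +
     (f k i j l + f k i l j + f k j i l + f k j l i + f k l i j + f k l j i) +
     (f l i j k + f l i k j + f l j i k + f l j k i + f l k i j + f l k j i)"

definition kron4 :: "nat \<Rightarrow> nat \<Rightarrow> nat \<Rightarrow> nat \<Rightarrow> nat \<Rightarrow> nat \<Rightarrow> nat \<Rightarrow> nat \<Rightarrow> real" where
  "kron4 i j k l a b c d = kron i a * kron j b * kron k c * kron l d"

lemma sym4_cong:
  assumes "\<And>a b c d. a \<in> {i, j, k, l} \<Longrightarrow> b \<in> {i, j, k, l} \<Longrightarrow> c \<in> {i, j, k, l} \<Longrightarrow> d \<in> {i, j, k, l} \<Longrightarrow> f a b c d = g a b c d"
  shows "sym4 f i j k l = sym4 g i j k l"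
  unfolding sym4_def by (intro arg_cong2[of _ _ _ _ "(+)"] assms; simp)

lemma sym4_perm:
  "sym4 (\<lambda>a b c d. f b a c d) i j k l = sym4 f i j k l"
  "sym4 (\<lambda>a b c d. f a c b d) i j k l = sym4 f i j k l"
  "sym4 (\<lambda>a b c d. f a b d c) i j k l = sym4 f i j k l"
  by (simp_all add: sym4_def add_ac)

lemma sym4_symmetric:
  fixes S :: "nat \<Rightarrow> nat \<Rightarrow> nat \<Rightarrow> nat \<Rightarrow> real"
  assumes "\<And>a b c d. S b a c d = S a b c d" "\<And>a b c d. S a c b d = S a b c d" "\<And>a b c d. S a b d c = S a b c d"
  shows "sym4 S i j k l = 24 * S i j k l"
  unfolding sym4_def by (simp add: assms)

lemma sym4_kron4: "sym4 (kron4 i j k l) i j k l = s24 i j k l"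
  unfolding sym4_def kron4_def s24_def kron_def
  by (cases "i = j"; cases "i = k"; cases "i = l"; cases "j = k"; cases "j = l"; cases "k = l"; simp)

text \<open>The inner sum is invariant under the adjacent transpositions, which generate all
  permutations; symmetrising it once more merely multiplies by 24.\<close>

lemma sym4_sym4_kron4: "sym4 (\<lambda>a b c d. sym4 (kron4 a b c d) i j k l) i j k l = 24 * s24 i j k l"
proof -
  define S where "S a b c d = sym4 (kron4 a b c d) i j k l" for a b c d
  have 1: "S b a c d = S a b c d" for a b c d
    unfolding S_def sym4_perm(1)[of "kron4 a b c d", symmetric] by (simp add: kron4_def[abs_def] mult_ac)
  have 2: "S a c b d = S a b c d" for a b c d
    unfolding S_def sym4_perm(2)[of "kron4 a b c d", symmetric] by (simp add: kron4_def[abs_def] mult_ac)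
  have 3: "S a b d c = S a b c d" for a b c d
    unfolding S_def sym4_perm(3)[of "kron4 a b c d", symmetric] by (simp add: kron4_def[abs_def] mult_ac)
  have "sym4 S i j k l = 24 * S i j k l" by (rule sym4_symmetric) (fact 1 2 3)+
  then show ?thesis unfolding S_def[abs_def] sym4_kron4 .
qed

section \<open>Base \<open>n\<close> digits and product bases\<close>

lemma sum_div_mod: "(\<Sum>a<n * m. f (a div m) (a mod m)) = (\<Sum>i<n. \<Sum>j<m. f i (j::nat))"
proof (cases "m = 0")
  case False
  have lt: "i * m + j < n * m" if "i < n" "j < m" for i j
  proof -
    have "i * m + j < (i + 1) * m" using that by simp
    also have "\<dots> \<le> n * m" using that by (intro mult_le_mono1) auto
    finally show ?thesis .
  qed
  show ?thesis unfolding sum.cartesian_product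
    by (rule sum.reindex_bij_witness[of _ "\<lambda>(i, j). i * m + j" "\<lambda>a. (a div m, a mod m)"])
      (use False lt in \<open>auto simp: less_mult_imp_div_less\<close>)
qed simp

text \<open>Base \<open>n\<close> digits, most significant first, which is the order in which the
  recursion of \<open>tensor_power\<close> nests its factors.\<close>

definition digit0 :: "nat \<Rightarrow> nat \<Rightarrow> nat" where "digit0 n a = a div n ^ 3"
definition digit1 :: "nat \<Rightarrow> nat \<Rightarrow> nat" where "digit1 n a = a mod n ^ 3 div n ^ 2"
definition digit2 :: "nat \<Rightarrow> nat \<Rightarrow> nat" where "digit2 n a = a mod n ^ 3 mod n ^ 2 div n"
definition digit3 :: "nat \<Rightarrow> nat \<Rightarrow> nat" where "digit3 n a = a mod n ^ 3 mod n ^ 2 mod n"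

lemmas digit_defs = digit0_def digit1_def digit2_def digit3_def

lemma sum_digits: "(\<Sum>a<n ^ 4. f (digit0 n a) (digit1 n a) (digit2 n a) (digit3 n a)) = (\<Sum>i<n. \<Sum>j<n. \<Sum>k<n. \<Sum>l<n. f i j k l)"
proof -
  have e: "n ^ 4 = n * n ^ 3" "n ^ 3 = n * n ^ 2" "n ^ 2 = n * n"
    by (simp_all add: power4_eq_xxxx power3_eq_cube power2_eq_square)
  have "(\<Sum>a<n ^ 4. f (digit0 n a) (digit1 n a) (digit2 n a) (digit3 n a)) = (\<Sum>i<n. \<Sum>b<n ^ 3. f i (b div n ^ 2) (b mod n ^ 2 div n) (b mod n ^ 2 mod n))"
    unfolding digit_defs e(1) by (rule sum_div_mod[of "\<lambda>i b. f i (b div n ^ 2) (b mod n ^ 2 div n) (b mod n ^ 2 mod n)" "n ^ 3" n])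
  also have "\<dots> = (\<Sum>i<n. \<Sum>j<n. \<Sum>c<n ^ 2. f i j (c div n) (c mod n))"
    unfolding e(2) by (rule sum.cong[OF refl], rule sum_div_mod[of "\<lambda>j c. f _ j (c div n) (c mod n)" "n ^ 2" n])
  also have "\<dots> = (\<Sum>i<n. \<Sum>j<n. \<Sum>k<n. \<Sum>l<n. f i j k l)"
    unfolding e(3) by (rule sum.cong[OF refl], rule sum.cong[OF refl], rule sum_div_mod[of "\<lambda>k l. f _ _ k l" n n])
  finally show ?thesis .
qed

lemma digit_less:
  assumes "a < n ^ 4" shows "digit0 n a < n" "digit1 n a < n" "digit2 n a < n" "digit3 n a < n"
proof -
  have n: "0 < n" using assms by (cases n) auto
  show "digit0 n a < n" unfolding digit0_def using assms by (intro less_mult_imp_div_less) (simp add: power4_eq_xxxx power3_eq_cube)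
  have "a mod n ^ 3 < n * n ^ 2" using n mod_less_divisor[of "n ^ 3" a] by (simp add: power3_eq_cube power2_eq_square mult.assoc)
  then show "digit1 n a < n" unfolding digit1_def by (rule less_mult_imp_div_less)
  have "a mod n ^ 3 mod n ^ 2 < n * n" using n by (simp add: power2_eq_square)
  then show "digit2 n a < n" unfolding digit2_def by (rule less_mult_imp_div_less)
  show "digit3 n a < n" unfolding digit3_def using n by simp
qed

lemma digit_inject:
  assumes "digit0 n a = digit0 n b" "digit1 n a = digit1 n b" "digit2 n a = digit2 n b" "digit3 n a = digit3 n b"
  shows "a = b"
  using assms unfolding digit_defs by (metis div_mod_decomp)

definition tensor4 :: "nat \<Rightarrow> (nat \<Rightarrow> complex) \<Rightarrow> (nat \<Rightarrow> complex) \<Rightarrow> (nat \<Rightarrow> complex) \<Rightarrow> (nat \<Rightarrow> complex) \<Rightarrow> nat \<Rightarrow> complex" where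
  "tensor4 n x y z w a = x (digit0 n a) * y (digit1 n a) * z (digit2 n a) * w (digit3 n a)"

lemma sum_prod4:
  fixes f g h e :: "nat \<Rightarrow> 'a::comm_semiring_1"
  shows "(\<Sum>i<n. \<Sum>j<n. \<Sum>k<n. \<Sum>l<n. f i * g j * h k * e l) = sum f {..<n} * sum g {..<n} * sum h {..<n} * sum e {..<n}"
  by (simp flip: sum_distrib_left sum_distrib_right)

lemma ip_tensor4: "ip (n ^ 4) (tensor4 n x y z w) (tensor4 n x' y' z' w') = ip n x x' * ip n y y' * ip n z z' * ip n w w'"
proof -
  have "ip (n ^ 4) (tensor4 n x y z w) (tensor4 n x' y' z' w') =
    (\<Sum>i<n. \<Sum>j<n. \<Sum>k<n. \<Sum>l<n. (cnj (x i) * x' i) * (cnj (y j) * y' j) * (cnj (z k) * z' k) * (cnj (w l) * w' l))"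
    unfolding ip_def[of "n ^ 4"] sum_digits[symmetric] by (intro sum.cong refl) (simp add: tensor4_def mult_ac)
  then show ?thesis unfolding sum_prod4 ip_def .
qed

definition tensor_basis :: "nat \<Rightarrow> (nat \<Rightarrow> nat \<Rightarrow> complex) \<Rightarrow> nat \<Rightarrow> nat \<Rightarrow> complex" where
  "tensor_basis n u x = tensor4 n (u (digit0 n x)) (u (digit1 n x)) (u (digit2 n x)) (u (digit3 n x))"

lemma onb_tensor_basis:
  assumes u: "onb n u" shows "onb (n ^ 4) (tensor_basis n u)"
  unfolding onb_def
proof (intro conjI allI impI)
  fix x y assume xy: "x < n ^ 4" "y < n ^ 4"
  show "ip (n ^ 4) (tensor_basis n u x) (tensor_basis n u y) = (if x = y then 1 else 0)"
    unfolding tensor_basis_def ip_tensor4 using digit_less[OF xy(1)] digit_less[OF xy(2)] digit_inject[of n x y] by (auto simp: onb_ip[OF u])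
next
  fix a b assume ab: "a < n ^ 4" "b < n ^ 4"
  have "(\<Sum>x<n ^ 4. tensor_basis n u x a * cnj (tensor_basis n u x b)) = (\<Sum>i<n. \<Sum>j<n. \<Sum>k<n. \<Sum>l<n. (u i (digit0 n a) * cnj (u i (digit0 n b))) * (u j (digit1 n a) * cnj (u j (digit1 n b)))
     * (u k (digit2 n a) * cnj (u k (digit2 n b))) * (u l (digit3 n a) * cnj (u l (digit3 n b))))"
    unfolding sum_digits[symmetric] by (intro sum.cong refl) (simp add: tensor_basis_def tensor4_def mult_ac)
  also have "\<dots> = (if a = b then 1 else 0)"
    unfolding sum_prod4 using digit_less[OF ab(1)] digit_less[OF ab(2)] digit_inject[of n a b] by (auto simp: onb_complete[OF u])
  finally show "(\<Sum>x<n ^ 4. tensor_basis n u x a * cnj (tensor_basis n u x b)) = (if a = b then 1 else 0)" .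
qed

lemma ip_add_left: "ip n (\<lambda>a. x a + y a) z = ip n x z + ip n y z"
  by (simp add: ip_def sum.distrib algebra_simps)

lemma ip_add_right: "ip n z (\<lambda>a. x a + y a) = ip n z x + ip n z y"
  by (simp add: ip_def sum.distrib algebra_simps)

text \<open>Equals 24 times the projection of the product vector onto the symmetric subspace; left
  unnormalised so that repeated indices need no separate treatment.\<close>

definition sym_vec :: "nat \<Rightarrow> (nat \<Rightarrow> nat \<Rightarrow> complex) \<Rightarrow> nat \<Rightarrow> nat \<Rightarrow> nat \<Rightarrow> nat \<Rightarrow> nat \<Rightarrow> complex" where
  "sym_vec n u i j k l a = sym4 (\<lambda>i j k l. tensor4 n (u i) (u j) (u k) (u l) a) i j k l"

lemma ip_sv_left: "ip m (sym_vec n u i j k l) z = sym4 (\<lambda>i j k l. ip m (tensor4 n (u i) (u j) (u k) (u l)) z) i j k l"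
  unfolding sym_vec_def[abs_def] sym4_def ip_add_left ..

lemma ip_sv_right: "ip m z (sym_vec n u i j k l) = sym4 (\<lambda>i j k l. ip m z (tensor4 n (u i) (u j) (u k) (u l))) i j k l"
  unfolding sym_vec_def[abs_def] sym4_def ip_add_right ..

text \<open>Inner products of permuted basis tensors are 0 or 1, so the squared norm counts
  coincidences between permuted tuples, and \<open>sym4_sym4_kron4\<close> evaluates the
  count.\<close>

lemma sqn_sym_vec:
  assumes u: "onb n u" and "i < n" "j < n" "k < n" "l < n"
  shows "sqn (n ^ 4) (sym_vec n u i j k l) = 24 * s24 i j k l"
proof -
  have less: "x < n" if "x \<in> {i, j, k, l}" for x using that assms by auto
  have d: "ip (n ^ 4) (tensor4 n (u a) (u b) (u c) (u d)) (tensor4 n (u a') (u b') (u c') (u d')) = complex_of_real (kron4 a' b' c' d' a b c d)"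
    if "a < n" "b < n" "c < n" "d < n" "a' < n" "b' < n" "c' < n" "d' < n" for a b c d a' b' c' d'
    unfolding ip_tensor4 using that by (auto simp: onb_ip[OF u] kron4_def kron_def)
  have s: "sym4 (\<lambda>i j k l. complex_of_real (f i j k l)) i j k l = complex_of_real (sym4 f i j k l)" for f i j k l
    by (simp add: sym4_def)
  have "ip (n ^ 4) (sym_vec n u i j k l) (sym_vec n u i j k l) = sym4 (\<lambda>a b c d. sym4 (\<lambda>a' b' c' d'. complex_of_real (kron4 a b c d a' b' c' d')) i j k l) i j k l"
    unfolding ip_sv_left ip_sv_right by (intro sym4_cong d less; assumption)
  also have "\<dots> = complex_of_real (24 * s24 i j k l)"
    unfolding s sym4_sym4_kron4 ..
  finally show ?thesis unfolding ip_self of_real_eq_iff .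
qed

section \<open>Fourth tensor powers of matrices\<close>

lemma tensor_power_carrier: "A \<in> carrier_mat n n \<Longrightarrow> tensor_power A t \<in> carrier_mat (n ^ t) (n ^ t)"
  by (induction t) (auto simp: kronecker_product_def)

lemma tensor_power_Suc_entry:
  assumes A: "A \<in> carrier_mat n n" and a: "a < n ^ Suc t" and b: "b < n ^ Suc t"
  shows "fun_of_mat (tensor_power A (Suc t)) a b
    = fun_of_mat A (a div n ^ t) (b div n ^ t) * fun_of_mat (tensor_power A t) (a mod n ^ t) (b mod n ^ t)"
  using A a b tensor_power_carrier[OF A, of t] by (simp add: fun_of_mat_def kronecker_product_def)

lemma tensor_power_4_entry:
  assumes A: "A \<in> carrier_mat n n" and a: "a < n ^ 4" and b: "b < n ^ 4"
  shows "fun_of_mat (tensor_power A 4) a b = fun_of_mat A (digit0 n a) (digit0 n b) * fun_of_mat A (digit1 n a) (digit1 n b)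
    * fun_of_mat A (digit2 n a) (digit2 n b) * fun_of_mat A (digit3 n a) (digit3 n b)"
proof -
  have n: "0 < n" using a by (cases n) auto
  have e: "4 = Suc 3" "3 = Suc 2" "2 = Suc 1" "1 = Suc 0" by simp_all
  have p: "x mod n ^ 3 < n ^ Suc 2" "x mod n ^ 2 < n ^ Suc 1" "x mod n < n ^ Suc 0" for x
    using n by (simp_all add: eval_nat_numeral)
  have "fun_of_mat (tensor_power A 4) a b = fun_of_mat A (a div n ^ 3) (b div n ^ 3) * fun_of_mat (tensor_power A 3) (a mod n ^ 3) (b mod n ^ 3)"
    unfolding e(1) by (rule tensor_power_Suc_entry[OF A]) (use a b in simp_all)
  also have "fun_of_mat (tensor_power A 3) (a mod n ^ 3) (b mod n ^ 3) = fun_of_mat A (a mod n ^ 3 div n ^ 2) (b mod n ^ 3 div n ^ 2)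
     * fun_of_mat (tensor_power A 2) (a mod n ^ 3 mod n ^ 2) (b mod n ^ 3 mod n ^ 2)"
    unfolding numeral_3_eq_3[folded numeral_2_eq_2] by (rule tensor_power_Suc_entry[OF A]) (use p in \<open>simp_all add: eval_nat_numeral\<close>)
  also have "fun_of_mat (tensor_power A 2) (a mod n ^ 3 mod n ^ 2) (b mod n ^ 3 mod n ^ 2)
     = fun_of_mat A (a mod n ^ 3 mod n ^ 2 div n ^ 1) (b mod n ^ 3 mod n ^ 2 div n ^ 1) * fun_of_mat (tensor_power A 1) (a mod n ^ 3 mod n ^ 2 mod n ^ 1) (b mod n ^ 3 mod n ^ 2 mod n ^ 1)"
    unfolding Suc_1[symmetric] by (rule tensor_power_Suc_entry[OF A]) (use n in \<open>simp_all add: eval_nat_numeral\<close>)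
  also have "fun_of_mat (tensor_power A 1) (a mod n ^ 3 mod n ^ 2 mod n ^ 1) (b mod n ^ 3 mod n ^ 2 mod n ^ 1)
     = fun_of_mat A (a mod n ^ 3 mod n ^ 2 mod n ^ 1) (b mod n ^ 3 mod n ^ 2 mod n ^ 1)"
    using tensor_power_Suc_entry[OF A, of "a mod n ^ 3 mod n ^ 2 mod n ^ 1" 0 "b mod n ^ 3 mod n ^ 2 mod n ^ 1"] n
    by (simp add: fun_of_mat_def)
  finally show ?thesis by (simp add: digit_defs mult.assoc)
qed

lemma tensor_power_4_ket_bra:
  assumes w: "w \<in> carrier_vec n"
  shows "tensor_power (ket_bra w) 4 = ket_bra (vec (n ^ 4) (tensor4 n (\<lambda>i. w $ i) (\<lambda>i. w $ i) (\<lambda>i. w $ i) (\<lambda>i. w $ i)))"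
proof (rule eq_matI)
  have P: "ket_bra w \<in> carrier_mat n n" using w by (auto simp: ket_bra_def)
  fix a b
  assume "a < dim_row (ket_bra (vec (n ^ 4) (tensor4 n (\<lambda>i. w $ i) (\<lambda>i. w $ i) (\<lambda>i. w $ i) (\<lambda>i. w $ i))))"
    "b < dim_col (ket_bra (vec (n ^ 4) (tensor4 n (\<lambda>i. w $ i) (\<lambda>i. w $ i) (\<lambda>i. w $ i) (\<lambda>i. w $ i))))"
  then have ab: "a < n ^ 4" "b < n ^ 4" by (auto simp: ket_bra_def)
  show "tensor_power (ket_bra w) 4 $$ (a, b) = ket_bra (vec (n ^ 4) (tensor4 n (\<lambda>i. w $ i) (\<lambda>i. w $ i) (\<lambda>i. w $ i) (\<lambda>i. w $ i))) $$ (a, b)"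
    using tensor_power_4_entry[OF P ab] ab digit_less[OF ab(1)] digit_less[OF ab(2)] w
    by (simp add: fun_of_ket_bra) (simp add: fun_of_mat_def ket_bra_def tensor4_def mult_ac)
qed (use tensor_power_carrier[of "ket_bra w" n 4] w in \<open>auto simp: ket_bra_def\<close>)

section \<open>The deviation operator of a design\<close>

definition tensor_pow4 :: "nat \<Rightarrow> complex vec \<Rightarrow> nat \<Rightarrow> complex" where
  "tensor_pow4 n w = tensor4 n (\<lambda>i. w $ i) (\<lambda>i. w $ i) (\<lambda>i. w $ i) (\<lambda>i. w $ i)"

lemma bform_tensor_ket_bra:
  assumes "w \<in> carrier_vec n"
  shows "bform (n ^ 4) (fun_of_mat (tensor_power (ket_bra w) 4)) y y = complex_of_real ((cmod (ip (n ^ 4) y (tensor_pow4 n w)))\<^sup>2)"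
proof -
  have "ip (n ^ 4) y (\<lambda>i. vec (n ^ 4) (tensor_pow4 n w) $ i) = ip (n ^ 4) y (tensor_pow4 n w)" by (rule ip_cong) auto
  then show ?thesis
    unfolding tensor_power_4_ket_bra[OF assms] tensor_pow4_def[symmetric] by (subst qf_ket_bra) auto
qed

text \<open>Averages of \<open>w \<otimes> w \<otimes> w \<otimes> w\<close> do not see the difference between a vector and its symmetrisation. The
  latter is shorter, which saves the factor that makes the spectral norm hypothesis effective.\<close>

lemma ip_w4_sym_vec: "ip (n ^ 4) (sym_vec n u i j k l) (tensor_pow4 n w) = 24 * ip (n ^ 4) (tensor4 n (u i) (u j) (u k) (u l)) (tensor_pow4 n w)"
  unfolding ip_sv_left tensor_pow4_def ip_tensor4 by (simp add: sym4_def mult_ac)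

definition design_diff :: "nat \<Rightarrow> nat \<Rightarrow> (nat \<Rightarrow> real) \<Rightarrow> (nat \<Rightarrow> complex vec) \<Rightarrow> complex mat measure \<Rightarrow> complex mat" where
  "design_diff n N p w \<mu> = weighted_mat_sum (n ^ 4) N p (\<lambda>i. tensor_power (ket_bra (w i)) 4) - mat_integral (n ^ 4) \<mu> (\<lambda>P. tensor_power P 4)"

text \<open>All that is extracted from the design hypothesis: the weighted means of four squared
  overlaps with an orthonormal basis.\<close>

definition des4 :: "nat \<Rightarrow> nat \<Rightarrow> (nat \<Rightarrow> real) \<Rightarrow> (nat \<Rightarrow> complex vec) \<Rightarrow> (nat \<Rightarrow> nat \<Rightarrow> complex) \<Rightarrow> nat \<Rightarrow> nat \<Rightarrow> nat \<Rightarrow> nat \<Rightarrow> real" where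
  "des4 n N p w u i j k l = (\<Sum>a<N. p a * ((cmod (ip n (u i) (\<lambda>m. w a $ m)))\<^sup>2 * (cmod (ip n (u j) (\<lambda>m. w a $ m)))\<^sup>2
     * (cmod (ip n (u k) (\<lambda>m. w a $ m)))\<^sup>2 * (cmod (ip n (u l) (\<lambda>m. w a $ m)))\<^sup>2))"

context
  fixes n N :: nat and p :: "nat \<Rightarrow> real" and w :: "nat \<Rightarrow> complex vec" and \<mu> :: "complex mat measure"
  assumes inv: "unitarily_invariant_prob n \<mu>" and wuv: "weighted_unit_vectors n N p w"
begin

lemma tensor_entry_integrable:
  assumes "a < n ^ 4" "b < n ^ 4"
  shows "integrable \<mu> (\<lambda>P. fun_of_mat (tensor_power P 4) a b)"
proof -
  interpret prob_space \<mu> by (rule prob_haar[OF inv])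
  note da = digit_less[OF assms(1)] and db = digit_less[OF assms(2)]
  let ?F = "\<lambda>P. fun_of_mat P (digit0 n a) (digit0 n b) * fun_of_mat P (digit1 n a) (digit1 n b) * fun_of_mat P (digit2 n a) (digit2 n b) * fun_of_mat P (digit3 n a) (digit3 n b)"
  have "integrable \<mu> ?F"
  proof (rule integrable_const_bound[of _ 1])
    show "AE P in \<mu>. norm (?F P) \<le> 1"
      using da db proj_space_entry(1) by (intro AE_I2) (auto simp: space_haar[OF inv] norm_mult intro!: mult_le_one)
    show "?F \<in> borel_measurable \<mu>"
      using da db by (intro borel_measurable_times entry_measurable[OF inv])
  qed
  then show ?thesis
    by (rule Bochner_Integration.integrable_cong[THEN iffD1, rotated 2])
      (auto simp: space_haar[OF inv] tensor_power_4_entry[OF proj_space_carrier assms])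
qed

lemma design_diff_entry:
  assumes "a < n ^ 4" "b < n ^ 4"
  shows "fun_of_mat (design_diff n N p w \<mu>) a b = (\<Sum>i<N. complex_of_real (p i) * fun_of_mat (tensor_power (ket_bra (w i)) 4) a b)
    - (\<integral>P. fun_of_mat (tensor_power P 4) a b \<partial>\<mu>)"
  using assms by (simp add: design_diff_def weighted_mat_sum_def mat_integral_def fun_of_mat_def)

text \<open>The entries are bounded, so the integral commutes with the finite sums of the form. The
  value is real because each fourth tensor power is again of the form
  \<open>ket_bra\<close>.\<close>

lemma design_diff_form:
  "bform (n ^ 4) (fun_of_mat (design_diff n N p w \<mu>)) y y = complex_of_real ((\<Sum>i<N. p i * (cmod (ip (n ^ 4) y (tensor_pow4 n (w i))))\<^sup>2)
     - (\<integral>P. qf (n ^ 4) (fun_of_mat (tensor_power P 4)) y \<partial>\<mu>))"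
proof -
  let ?N = "n ^ 4"
  have wc: "w i \<in> carrier_vec n" if "i < N" for i using wuv that by (simp add: weighted_unit_vectors_def)
  have "bform ?N (fun_of_mat (design_diff n N p w \<mu>)) y y = (\<Sum>a<?N. \<Sum>b<?N. (\<Sum>i<N. complex_of_real (p i) * (cnj (y a) * fun_of_mat (tensor_power (ket_bra (w i)) 4) a b * y b))
      - (\<integral>P. cnj (y a) * fun_of_mat (tensor_power P 4) a b * y b \<partial>\<mu>))"
    unfolding bform_def
  proof (intro sum.cong refl)
    fix a b assume "a \<in> {..<?N}" "b \<in> {..<?N}"
    then have ab: "a < ?N" "b < ?N" by auto
    have "(\<integral>P. cnj (y a) * fun_of_mat (tensor_power P 4) a b * y b \<partial>\<mu>) = cnj (y a) * (\<integral>P. fun_of_mat (tensor_power P 4) a b \<partial>\<mu>) * y b"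
      using tensor_entry_integrable[OF ab] by simp
    then show "cnj (y a) * fun_of_mat (design_diff n N p w \<mu>) a b * y b = (\<Sum>i<N. complex_of_real (p i) * (cnj (y a) * fun_of_mat (tensor_power (ket_bra (w i)) 4) a b * y b))
      - (\<integral>P. cnj (y a) * fun_of_mat (tensor_power P 4) a b * y b \<partial>\<mu>)"
      unfolding design_diff_entry[OF ab] by (simp add: algebra_simps sum_distrib_left)
  qed
  also have "\<dots> = (\<Sum>i<N. complex_of_real (p i) * bform ?N (fun_of_mat (tensor_power (ket_bra (w i)) 4)) y y)
      - (\<Sum>a<?N. \<Sum>b<?N. (\<integral>P. cnj (y a) * fun_of_mat (tensor_power P 4) a b * y b \<partial>\<mu>))"
    unfolding sum_subtractf bform_def sum_distrib_left
    by (intro arg_cong2[of _ _ _ _ "(-)"] refl, subst (2) sum.swap, rule sum.cong[OF refl]) (rule sum.swap)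
  also have "(\<Sum>a<?N. \<Sum>b<?N. (\<integral>P. cnj (y a) * fun_of_mat (tensor_power P 4) a b * y b \<partial>\<mu>)) = (\<integral>P. bform ?N (fun_of_mat (tensor_power P 4)) y y \<partial>\<mu>)"
  proof -
    have int: "integrable \<mu> (\<lambda>P. cnj (y a) * fun_of_mat (tensor_power P 4) a b * y b)" if "a \<in> {..<?N}" "b \<in> {..<?N}" for a b
      using tensor_entry_integrable[of a b] that by simp
    show ?thesis unfolding bform_def
      by (subst Bochner_Integration.integral_sum, (intro Bochner_Integration.integrable_sum int; assumption), rule sum.cong[OF refl],
          subst Bochner_Integration.integral_sum) (auto intro: int)
  qed
  also have "\<dots> = (\<integral>P. complex_of_real (qf ?N (fun_of_mat (tensor_power P 4)) y) \<partial>\<mu>)"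
  proof (intro Bochner_Integration.integral_cong refl)
    fix P assume "P \<in> space \<mu>"
    then obtain v where "v \<in> carrier_vec n" "P = ket_bra v" unfolding space_haar[OF inv] by (rule proj_spaceE)
    then show "bform ?N (fun_of_mat (tensor_power P 4)) y y = complex_of_real (qf ?N (fun_of_mat (tensor_power P 4)) y)"
      by (simp add: bform_tensor_ket_bra)
  qed
  also have "\<dots> = complex_of_real (\<integral>P. qf ?N (fun_of_mat (tensor_power P 4)) y \<partial>\<mu>)" by (rule integral_complex_of_real)
  also have "(\<Sum>i<N. complex_of_real (p i) * bform ?N (fun_of_mat (tensor_power (ket_bra (w i)) 4)) y y) = complex_of_real (\<Sum>i<N. p i * (cmod (ip (n ^ 4) y (tensor_pow4 n (w i))))\<^sup>2)"
    unfolding of_real_sum by (intro sum.cong refl) (simp add: bform_tensor_ket_bra wc)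
  finally show ?thesis by simp
qed

lemma design_diff_hermitian: "design_diff n N p w \<mu> \<in> hermitian_mats (n ^ 4)"
proof -
  let ?D = "design_diff n N p w \<mu>"
  have wc: "w i \<in> carrier_vec n" if "i < N" for i using wuv that by (simp add: weighted_unit_vectors_def)
  have h: "cnj (fun_of_mat (tensor_power (ket_bra v) 4) a b) = fun_of_mat (tensor_power (ket_bra v) 4) b a"
    if "v \<in> carrier_vec n" "a < n ^ 4" "b < n ^ 4" for v a b
    unfolding tensor_power_4_ket_bra[OF that(1)] using that by (simp add: fun_of_mat_def ket_bra_def)
  have "fun_of_mat ?D b a = cnj (fun_of_mat ?D a b)" if ab: "a < n ^ 4" "b < n ^ 4" for a b
  proof -
    have "cnj (\<integral>P. fun_of_mat (tensor_power P 4) a b \<partial>\<mu>) = (\<integral>P. cnj (fun_of_mat (tensor_power P 4) a b) \<partial>\<mu>)"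
      by (rule integral_bounded_linear[OF bounded_linear_cnj tensor_entry_integrable[OF ab], symmetric])
    also have "\<dots> = (\<integral>P. fun_of_mat (tensor_power P 4) b a \<partial>\<mu>)"
    proof (intro Bochner_Integration.integral_cong refl)
      fix P assume "P \<in> space \<mu>"
      then obtain v where "v \<in> carrier_vec n" "P = ket_bra v" unfolding space_haar[OF inv] by (rule proj_spaceE)
      then show "cnj (fun_of_mat (tensor_power P 4) a b) = fun_of_mat (tensor_power P 4) b a" using h ab by simp
    qed
    finally show ?thesis unfolding design_diff_entry[OF ab] design_diff_entry[OF ab(2,1)] using h ab wc by simp
  qed
  then have "herm (n ^ 4) (fun_of_mat ?D)" unfolding herm_def by blast
  moreover have "?D \<in> carrier_mat (n ^ 4) (n ^ 4)" 
    unfolding design_diff_def weighted_mat_sum_def mat_integral_def by (intro minus_carrier_mat mat_carrier)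
  ultimately show ?thesis by (simp add: hermitian_mats_iff)
qed

text \<open>Compares the deviation on a product vector and on its symmetrisation. The value grows by
  \<open>24 ^ 2\<close> but the squared norm only to \<open>24 * s24\<close>; for distinct indices
  this gains a factor 24 under a spectral norm bound.\<close>

lemma design_diff_basis:
  assumes n: "0 < n" and u: "onb n u" and ijkl: "i < n" "j < n" "k < n" "l < n"
  defines "\<alpha> \<equiv> 1 / (real n * (real n + 1) * (real n + 2) * (real n + 3))"
  shows "qf (n ^ 4) (fun_of_mat (design_diff n N p w \<mu>)) (tensor4 n (u i) (u j) (u k) (u l)) = des4 n N p w u i j k l - \<alpha> * s24 i j k l" (is ?A)
    and "qf (n ^ 4) (fun_of_mat (design_diff n N p w \<mu>)) (sym_vec n u i j k l) = 24 ^ 2 * (des4 n N p w u i j k l - \<alpha> * s24 i j k l)" (is ?B)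
proof -
  let ?D = "design_diff n N p w \<mu>" and ?v = "tensor4 n (u i) (u j) (u k) (u l)" and ?N = "n ^ 4"
  have "(\<integral>P. qf ?N (fun_of_mat (tensor_power P 4)) ?v \<partial>\<mu>) = (\<integral>P. qf n (fun_of_mat P) (u i) * qf n (fun_of_mat P) (u j) * qf n (fun_of_mat P) (u k) * qf n (fun_of_mat P) (u l) \<partial>\<mu>)"
  proof (intro Bochner_Integration.integral_cong refl)
    fix P assume "P \<in> space \<mu>"
    then obtain v where "v \<in> carrier_vec n" "P = ket_bra v" unfolding space_haar[OF inv] by (rule proj_spaceE)
    then show "qf ?N (fun_of_mat (tensor_power P 4)) ?v = qf n (fun_of_mat P) (u i) * qf n (fun_of_mat P) (u j) * qf n (fun_of_mat P) (u k) * qf n (fun_of_mat P) (u l)"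
      by (simp add: bform_tensor_ket_bra qf_ket_bra tensor_pow4_def ip_tensor4 norm_mult power_mult_distrib)
  qed
  also have "\<dots> = \<alpha> * s24 i j k l" unfolding haar_fourth_moment[OF inv n u ijkl] by (simp add: \<alpha>_def)
  finally have haar: "(\<integral>P. qf ?N (fun_of_mat (tensor_power P 4)) ?v \<partial>\<mu>) = \<alpha> * s24 i j k l" .
  show A: ?A unfolding design_diff_form haar by (simp add: des4_def tensor_pow4_def ip_tensor4 norm_mult power_mult_distrib)
  have s: "(cmod (ip ?N (sym_vec n u i j k l) (tensor_pow4 n v)))\<^sup>2 = 24 ^ 2 * (cmod (ip ?N ?v (tensor_pow4 n v)))\<^sup>2" for v
    unfolding ip_w4_sym_vec by (simp add: norm_mult power_mult_distrib)
  have "qf ?N (fun_of_mat ?D) (sym_vec n u i j k l) = 24 ^ 2 * qf ?N (fun_of_mat ?D) ?v"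
  proof -
    have "(\<integral>P. qf ?N (fun_of_mat (tensor_power P 4)) (sym_vec n u i j k l) \<partial>\<mu>) = (\<integral>P. 24 ^ 2 * qf ?N (fun_of_mat (tensor_power P 4)) ?v \<partial>\<mu>)"
    proof (intro Bochner_Integration.integral_cong refl)
      fix P assume "P \<in> space \<mu>"
      then obtain v where "v \<in> carrier_vec n" "P = ket_bra v" unfolding space_haar[OF inv] by (rule proj_spaceE)
      then show "qf ?N (fun_of_mat (tensor_power P 4)) (sym_vec n u i j k l) = 24 ^ 2 * qf ?N (fun_of_mat (tensor_power P 4)) ?v"
        by (simp only: bform_tensor_ket_bra Re_complex_of_real s)
    qed
    then show ?thesis unfolding design_diff_form s Re_complex_of_real
      by (simp add: right_diff_distrib sum_distrib_left mult.left_commute)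
  qed
  then show ?B unfolding A .
qed

end

lemma choose_4: "real ((n + 4 - 1) choose 4) = real n * (real n + 1) * (real n + 2) * (real n + 3) / 24"
proof (cases n)
  case (Suc m)
  have "fact 4 * fact m * ((m + 4) choose 4) = (fact (m + 4) :: nat)"
    using binomial_fact_lemma[of 4 "m + 4"] by simp
  also have "(fact (m + 4) :: nat) = (m + 4) * (m + 3) * (m + 2) * (m + 1) * fact m"
    by (simp add: eval_nat_numeral algebra_simps)
  finally have "fact m * (24 * ((m + 4) choose 4)) = fact m * ((m + 4) * (m + 3) * (m + 2) * (m + 1))"
    by (simp add: fact_numeral mult_ac)
  then have "24 * ((m + 4) choose 4) = (m + 4) * (m + 3) * (m + 2) * (m + 1)" by simp
  then have "real (24 * ((m + 4) choose 4)) = real ((m + 4) * (m + 3) * (m + 2) * (m + 1))" by simp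
  then show ?thesis by (simp add: Suc algebra_simps)
qed simp

text \<open>The normaliser in the design condition is \<open>24 * \<alpha>\<close>. Testing on the
  symmetrised vector cancels the 24 and leaves a relative error \<theta> on every single
  moment.\<close>

lemma approx_design_inf:
  assumes d: "approx_design n 4 \<infinity> \<theta> N p w" and n: "0 < n" and u: "onb n u" and ijkl: "i < n" "j < n" "k < n" "l < n"
  defines "\<alpha> \<equiv> 1 / (real n * (real n + 1) * (real n + 2) * (real n + 3))"
  shows "\<bar>des4 n N p w u i j k l - \<alpha> * s24 i j k l\<bar> \<le> \<theta> * \<alpha> * s24 i j k l"
proof -
  obtain \<mu> where wuv: "weighted_unit_vectors n N p w" and inv: "unitarily_invariant_prob n \<mu>"
    and le: "schatten_norm \<infinity> (design_diff n N p w \<mu>) \<le> inverse (real ((n + 4 - 1) choose 4)) * \<theta>"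
    using d unfolding approx_design_def design_diff_def by blast
  let ?D = "design_diff n N p w \<mu>"
  note D = design_diff_hermitian[OF inv wuv]
  obtain v \<delta> where v: "eigsys (n ^ 4) (fun_of_mat ?D) v \<delta>" using D spectral_theorem hermitian_mats_iff by blast
  have "inverse (real ((n + 4 - 1) choose 4)) = 24 * \<alpha>" unfolding choose_4 \<alpha>_def by simp
  then have "\<bar>\<delta> x\<bar> \<le> 24 * \<alpha> * \<theta>" if "x < n ^ 4" for x
    using schatten_norm_inf_ge[OF D v that] le by simp
  then have "\<bar>qf (n ^ 4) (fun_of_mat ?D) (sym_vec n u i j k l)\<bar> \<le> 24 * \<alpha> * \<theta> * (24 * s24 i j k l)"
    using eigsys_qf_bound[OF v, of "24 * \<alpha> * \<theta>" "sym_vec n u i j k l"] sqn_sym_vec[OF u ijkl] by simp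
  then show ?thesis
    unfolding design_diff_basis(2)[OF inv wuv n u ijkl, folded \<alpha>_def] abs_mult by (simp add: mult_ac)
qed

text \<open>The deviations at all index tuples are diagonal entries of one Hermitian matrix in a
  product basis, so \<open>pinching\<close> bounds their absolute sum by its trace norm.\<close>

lemma approx_design_trace:
  assumes d: "approx_design n 4 1 \<theta> N p w" and n: "0 < n" and u: "onb n u"
  defines "\<alpha> \<equiv> 1 / (real n * (real n + 1) * (real n + 2) * (real n + 3))"
  shows "(\<Sum>i<n. \<Sum>j<n. \<Sum>k<n. \<Sum>l<n. \<bar>des4 n N p w u i j k l - \<alpha> * s24 i j k l\<bar>) \<le> 24 * \<alpha> * \<theta>"
proof -
  obtain \<mu> where wuv: "weighted_unit_vectors n N p w" and inv: "unitarily_invariant_prob n \<mu>"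
    and le: "schatten_norm 1 (design_diff n N p w \<mu>) \<le> inverse (real ((n + 4 - 1) choose 4)) * \<theta>"
    using d unfolding approx_design_def design_diff_def by blast
  let ?D = "design_diff n N p w \<mu>"
  note D = design_diff_hermitian[OF inv wuv]
  obtain v \<delta> where v: "eigsys (n ^ 4) (fun_of_mat ?D) v \<delta>" using D spectral_theorem hermitian_mats_iff by blast
  have "(\<Sum>i<n. \<Sum>j<n. \<Sum>k<n. \<Sum>l<n. \<bar>des4 n N p w u i j k l - \<alpha> * s24 i j k l\<bar>)
    = (\<Sum>i<n. \<Sum>j<n. \<Sum>k<n. \<Sum>l<n. \<bar>qf (n ^ 4) (fun_of_mat ?D) (tensor4 n (u i) (u j) (u k) (u l))\<bar>)"
    using design_diff_basis(1)[OF inv wuv n u, folded \<alpha>_def] by (intro sum.cong refl) auto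
  also have "\<dots> = (\<Sum>x<n ^ 4. \<bar>qf (n ^ 4) (fun_of_mat ?D) (tensor_basis n u x)\<bar>)"
    unfolding sum_digits[symmetric] tensor_basis_def ..
  also have "\<dots> \<le> (\<Sum>x<n ^ 4. \<bar>\<delta> x\<bar>)" by (rule pinching[OF v onb_tensor_basis[OF u]])
  also have "\<dots> \<le> 24 * \<alpha> * \<theta>"
    using le unfolding schatten_norm_1[OF D v] choose_4 by (simp add: \<alpha>_def)
  finally show ?thesis .
qed

section \<open>A small ball estimate\<close>

lemma power_sum_bounds:
  fixes x :: "nat \<Rightarrow> real" and n :: nat
  defines "q \<equiv> (\<Sum>i<n. (x i)\<^sup>2)"
  shows "k < n \<Longrightarrow> \<bar>x k\<bar> \<le> sqrt q" "\<bar>\<Sum>i<n. (x i) ^ 3\<bar> \<le> sqrt q * q" "(\<Sum>i<n. (x i) ^ 4) \<le> q\<^sup>2"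
proof -
  have q: "0 \<le> q" by (simp add: q_def sum_nonneg)
  have le: "\<bar>x k\<bar> \<le> sqrt q" if "k < n" for k
  proof -
    have "(x k)\<^sup>2 \<le> q" unfolding q_def using that by (intro member_le_sum) auto
    then show ?thesis by (intro real_le_rsqrt) simp
  qed
  then show "k < n \<Longrightarrow> \<bar>x k\<bar> \<le> sqrt q" .
  have "\<bar>\<Sum>i<n. (x i) ^ 3\<bar> \<le> (\<Sum>i<n. \<bar>x i\<bar> * (x i)\<^sup>2)"
    by (rule order_trans[OF sum_abs]) (simp add: abs_mult power3_eq_cube power2_eq_square mult.assoc)
  also have "\<dots> \<le> (\<Sum>i<n. sqrt q * (x i)\<^sup>2)" by (intro sum_mono mult_right_mono le) auto
  finally show "\<bar>\<Sum>i<n. (x i) ^ 3\<bar> \<le> sqrt q * q" by (simp add: q_def sum_distrib_left)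
  have "(\<Sum>i<n. (x i) ^ 4) = (\<Sum>i<n. (x i)\<^sup>2 * (x i)\<^sup>2)" by (simp add: power4_eq_xxxx power2_eq_square mult.assoc)
  also have "\<dots> \<le> (\<Sum>i<n. q * (x i)\<^sup>2)"
    unfolding q_def by (intro sum_mono mult_right_mono member_le_sum) auto
  finally show "(\<Sum>i<n. (x i) ^ 4) \<le> q\<^sup>2" by (simp add: q_def sum_distrib_left power2_eq_square)
qed

text \<open>The 24 permutations grouped by cycle type: the identity, 6 transpositions, 3 double
  transpositions, 8 three-cycles and 6 four-cycles, each contributing a product of power
  sums.\<close>

lemma sum_s24_fourth:
  fixes x :: "nat \<Rightarrow> real"
  shows "(\<Sum>i<n. \<Sum>j<n. \<Sum>k<n. \<Sum>l<n. x i * x j * x k * x l * s24 i j k l)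
    = (\<Sum>i<n. x i) ^ 4 + 6 * (\<Sum>i<n. x i)\<^sup>2 * (\<Sum>i<n. (x i)\<^sup>2) + 3 * (\<Sum>i<n. (x i)\<^sup>2)\<^sup>2
      + 8 * (\<Sum>i<n. x i) * (\<Sum>i<n. (x i) ^ 3) + 6 * (\<Sum>i<n. (x i) ^ 4)"
proof -
  define s q c f where "s = (\<Sum>i<n. x i)" and "q = (\<Sum>i<n. (x i)\<^sup>2)" and "c = (\<Sum>i<n. (x i) ^ 3)" and "f = (\<Sum>i<n. (x i) ^ 4)"
  have 1: "(\<Sum>k<n. \<Sum>l<n. x i * x j * x k * x l * s24 i j k l) = x i * x j * (1 + kron i j) *
      (s\<^sup>2 + q + 2 * s * x i + 2 * s * x j + 2 * (x i)\<^sup>2 + 2 * (x j)\<^sup>2 + 2 * x i * x j)" if ij: "i < n" "j < n" for i j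
  proof -
    have "(\<Sum>k<n. \<Sum>l<n. x i * x j * x k * x l * s24 i j k l) = (\<Sum>k<n. x i * x j * x k * (\<Sum>l<n. x l * s24 i j k l))"
      by (simp add: sum_distrib_left mult_ac)
    also have "\<dots> = (\<Sum>k<n. x i * x j * (1 + kron i j) * (((s + x i + x j) * x k + (x k)\<^sup>2) + kron i k * (x k * (s + x i + x j + x k)) + kron j k * (x k * (s + x i + x j + x k))))"
      using ij by (intro sum.cong refl) (simp add: sum_s24_inner s_def power2_eq_square algebra_simps)
    also have "\<dots> = x i * x j * (1 + kron i j) * (((s + x i + x j) * s + q) + x i * (s + x i + x j + x i) + x j * (s + x i + x j + x j))"
      unfolding sum_distrib_left[symmetric] sum.distrib sum_kron[OF ij(1)] sum_kron[OF ij(2)] s_def[symmetric] q_def[symmetric] ..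
    finally show ?thesis by (simp add: power2_eq_square algebra_simps)
  qed
  have 2: "(\<Sum>j<n. x i * x j * (1 + kron i j) * (s\<^sup>2 + q + 2 * s * x i + 2 * s * x j + 2 * (x i)\<^sup>2 + 2 * (x j)\<^sup>2 + 2 * x i * x j))
    = x i * (s * (s\<^sup>2 + q) + 2 * s\<^sup>2 * x i + 2 * s * q + 2 * s * (x i)\<^sup>2 + 2 * c + 2 * x i * q) + (x i)\<^sup>2 * (s\<^sup>2 + q + 4 * s * x i + 6 * (x i)\<^sup>2)" if i: "i < n" for i
  proof -
    have "(\<Sum>j<n. x i * x j * (1 + kron i j) * (s\<^sup>2 + q + 2 * s * x i + 2 * s * x j + 2 * (x i)\<^sup>2 + 2 * (x j)\<^sup>2 + 2 * x i * x j))
      = (\<Sum>j<n. (x i * (s\<^sup>2 + q + 2 * s * x i + 2 * (x i)\<^sup>2)) * x j + (x i * (2 * s + 2 * x i)) * (x j)\<^sup>2 + (x i * 2) * (x j) ^ 3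
        + kron i j * (x i * x j * (s\<^sup>2 + q + 2 * s * x i + 2 * s * x j + 2 * (x i)\<^sup>2 + 2 * (x j)\<^sup>2 + 2 * x i * x j)))"
      by (intro sum.cong refl) (simp add: power2_eq_square power3_eq_cube algebra_simps)
    also have "\<dots> = (x i * (s\<^sup>2 + q + 2 * s * x i + 2 * (x i)\<^sup>2)) * s + (x i * (2 * s + 2 * x i)) * q + (x i * 2) * c
        + x i * x i * (s\<^sup>2 + q + 2 * s * x i + 2 * s * x i + 2 * (x i)\<^sup>2 + 2 * (x i)\<^sup>2 + 2 * x i * x i)"
      unfolding sum.distrib sum_kron[OF i] sum_distrib_left[symmetric] s_def[symmetric] q_def[symmetric] c_def[symmetric] ..
    finally show ?thesis by (simp add: power2_eq_square algebra_simps)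
  qed
  have "(\<Sum>i<n. \<Sum>j<n. \<Sum>k<n. \<Sum>l<n. x i * x j * x k * x l * s24 i j k l)
    = (\<Sum>i<n. x i * (s * (s\<^sup>2 + q) + 2 * s\<^sup>2 * x i + 2 * s * q + 2 * s * (x i)\<^sup>2 + 2 * c + 2 * x i * q) + (x i)\<^sup>2 * (s\<^sup>2 + q + 4 * s * x i + 6 * (x i)\<^sup>2))"
    using 1 2 by (intro sum.cong refl) simp
  also have "\<dots> = (\<Sum>i<n. (s * (s\<^sup>2 + q) + 2 * s * q + 2 * c) * x i + (3 * s\<^sup>2 + 3 * q) * (x i)\<^sup>2 + (6 * s) * (x i) ^ 3 + 6 * (x i) ^ 4)"
    by (intro sum.cong refl) (simp add: power2_eq_square power3_eq_cube power4_eq_xxxx algebra_simps)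
  also have "\<dots> = (s * (s\<^sup>2 + q) + 2 * s * q + 2 * c) * s + (3 * s\<^sup>2 + 3 * q) * q + (6 * s) * c + 6 * f"
    unfolding sum.distrib sum_distrib_left[symmetric] s_def[symmetric] q_def[symmetric] c_def[symmetric] f_def[symmetric] ..
  also have "\<dots> = s ^ 4 + 6 * s\<^sup>2 * q + 3 * q\<^sup>2 + 8 * s * c + 6 * f"
    by (simp add: power2_eq_square power4_eq_xxxx algebra_simps)
  finally show ?thesis by (simp only: s_def q_def c_def f_def)
qed

text \<open>The right-hand side is the square of what the second moment is proportional to, as the
  small ball argument needs. The term with the cubic sum may have either sign; its size, at most
  \<open>8 * |s|\<close>, is absorbed by \<open>4 * (1 + s^2)\<close>.\<close>

lemma sum_s24_fourth_le:
  fixes x :: "nat \<Rightarrow> real"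
  assumes q: "(\<Sum>i<n. (x i)\<^sup>2) = 1"
  shows "(\<Sum>i<n. \<Sum>j<n. \<Sum>k<n. \<Sum>l<n. x i * x j * x k * x l * s24 i j k l) \<le> 13 * (1 + (\<Sum>i<n. x i)\<^sup>2)\<^sup>2"
proof -
  define s c where "s = (\<Sum>i<n. x i)" and "c = (\<Sum>i<n. (x i) ^ 3)"
  have c: "\<bar>c\<bar> \<le> 1" and f: "(\<Sum>i<n. (x i) ^ 4) \<le> 1"
    using power_sum_bounds(2,3)[where x = x and n = n] q by (simp_all add: c_def)
  have "8 * s * c \<le> 8 * \<bar>s\<bar>"
  proof -
    have "s * c \<le> \<bar>s\<bar> * \<bar>c\<bar>" by (metis abs_ge_self abs_mult)
    also have "\<dots> \<le> \<bar>s\<bar>" using c by (simp add: mult_left_le)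
    finally show ?thesis by simp
  qed
  also have "8 * \<bar>s\<bar> \<le> 4 * (1 + s\<^sup>2)"
  proof -
    have "0 \<le> (\<bar>s\<bar> - 1)\<^sup>2" by simp
    then show ?thesis by (simp add: power2_diff)
  qed
  finally have "s ^ 4 + 6 * s\<^sup>2 + 3 + 8 * s * c + 6 * (\<Sum>i<n. (x i) ^ 4) \<le> s ^ 4 + 10 * s\<^sup>2 + 13" using f by simp
  also have "\<dots> \<le> 13 * (1 + s\<^sup>2)\<^sup>2"
  proof -
    have "13 * (1 + s\<^sup>2)\<^sup>2 = 13 + 26 * s\<^sup>2 + 13 * s ^ 4" by (simp add: power2_sum flip: power_mult)
    moreover have "0 \<le> s ^ 4" "0 \<le> s\<^sup>2" by simp_all
    ultimately show ?thesis by linarith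
  qed
  finally show ?thesis unfolding sum_s24_fourth q s_def[symmetric] c_def[symmetric] by simp
qed

text \<open>Summing out the free indices \<open>k\<close> and \<open>l\<close> yields a constant:
  second moments are fourth moments summed over two indices.\<close>

lemma sum_s24_second: 
  fixes x :: "nat \<Rightarrow> real"
  shows "(\<Sum>i<n. \<Sum>j<n. \<Sum>k<n. \<Sum>l<n. x i * x j * s24 i j k l) = ((\<Sum>i<n. x i)\<^sup>2 + (\<Sum>i<n. (x i)\<^sup>2)) * ((real n + 2) * (real n + 3))"
proof -
  have "(\<Sum>i<n. \<Sum>j<n. \<Sum>k<n. \<Sum>l<n. x i * x j * s24 i j k l) = (\<Sum>i<n. \<Sum>j<n. (x i * x j + kron i j * (x i * x j)) * ((real n + 2) * (real n + 3)))"
    by (intro sum.cong refl) (simp add: sum_s24_inner2 sum_distrib_left[symmetric] algebra_simps)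
  also have "\<dots> = (\<Sum>i<n. (x i * sum x {..<n} + x i * x i) * ((real n + 2) * (real n + 3)))"
    by (intro sum.cong refl) (simp add: sum.distrib sum_kron sum_distrib_left flip: sum_distrib_right)
  also have "\<dots> = (sum x {..<n} * sum x {..<n} + (\<Sum>i<n. x i * x i)) * ((real n + 2) * (real n + 3))"
    by (simp add: sum.distrib sum_distrib_right[symmetric])
  finally show ?thesis by (simp add: power2_eq_square)
qed

lemma sum_prod4_scale:
  fixes f g h e :: "nat \<Rightarrow> 'a::comm_semiring_1"
  shows "(\<Sum>i<n. \<Sum>j<n. \<Sum>k<n. \<Sum>l<n. c * (f i * g j * h k * e l)) = c * (sum f {..<n} * sum g {..<n} * sum h {..<n} * sum e {..<n})"
  by (simp flip: sum_distrib_left sum_distrib_right)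

lemma sum4_scale:
  fixes f :: "nat \<Rightarrow> nat \<Rightarrow> nat \<Rightarrow> nat \<Rightarrow> real"
  shows "(\<Sum>i<n. \<Sum>j<n. \<Sum>k<n. \<Sum>l<n. c * f i j k l) = c * (\<Sum>i<n. \<Sum>j<n. \<Sum>k<n. \<Sum>l<n. f i j k l)"
  by (simp only: sum_distrib_left)

lemma abs_sum4_le:
  fixes f :: "nat \<Rightarrow> nat \<Rightarrow> nat \<Rightarrow> nat \<Rightarrow> real"
  assumes "\<And>i j k l. i < n \<Longrightarrow> j < n \<Longrightarrow> k < n \<Longrightarrow> l < n \<Longrightarrow> \<bar>f i j k l\<bar> \<le> g i j k l"
  shows "\<bar>\<Sum>i<n. \<Sum>j<n. \<Sum>k<n. \<Sum>l<n. f i j k l\<bar> \<le> (\<Sum>i<n. \<Sum>j<n. \<Sum>k<n. \<Sum>l<n. g i j k l)"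
  using assms by (intro order_trans[OF sum_abs] sum_mono) simp

text \<open>The deviations from the moments of the Haar measure are dominated by the latter, and with the
  constants at hand they leave a quarter of the second moment.\<close>

lemma design_deviation:
  fixes x :: "nat \<Rightarrow> real"
  assumes d: "(\<exists>\<theta>. approx_design n 4 \<infinity> \<theta> N p w \<and> \<theta> \<le> 1 / (16 * (real r)\<^sup>2)) \<or> (\<exists>\<theta>. approx_design n 4 1 \<theta> N p w \<and> \<theta> \<le> 1 / 4)"
    and n: "2 \<le> n" and r: "1 \<le> r" and u: "onb n u"
    and q: "(\<Sum>i<n. (x i)\<^sup>2) = 1" and cone: "(\<Sum>i<n. \<bar>x i\<bar>)\<^sup>2 \<le> 6 * real r"
  defines "\<alpha> \<equiv> 1 / (real n * (real n + 1) * (real n + 2) * (real n + 3))"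
  defines "\<Delta> \<equiv> \<lambda>i j k l. des4 n N p w u i j k l - \<alpha> * s24 i j k l"
  shows "\<bar>\<Sum>i<n. \<Sum>j<n. \<Sum>k<n. \<Sum>l<n. x i * x j * \<Delta> i j k l\<bar> * (real n * (real n + 1)) \<le> 3 / 4" (is ?thesis1)
    and "\<bar>\<Sum>i<n. \<Sum>j<n. \<Sum>k<n. \<Sum>l<n. x i * x j * x k * x l * \<Delta> i j k l\<bar> * (real n * (real n + 1))\<^sup>2 \<le> 54" (is ?thesis2)
proof -
  have n0: "0 < n" using n by simp
  have \<alpha>0: "0 < \<alpha>" using n by (simp add: \<alpha>_def)
  have c\<alpha>: "\<alpha> * ((real n + 2) * (real n + 3)) * (real n * (real n + 1)) = 1"
    using n by (simp add: \<alpha>_def)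
  have c2\<alpha>: "\<alpha> * (real n * (real n + 1))\<^sup>2 \<le> 1"
  proof -
    have "real n * (real n + 1) \<le> (real n + 2) * (real n + 3)" by (intro mult_mono) auto
    then have "\<alpha> * (real n * (real n + 1)) * (real n * (real n + 1)) \<le> \<alpha> * (real n * (real n + 1)) * ((real n + 2) * (real n + 3))"
      using \<alpha>0 by (intro mult_left_mono) auto
    then show ?thesis using c\<alpha> by (simp add: power2_eq_square mult_ac)
  qed
  have x1: "\<bar>x i\<bar> \<le> 1" if "i < n" for i using power_sum_bounds(1)[OF that, of x] q by simp
  define S where "S = (\<Sum>i<n. \<bar>x i\<bar>)"
  have S: "S\<^sup>2 \<le> 6 * real r" "1 \<le> S\<^sup>2"
  proof -
    show "S\<^sup>2 \<le> 6 * real r" using cone by (simp add: S_def)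
    have "(\<Sum>i<n. \<bar>x i\<bar>\<^sup>2) \<le> (\<Sum>i<n. \<bar>x i\<bar> * S)"
      unfolding S_def power2_eq_square by (intro sum_mono mult_left_mono member_le_sum) auto
    then show "1 \<le> S\<^sup>2" using q by (simp add: S_def power2_eq_square sum_distrib_right)
  qed
  from d have "?thesis1 \<and> ?thesis2"
  proof (elim disjE exE conjE)
    fix \<theta> assume a: "approx_design n 4 \<infinity> \<theta> N p w" and th: "\<theta> \<le> 1 / (16 * (real r)\<^sup>2)"
    define \<kappa> where "\<kappa> = 1 / (16 * (real r)\<^sup>2)"
    have \<kappa>0: "0 \<le> \<kappa>" by (simp add: \<kappa>_def)
    have \<Delta>: "\<bar>\<Delta> i j k l\<bar> \<le> \<kappa> * \<alpha> * s24 i j k l" if "i < n" "j < n" "k < n" "l < n" for i j k l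
    proof -
      have "\<bar>\<Delta> i j k l\<bar> \<le> \<theta> * \<alpha> * s24 i j k l"
        using approx_design_inf[OF a n0 u that] unfolding \<Delta>_def \<alpha>_def .
      also have "\<dots> \<le> \<kappa> * \<alpha> * s24 i j k l" using th \<alpha>0 s24_nonneg by (intro mult_right_mono) (auto simp: \<kappa>_def)
      finally show ?thesis .
    qed
    have "\<bar>\<Sum>i<n. \<Sum>j<n. \<Sum>k<n. \<Sum>l<n. x i * x j * \<Delta> i j k l\<bar> \<le> (\<Sum>i<n. \<Sum>j<n. \<Sum>k<n. \<Sum>l<n. (\<kappa> * \<alpha>) * (\<bar>x i\<bar> * \<bar>x j\<bar> * s24 i j k l))"
    proof (rule abs_sum4_le)
      fix i j k l assume "i < n" "j < n" "k < n" "l < n"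
      then have "\<bar>x i\<bar> * \<bar>x j\<bar> * \<bar>\<Delta> i j k l\<bar> \<le> \<bar>x i\<bar> * \<bar>x j\<bar> * (\<kappa> * \<alpha> * s24 i j k l)" using \<Delta> by (intro mult_left_mono) auto
      then show "\<bar>x i * x j * \<Delta> i j k l\<bar> \<le> (\<kappa> * \<alpha>) * (\<bar>x i\<bar> * \<bar>x j\<bar> * s24 i j k l)" by (simp add: abs_mult mult_ac)
    qed
    also have "\<dots> = \<kappa> * \<alpha> * ((S\<^sup>2 + 1) * ((real n + 2) * (real n + 3)))"
    proof -
      have "(\<Sum>i<n. \<Sum>j<n. \<Sum>k<n. \<Sum>l<n. (\<kappa> * \<alpha>) * (\<bar>x i\<bar> * \<bar>x j\<bar> * s24 i j k l)) = \<kappa> * \<alpha> * (\<Sum>i<n. \<Sum>j<n. \<Sum>k<n. \<Sum>l<n. \<bar>x i\<bar> * \<bar>x j\<bar> * s24 i j k l)"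
        by (simp only: sum_distrib_left)
      then show ?thesis unfolding sum_s24_second[of "\<lambda>i. \<bar>x i\<bar>"] using q by (simp add: S_def)
    qed
    finally have "\<bar>\<Sum>i<n. \<Sum>j<n. \<Sum>k<n. \<Sum>l<n. x i * x j * \<Delta> i j k l\<bar> * (real n * (real n + 1)) \<le> \<kappa> * \<alpha> * ((S\<^sup>2 + 1) * ((real n + 2) * (real n + 3))) * (real n * (real n + 1))"
      by (intro mult_right_mono) auto
    also have "\<dots> = \<kappa> * (S\<^sup>2 + 1) * (\<alpha> * ((real n + 2) * (real n + 3)) * (real n * (real n + 1)))" by (simp only: mult_ac)
    also have "\<dots> = \<kappa> * (S\<^sup>2 + 1)" unfolding c\<alpha> by simp
    \<comment> \<open>Here \<open>S^2 + 1\<close> is at most twice \<open>S^2\<close>, as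
      \<open>S^2\<close> is at least 1. The result \<open>12 / (16 * r)\<close> would tolerate an
      accuracy of order 1/r.\<close>
    also have "\<dots> \<le> \<kappa> * (12 * real r)" using S \<kappa>0 by (intro mult_left_mono) auto
    also have "\<dots> \<le> 3 / 4" using r unfolding \<kappa>_def by (simp add: power2_eq_square field_simps)
    finally have 1: ?thesis1 .
    have "\<bar>\<Sum>i<n. \<Sum>j<n. \<Sum>k<n. \<Sum>l<n. x i * x j * x k * x l * \<Delta> i j k l\<bar> \<le> (\<Sum>i<n. \<Sum>j<n. \<Sum>k<n. \<Sum>l<n. (\<kappa> * \<alpha> * 24) * (\<bar>x i\<bar> * \<bar>x j\<bar> * \<bar>x k\<bar> * \<bar>x l\<bar>))"
    proof (rule abs_sum4_le)
      fix i j k l assume "i < n" "j < n" "k < n" "l < n"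
      then have "\<bar>\<Delta> i j k l\<bar> \<le> \<kappa> * \<alpha> * 24"
        using \<Delta> s24_le[of i j k l] \<kappa>0 \<alpha>0 by (meson mult_left_mono mult_nonneg_nonneg less_imp_le order_trans)
      then have "(\<bar>x i\<bar> * \<bar>x j\<bar> * \<bar>x k\<bar> * \<bar>x l\<bar>) * \<bar>\<Delta> i j k l\<bar> \<le> (\<bar>x i\<bar> * \<bar>x j\<bar> * \<bar>x k\<bar> * \<bar>x l\<bar>) * (\<kappa> * \<alpha> * 24)" by (intro mult_left_mono) auto
      then show "\<bar>x i * x j * x k * x l * \<Delta> i j k l\<bar> \<le> (\<kappa> * \<alpha> * 24) * (\<bar>x i\<bar> * \<bar>x j\<bar> * \<bar>x k\<bar> * \<bar>x l\<bar>)" by (simp add: abs_mult mult_ac)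
    qed
    also have "\<dots> = \<kappa> * \<alpha> * 24 * (S\<^sup>2)\<^sup>2"
      unfolding sum_prod4_scale by (simp add: S_def power2_eq_square mult.assoc)
    \<comment> \<open>The fourth moment is what uses up the accuracy of order 1/r^2:
      \<open>24 * 36 / 16 = 54\<close>.\<close>
    also have "\<dots> \<le> \<kappa> * \<alpha> * 24 * (6 * real r)\<^sup>2" using S \<kappa>0 \<alpha>0 by (intro mult_left_mono power_mono) auto
    also have "\<dots> = 54 * \<alpha>" using r by (simp add: \<kappa>_def power2_eq_square field_simps)
    finally have "\<bar>\<Sum>i<n. \<Sum>j<n. \<Sum>k<n. \<Sum>l<n. x i * x j * x k * x l * \<Delta> i j k l\<bar> * (real n * (real n + 1))\<^sup>2 \<le> 54 * \<alpha> * (real n * (real n + 1))\<^sup>2"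
      by (intro mult_right_mono) auto
    then have ?thesis2 using c2\<alpha> by linarith
    with 1 show ?thesis ..
  next
    fix \<theta> assume a: "approx_design n 4 1 \<theta> N p w" and th: "\<theta> \<le> 1 / 4"
    have "(\<Sum>i<n. \<Sum>j<n. \<Sum>k<n. \<Sum>l<n. \<bar>\<Delta> i j k l\<bar>) \<le> 24 * \<alpha> * \<theta>"
      using approx_design_trace[OF a n0 u] unfolding \<Delta>_def \<alpha>_def .
    also have "\<dots> \<le> 24 * \<alpha> * (1 / 4)" using th \<alpha>0 by (intro mult_left_mono) auto
    finally have \<Delta>: "(\<Sum>i<n. \<Sum>j<n. \<Sum>k<n. \<Sum>l<n. \<bar>\<Delta> i j k l\<bar>) \<le> 6 * \<alpha>" by simp
    \<comment> \<open>Unit Frobenius norm bounds every coefficient by 1, so the trace norm bound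
      applies without any loss in \<open>r\<close>.\<close>
    have "\<bar>\<Sum>i<n. \<Sum>j<n. \<Sum>k<n. \<Sum>l<n. x i * x j * \<Delta> i j k l\<bar> \<le> (\<Sum>i<n. \<Sum>j<n. \<Sum>k<n. \<Sum>l<n. \<bar>\<Delta> i j k l\<bar>)"
      using x1 by (intro abs_sum4_le) (simp add: abs_mult mult_left_le_one_le mult_le_one)
    then have "\<bar>\<Sum>i<n. \<Sum>j<n. \<Sum>k<n. \<Sum>l<n. x i * x j * \<Delta> i j k l\<bar> * (real n * (real n + 1)) \<le> 6 * \<alpha> * (real n * (real n + 1))"
      using \<Delta> by (intro mult_right_mono) auto
    \<comment> \<open>What remains is 6 over \<open>(n + 2) * (n + 3)\<close>, and this product is
      at least 8.\<close>
    also have "\<dots> \<le> 3 / 4"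
    proof -
      have "8 * (\<alpha> * (real n * (real n + 1))) \<le> (real n + 2) * (real n + 3) * (\<alpha> * (real n * (real n + 1)))"
      proof (intro mult_right_mono)
        have "4 * 2 \<le> (real n + 2) * (real n + 3)" using n by (intro mult_mono) auto
        then show "8 \<le> (real n + 2) * (real n + 3)" by simp
      qed (use \<alpha>0 in auto)
      moreover have "(real n + 2) * (real n + 3) * (\<alpha> * (real n * (real n + 1))) = 1" using c\<alpha> by (simp only: mult_ac)
      ultimately show ?thesis by linarith
    qed
    finally have 1: ?thesis1 .
    have "\<bar>\<Sum>i<n. \<Sum>j<n. \<Sum>k<n. \<Sum>l<n. x i * x j * x k * x l * \<Delta> i j k l\<bar> \<le> (\<Sum>i<n. \<Sum>j<n. \<Sum>k<n. \<Sum>l<n. \<bar>\<Delta> i j k l\<bar>)"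
      using x1 by (intro abs_sum4_le) (simp add: abs_mult mult_left_le_one_le mult_le_one)
    then have "\<bar>\<Sum>i<n. \<Sum>j<n. \<Sum>k<n. \<Sum>l<n. x i * x j * x k * x l * \<Delta> i j k l\<bar> * (real n * (real n + 1))\<^sup>2 \<le> 6 * \<alpha> * (real n * (real n + 1))\<^sup>2"
      using \<Delta> by (intro mult_right_mono) auto
    then have ?thesis2 using c2\<alpha> by linarith
    with 1 show ?thesis ..
  qed
  then show ?thesis1 ?thesis2 by auto
qed

text \<open>A Paley-Zygmund argument by way of the pointwise bound
  \<open>t^2 - t^4 / 4 \<le> min t 1\<close>. The second moment is at least \<open>S / 4\<close> and
  the fourth at most \<open>67 * S^2\<close>; both scale with \<open>S\<close>, so after rescaling
  by \<open>h\<close> the result depends neither on \<open>r\<close> nor on the trace of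
  \<open>Z\<close>.\<close>

lemma small_ball:
  fixes x :: "nat \<Rightarrow> real"
  assumes d: "(\<exists>\<theta>. approx_design n 4 \<infinity> \<theta> N p w \<and> \<theta> \<le> 1 / (16 * (real r)\<^sup>2)) \<or> (\<exists>\<theta>. approx_design n 4 1 \<theta> N p w \<and> \<theta> \<le> 1 / 4)"
    and wuv: "weighted_unit_vectors n N p w"
    and n: "2 \<le> n" and r: "1 \<le> r" and Z: "eigsys n Z u x"
    and q: "(\<Sum>i<n. (x i)\<^sup>2) = 1" and cone: "(\<Sum>i<n. \<bar>x i\<bar>)\<^sup>2 \<le> 6 * real r"
  shows "1 / 1072 \<le> (\<Sum>a<N. p a * min \<bar>sqrt (real n * (real n + 1)) * qf n Z (\<lambda>m. w a $ m)\<bar> 1)"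
proof -
  note u = eigsys_onb[OF Z]
  define c where "c = real n * (real n + 1)"
  define \<alpha> where "\<alpha> = 1 / (real n * (real n + 1) * (real n + 2) * (real n + 3))"
  define \<tau> where "\<tau> i a = (cmod (ip n (u i) (\<lambda>m. w a $ m)))\<^sup>2" for i a
  define y where "y a = (\<Sum>i<n. x i * \<tau> i a)" for a
  define S where "S = 1 + (\<Sum>i<n. x i)\<^sup>2"
  have S1: "1 \<le> S" by (simp add: S_def)
  have qfy: "qf n Z (\<lambda>m. w a $ m) = y a" for a unfolding y_def \<tau>_def by (rule eigsys_qf[OF Z])
  have \<tau>1: "(\<Sum>i<n. \<tau> i a) = 1" if "a < N" for a
    using wuv that vec_l2_norm_eq_1[of "w a" n] unfolding \<tau>_def onb_sqn[OF u, symmetric] by (simp add: weighted_unit_vectors_def)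
  have c0: "0 \<le> c" by (simp add: c_def)
  have des: "des4 n N p w u i j k l = (\<Sum>a<N. p a * (\<tau> i a * \<tau> j a * \<tau> k a * \<tau> l a))" for i j k l
    by (simp add: des4_def \<tau>_def)
  have push: "(\<Sum>i<n. \<Sum>j<n. \<Sum>k<n. \<Sum>l<n. \<Sum>a<N. F a i j k l) = (\<Sum>a<N. \<Sum>i<n. \<Sum>j<n. \<Sum>k<n. \<Sum>l<n. F a i j k l)" for F :: "nat \<Rightarrow> nat \<Rightarrow> nat \<Rightarrow> nat \<Rightarrow> nat \<Rightarrow> real"
    by (simp only: sum.swap[of _ "{..<N}" "{..<n}"])
  \<comment> \<open>The overlaps \<tau> sum to 1 over the basis, so second moments are fourth
    moments summed over two indices and the same hypothesis controls both.\<close>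
  have m2: "(\<Sum>i<n. \<Sum>j<n. \<Sum>k<n. \<Sum>l<n. x i * x j * des4 n N p w u i j k l) = (\<Sum>a<N. p a * (y a)\<^sup>2)"
  proof -
    have "(\<Sum>i<n. \<Sum>j<n. \<Sum>k<n. \<Sum>l<n. x i * x j * des4 n N p w u i j k l) = (\<Sum>a<N. \<Sum>i<n. \<Sum>j<n. \<Sum>k<n. \<Sum>l<n. p a * ((x i * \<tau> i a) * (x j * \<tau> j a) * \<tau> k a * \<tau> l a))"
      unfolding push[symmetric] des by (intro sum.cong refl) (simp add: sum_distrib_left mult_ac)
    also have "\<dots> = (\<Sum>a<N. p a * (y a)\<^sup>2)"
      unfolding sum_prod4_scale by (intro sum.cong refl) (simp add: \<tau>1 y_def power2_eq_square)
    finally show ?thesis .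
  qed
  have m4: "(\<Sum>i<n. \<Sum>j<n. \<Sum>k<n. \<Sum>l<n. x i * x j * x k * x l * des4 n N p w u i j k l) = (\<Sum>a<N. p a * (y a) ^ 4)"
  proof -
    have "(\<Sum>i<n. \<Sum>j<n. \<Sum>k<n. \<Sum>l<n. x i * x j * x k * x l * des4 n N p w u i j k l) = (\<Sum>a<N. \<Sum>i<n. \<Sum>j<n. \<Sum>k<n. \<Sum>l<n. p a * ((x i * \<tau> i a) * (x j * \<tau> j a) * (x k * \<tau> k a) * (x l * \<tau> l a)))"
      unfolding push[symmetric] des by (intro sum.cong refl) (simp add: sum_distrib_left mult_ac)
    also have "\<dots> = (\<Sum>a<N. p a * (y a) ^ 4)"
      unfolding sum_prod4_scale by (intro sum.cong refl) (simp add: y_def power4_eq_xxxx)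
    finally show ?thesis .
  qed
  note dev = design_deviation[OF d n r u q cone, folded \<alpha>_def c_def]
  \<comment> \<open>The deviation costs at most 3/4, and \<open>S - 3 / 4 \<ge> S / 4\<close>
    because \<open>S \<ge> 1\<close>.\<close>
  have E2: "S / 4 \<le> c * (\<Sum>a<N. p a * (y a)\<^sup>2)"
  proof -
    have "(\<Sum>a<N. p a * (y a)\<^sup>2) = (\<Sum>i<n. \<Sum>j<n. \<Sum>k<n. \<Sum>l<n. \<alpha> * (x i * x j * s24 i j k l) + x i * x j * (des4 n N p w u i j k l - \<alpha> * s24 i j k l))"
      unfolding m2[symmetric] by (intro sum.cong refl) (simp add: algebra_simps)
    also have "\<dots> = \<alpha> * (S * ((real n + 2) * (real n + 3))) + (\<Sum>i<n. \<Sum>j<n. \<Sum>k<n. \<Sum>l<n. x i * x j * (des4 n N p w u i j k l - \<alpha> * s24 i j k l))"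
      unfolding sum.distrib sum4_scale sum_s24_second q S_def by (simp add: add.commute)
    finally have "c * (\<Sum>a<N. p a * (y a)\<^sup>2) = S * (\<alpha> * ((real n + 2) * (real n + 3)) * c) + c * (\<Sum>i<n. \<Sum>j<n. \<Sum>k<n. \<Sum>l<n. x i * x j * (des4 n N p w u i j k l - \<alpha> * s24 i j k l))"
      by (simp add: algebra_simps)
    moreover have "\<alpha> * ((real n + 2) * (real n + 3)) * c = 1" using n by (simp add: \<alpha>_def c_def)
    moreover have "- (3 / 4) \<le> c * (\<Sum>i<n. \<Sum>j<n. \<Sum>k<n. \<Sum>l<n. x i * x j * (des4 n N p w u i j k l - \<alpha> * s24 i j k l))"
    proof -
      have "\<bar>c * (\<Sum>i<n. \<Sum>j<n. \<Sum>k<n. \<Sum>l<n. x i * x j * (des4 n N p w u i j k l - \<alpha> * s24 i j k l))\<bar> \<le> 3 / 4"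
        using dev(1) c0 by (simp add: abs_mult mult.commute)
      then show ?thesis by linarith
    qed
    ultimately show ?thesis using S1 by simp
  qed
  \<comment> \<open>The constant is 13 for the invariant measure plus 54 for the deviation.\<close>
  have E4: "c\<^sup>2 * (\<Sum>a<N. p a * (y a) ^ 4) \<le> 67 * S\<^sup>2"
  proof -
    have "(\<Sum>a<N. p a * (y a) ^ 4) = (\<Sum>i<n. \<Sum>j<n. \<Sum>k<n. \<Sum>l<n. \<alpha> * (x i * x j * x k * x l * s24 i j k l) + x i * x j * x k * x l * (des4 n N p w u i j k l - \<alpha> * s24 i j k l))"
      unfolding m4[symmetric] by (intro sum.cong refl) (simp add: algebra_simps)
    also have "\<dots> = \<alpha> * (\<Sum>i<n. \<Sum>j<n. \<Sum>k<n. \<Sum>l<n. x i * x j * x k * x l * s24 i j k l) + (\<Sum>i<n. \<Sum>j<n. \<Sum>k<n. \<Sum>l<n. x i * x j * x k * x l * (des4 n N p w u i j k l - \<alpha> * s24 i j k l))"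
      unfolding sum.distrib sum_distrib_left[symmetric] ..
    finally have "c\<^sup>2 * (\<Sum>a<N. p a * (y a) ^ 4) = \<alpha> * c\<^sup>2 * (\<Sum>i<n. \<Sum>j<n. \<Sum>k<n. \<Sum>l<n. x i * x j * x k * x l * s24 i j k l)
       + c\<^sup>2 * (\<Sum>i<n. \<Sum>j<n. \<Sum>k<n. \<Sum>l<n. x i * x j * x k * x l * (des4 n N p w u i j k l - \<alpha> * s24 i j k l))"
      by (simp add: algebra_simps)
    moreover have "\<alpha> * c\<^sup>2 * (\<Sum>i<n. \<Sum>j<n. \<Sum>k<n. \<Sum>l<n. x i * x j * x k * x l * s24 i j k l) \<le> 1 * (13 * S\<^sup>2)"
    proof (rule order_trans[OF mult_left_mono[OF sum_s24_fourth_le[OF q]]])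
      have "c \<le> (real n + 2) * (real n + 3)" unfolding c_def by (intro mult_mono) auto
      then have "\<alpha> * c * c \<le> \<alpha> * c * ((real n + 2) * (real n + 3))" using c0 by (intro mult_left_mono) (auto simp: \<alpha>_def)
      also have "\<dots> = 1" using n by (simp add: \<alpha>_def c_def)
      finally have "\<alpha> * c\<^sup>2 \<le> 1" by (simp add: power2_eq_square mult.assoc)
      then show "\<alpha> * c\<^sup>2 * (13 * (1 + (\<Sum>i<n. x i)\<^sup>2)\<^sup>2) \<le> 1 * (13 * S\<^sup>2)" unfolding S_def by (intro mult_right_mono) auto
    qed (simp add: \<alpha>_def)
    moreover have "c\<^sup>2 * (\<Sum>i<n. \<Sum>j<n. \<Sum>k<n. \<Sum>l<n. x i * x j * x k * x l * (des4 n N p w u i j k l - \<alpha> * s24 i j k l)) \<le> 54"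
    proof -
      define D where "D = (\<Sum>i<n. \<Sum>j<n. \<Sum>k<n. \<Sum>l<n. x i * x j * x k * x l * (des4 n N p w u i j k l - \<alpha> * s24 i j k l))"
      have "\<bar>D\<bar> * c\<^sup>2 \<le> 54" using dev(2) unfolding D_def .
      moreover have "c\<^sup>2 * D \<le> c\<^sup>2 * \<bar>D\<bar>" by (intro mult_left_mono) auto
      ultimately show ?thesis unfolding D_def[symmetric] by (simp add: mult.commute)
    qed
    moreover have "54 \<le> 54 * S\<^sup>2" using S1 by (simp add: one_le_power)
    ultimately show ?thesis by linarith
  qed
  \<comment> \<open>The maximiser of \<open>h * S / 4 - 67 * h^2 * S^2 / 4\<close>; the maximum is
    1/1072.\<close>
  define h where "h = 1 / (134 * S)"
  have h: "0 < h" "h \<le> 1" using S1 by (auto simp: h_def field_simps)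
  have pt: "h * (c * (y a)\<^sup>2) - h\<^sup>2 * (c\<^sup>2 * (y a) ^ 4) / 4 \<le> min \<bar>sqrt c * y a\<bar> 1" for a
  proof -
    define t where "t = sqrt h * \<bar>sqrt c * y a\<bar>"
    have t0: "0 \<le> t" using h by (simp add: t_def)
    have t2: "t\<^sup>2 = h * (c * (y a)\<^sup>2)" using h c0 by (simp add: t_def power_mult_distrib)
    have t4: "t ^ 4 = h\<^sup>2 * (c\<^sup>2 * (y a) ^ 4)"
    proof -
      have "t ^ 4 = (t\<^sup>2)\<^sup>2" by simp
      also have "\<dots> = h\<^sup>2 * (c\<^sup>2 * (y a) ^ 4)" unfolding t2 by (simp add: power_mult_distrib)
      finally show ?thesis .
    qed
    have "t\<^sup>2 - t ^ 4 / 4 \<le> min t 1"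
    proof -
      have "0 \<le> (t\<^sup>2 - 2)\<^sup>2" by simp
      then have "t\<^sup>2 - t ^ 4 / 4 \<le> 1" by (simp add: power2_diff flip: power_mult)
      moreover have "t\<^sup>2 - t ^ 4 / 4 \<le> t" if "t \<le> 1"
      proof -
        have "t\<^sup>2 \<le> t" using that t0 by (simp add: power2_eq_square mult_left_le)
        moreover have "0 \<le> t ^ 4" by simp
        ultimately show ?thesis by linarith
      qed
      ultimately show ?thesis by (cases "t \<le> 1") auto
    qed
    also have "min t 1 \<le> min \<bar>sqrt c * y a\<bar> 1"
    proof -
      have "t \<le> 1 * \<bar>sqrt c * y a\<bar>" unfolding t_def using h by (intro mult_right_mono) auto
      then show ?thesis by simp
    qed
    finally show ?thesis unfolding t2 t4 .
  qed
  have "h * (S / 4) - h\<^sup>2 * (67 * S\<^sup>2) / 4 \<le> h * (c * (\<Sum>a<N. p a * (y a)\<^sup>2)) - h\<^sup>2 * (c\<^sup>2 * (\<Sum>a<N. p a * (y a) ^ 4)) / 4"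
    using E2 E4 h by (intro diff_mono mult_left_mono divide_right_mono) auto
  also have "\<dots> = (\<Sum>a<N. p a * (h * (c * (y a)\<^sup>2) - h\<^sup>2 * (c\<^sup>2 * (y a) ^ 4) / 4))"
    by (simp add: sum_distrib_left sum_subtractf sum_divide_distrib algebra_simps)
  also have "\<dots> \<le> (\<Sum>a<N. p a * min \<bar>sqrt c * y a\<bar> 1)"
    using wuv pt by (intro sum_mono mult_left_mono) (auto simp: weighted_unit_vectors_def)
  finally have "h * (S / 4) - h\<^sup>2 * (67 * S\<^sup>2) / 4 \<le> (\<Sum>a<N. p a * min \<bar>sqrt c * y a\<bar> 1)" .
  moreover have "h * (S / 4) - h\<^sup>2 * (67 * S\<^sup>2) / 4 = 1 / 1072"
  proof -
    have hS: "h * S = 1 / 134" using S1 by (simp add: h_def)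
    have "h * (S / 4) - h\<^sup>2 * (67 * S\<^sup>2) / 4 = (h * S) / 4 - 67 * (h * S)\<^sup>2 / 4" by (simp add: power_mult_distrib)
    then show ?thesis unfolding hS by (simp add: power2_eq_square)
  qed
  ultimately have "1 / 1072 \<le> (\<Sum>a<N. p a * min \<bar>sqrt c * y a\<bar> 1)" by (simp only:)
  then show ?thesis unfolding qfy c_def .
qed

section \<open>From a lower bound on the cone to recovery\<close>

abbreviation coords :: "complex vec \<Rightarrow> nat \<Rightarrow> complex" where
  "coords v \<equiv> \<lambda>i. v $ i"

lemma meas_map_entry:
  assumes Z: "Z \<in> carrier_mat n n" and a: "a j \<in> carrier_vec n" and j: "j < m"
  shows "meas_map n m a Z $ j = sqrt (real n * (real n + 1)) * qf n (fun_of_mat Z) (coords (a j))"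
proof -
  let ?c = "complex_of_real (sqrt (real n * (real n + 1)))"
  have k: "ket_bra (a j) \<in> carrier_mat n n" "meas_mat n (a j) \<in> carrier_mat n n" using a by (auto simp: ket_bra_def meas_mat_def)
  have "mat_trace (Z * meas_mat n (a j)) = (\<Sum>i<n. (Z * meas_mat n (a j)) $$ (i, i))"
    using Z by (simp add: mat_trace_def)
  also have "\<dots> = (\<Sum>i<n. \<Sum>k<n. ?c * (cnj (a j $ i) * fun_of_mat Z i k * a j $ k))"
  proof (intro sum.cong refl)
    fix i assume i: "i \<in> {..<n}"
    then have "(Z * meas_mat n (a j)) $$ (i, i) = (\<Sum>k<n. Z $$ (i, k) * meas_mat n (a j) $$ (k, i))"
      using square_mat_mult_entry[OF Z k(2)] by simp
    also have "\<dots> = (\<Sum>k<n. ?c * (cnj (a j $ i) * fun_of_mat Z i k * a j $ k))"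
      using i a by (intro sum.cong refl) (simp add: meas_mat_def ket_bra_def fun_of_mat_def mult_ac)
    finally show "(Z * meas_mat n (a j)) $$ (i, i) = \<dots>" .
  qed
  also have "\<dots> = ?c * bform n (fun_of_mat Z) (coords (a j)) (coords (a j))"
    by (simp add: bform_def sum_distrib_left)
  finally show ?thesis using j by (simp add: meas_map_def)
qed

lemma eigsys_scale: "eigsys n Z u l \<Longrightarrow> eigsys n (\<lambda>i j. complex_of_real c * Z i j) u (\<lambda>k. c * l k)"
  by (simp add: eigsys_def sum_distrib_left mult.assoc)

lemma qf_scale: "qf n (\<lambda>i j. complex_of_real c * Z i j) x = c * qf n Z x"
proof -
  have "bform n (\<lambda>i j. complex_of_real c * Z i j) x x = complex_of_real c * bform n Z x x"
    unfolding bform_def sum_distrib_left by (intro sum.cong refl) (simp add: mult_ac)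
  then show ?thesis by simp
qed

text \<open>Normalised to Frobenius norm 1, so that the suprema over it are finite. The constant 6
  is the one from \<open>cone_bound\<close>.\<close>

definition cone :: "nat \<Rightarrow> nat \<Rightarrow> (nat \<Rightarrow> nat \<Rightarrow> complex) set" where
  "cone n r = {Z. \<exists>u l. eigsys n Z u l \<and> (\<Sum>k<n. (l k)\<^sup>2) = 1 \<and> (\<Sum>k<n. \<bar>l k\<bar>)\<^sup>2 \<le> 6 * real r}"

lemma vec_l2_norm_eq: "vec_l2_norm v = sqrt (\<Sum>i<dim_vec v. (norm (v $ i))\<^sup>2)"
  by (simp add: vec_l2_norm_def L2_set_def)

text \<open>Both \<open>X\<close> and \<open>Y\<close> are feasible, so their difference has
  measurements of norm at most \<open>2 * \<eta>\<close>; and since \<open>Y\<close> minimises the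
  nuclear norm, the difference is a multiple of an element of the cone.\<close>

lemma recovery_from_cone_bound:
  assumes a: "\<And>j. j < m \<Longrightarrow> a j \<in> carrier_vec n" and m: "0 < m" and \<beta>: "0 < \<beta>"
    and lower: "\<And>Z. Z \<in> cone n r \<Longrightarrow> real m * \<beta>\<^sup>2 \<le> (\<Sum>j<m. (sqrt (real n * (real n + 1)) * qf n Z (coords (a j)))\<^sup>2)"
    and X: "X \<in> hermitian_mats n" and rk: "vec_space.rank n X \<le> r"
    and \<epsilon>: "\<epsilon> \<in> carrier_vec m" "vec_l2_norm \<epsilon> \<le> \<eta>"
    and Y: "Y \<in> nuclear_norm_solutions n m a (meas_map n m a X + \<epsilon>) \<eta>"
  shows "schatten_norm 2 (X - Y) \<le> 2 / \<beta> * \<eta> / sqrt (real m)"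
proof -
  let ?c = "sqrt (real n * (real n + 1))" and ?b = "meas_map n m a X + \<epsilon>"
  have Xc: "X \<in> carrier_mat n n" and Xh: "herm n (fun_of_mat X)" using X hermitian_mats_iff by blast+
  have Yf: "Y \<in> feasible_set n m a ?b \<eta>" using Y by (simp add: nuclear_norm_solutions_def)
  then have Yh: "Y \<in> hermitian_mats n" and Y\<eta>: "vec_l2_norm (meas_map n m a Y - ?b) \<le> \<eta>" by (auto simp: feasible_set_def)
  have Yc: "Y \<in> carrier_mat n n" and Yhh: "herm n (fun_of_mat Y)" using Yh hermitian_mats_iff by blast+
  have mm: "dim_vec (meas_map n m a Z) = m" for Z by (simp add: meas_map_def)
  have "vec_l2_norm (meas_map n m a X - ?b) = vec_l2_norm \<epsilon>"
    using \<epsilon> by (simp add: vec_l2_norm_eq mm)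
  then have "X \<in> feasible_set n m a ?b \<eta>" using X \<epsilon> by (simp add: feasible_set_def)
  then have le: "schatten_norm 1 Y \<le> schatten_norm 1 X" using Y by (simp add: nuclear_norm_solutions_def)
  define Z where "Z i j = fun_of_mat Y i j - fun_of_mat X i j" for i j
  have "herm n Z" unfolding herm_def Z_def using hermD[OF Xh] hermD[OF Yhh] by simp
  then obtain u z where z: "eigsys n Z u z" using spectral_theorem by blast
  have cn: "(\<Sum>k<n. \<bar>z k\<bar>)\<^sup>2 \<le> 6 * real r * (\<Sum>k<n. (z k)\<^sup>2)"
    using cone_bound[OF X Yh rk le] z unfolding Z_def by blast
  define \<rho> where "\<rho> = sqrt (\<Sum>k<n. (z k)\<^sup>2)"
  have \<rho>0: "0 \<le> \<rho>" and \<rho>2: "\<rho>\<^sup>2 = (\<Sum>k<n. (z k)\<^sup>2)" by (simp_all add: \<rho>_def sum_nonneg)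
  have "schatten_norm 2 (X - Y) = \<rho>"
  proof -
    have e: "fun_of_mat (X - Y) i j = complex_of_real (- 1) * Z i j" if "i < n" "j < n" for i j
      using that Xc Yc by (simp add: fun_of_mat_def Z_def)
    have s: "eigsys n (fun_of_mat (X - Y)) u (\<lambda>k. - 1 * z k)"
      using eigsys_scale[OF z, of "- 1"] e unfolding eigsys_def by simp
    moreover have "X - Y \<in> hermitian_mats n"
      using eigsys_herm[OF s] minus_carrier_mat[OF Yc, of X] by (simp add: hermitian_mats_iff)
    ultimately show ?thesis using schatten_norm_2 by (simp add: \<rho>_def)
  qed
  moreover have "\<beta> * sqrt (real m) * \<rho> \<le> 2 * \<eta>"
  proof (cases "\<rho> = 0")
    case True
    have "0 \<le> vec_l2_norm \<epsilon>" by (simp add: vec_l2_norm_eq sum_nonneg)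
    then show ?thesis using True \<epsilon> by simp
  next
    case False
    then have \<rho>: "0 < \<rho>" using \<rho>0 by simp
    define Z' where "Z' = (\<lambda>i j. complex_of_real (1 / \<rho>) * Z i j)"
    have "eigsys n Z' u (\<lambda>k. 1 / \<rho> * z k)" unfolding Z'_def by (rule eigsys_scale[OF z])
    moreover have "(\<Sum>k<n. (1 / \<rho> * z k)\<^sup>2) = 1"
    proof -
      have "(\<Sum>k<n. (1 / \<rho> * z k)\<^sup>2) = (1 / \<rho>)\<^sup>2 * \<rho>\<^sup>2" unfolding \<rho>2 sum_distrib_left power_mult_distrib ..
      then show ?thesis using \<rho> by (simp add: power_divide)
    qed
    moreover have "(\<Sum>k<n. \<bar>1 / \<rho> * z k\<bar>)\<^sup>2 \<le> 6 * real r"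
    proof -
      have "(\<Sum>k<n. \<bar>1 / \<rho> * z k\<bar>) = 1 / \<rho> * (\<Sum>k<n. \<bar>z k\<bar>)" unfolding sum_distrib_left using \<rho> by (simp add: abs_mult)
      then have "(\<Sum>k<n. \<bar>1 / \<rho> * z k\<bar>)\<^sup>2 = (\<Sum>k<n. \<bar>z k\<bar>)\<^sup>2 / \<rho>\<^sup>2" by (simp add: power_divide)
      also have "\<dots> \<le> 6 * real r * \<rho>\<^sup>2 / \<rho>\<^sup>2" using cn unfolding \<rho>2[symmetric] by (intro divide_right_mono) auto
      finally show ?thesis using \<rho> by simp
    qed
    ultimately have "Z' \<in> cone n r" unfolding cone_def by blast
    then have "real m * \<beta>\<^sup>2 \<le> (\<Sum>j<m. (?c * qf n Z' (coords (a j)))\<^sup>2)" by (rule lower)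
    also have "\<dots> = (\<Sum>j<m. (?c * qf n Z (coords (a j)))\<^sup>2) / \<rho>\<^sup>2"
      unfolding Z'_def qf_scale sum_divide_distrib by (intro sum.cong refl) (simp add: power_mult_distrib power_divide)
    finally have 1: "real m * \<beta>\<^sup>2 * \<rho>\<^sup>2 \<le> (\<Sum>j<m. (?c * qf n Z (coords (a j)))\<^sup>2)" using \<rho> by (simp add: pos_le_divide_eq)
    have "\<beta> * sqrt (real m) * \<rho> = sqrt (real m * \<beta>\<^sup>2 * \<rho>\<^sup>2)" using \<beta> \<rho> by (simp add: real_sqrt_mult mult_ac)
    also have "\<dots> \<le> L2_set (\<lambda>j. ?c * qf n Z (coords (a j))) {..<m}" unfolding L2_set_def using 1 by (rule real_sqrt_le_mono)
    \<comment> \<open>The measurements of the difference are the residual of \<open>Y\<close> plus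
      the noise, each of norm at most \<eta>.\<close>
    also have "\<dots> = L2_set (\<lambda>j. (meas_map n m a Y - ?b) $ j + \<epsilon> $ j) {..<m}"
    proof (intro L2_set_cong refl)
      fix j assume "j \<in> {..<m}"
      then have j: "j < m" by simp
      have "bform n Z (coords (a j)) (coords (a j)) = bform n (fun_of_mat Y) (coords (a j)) (coords (a j)) - bform n (fun_of_mat X) (coords (a j)) (coords (a j))"
        unfolding bform_def Z_def sum_subtractf[symmetric] by (intro sum.cong refl) (simp add: algebra_simps)
      then show "?c * qf n Z (coords (a j)) = (meas_map n m a Y - ?b) $ j + \<epsilon> $ j"
        using j \<epsilon> meas_map_entry[where j = j and a = a, OF Xc a[OF j] j] meas_map_entry[where j = j and a = a, OF Yc a[OF j] j]
        by (simp add: mm right_diff_distrib)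
    qed
    also have "\<dots> \<le> L2_set (\<lambda>j. (meas_map n m a Y - ?b) $ j) {..<m} + L2_set (\<lambda>j. \<epsilon> $ j) {..<m}"
      by (rule L2_set_triangle_ineq)
    also have "\<dots> = vec_l2_norm (meas_map n m a Y - ?b) + vec_l2_norm \<epsilon>"
      using \<epsilon> by (simp add: vec_l2_norm_eq L2_set_def)
    finally show ?thesis using Y\<eta> \<epsilon> by simp
  qed
  ultimately show ?thesis using \<beta> m by (simp add: field_simps)
qed

section \<open>The frame bound, and sampling as a finite expectation\<close>

text \<open>The form at a unit vector is \<open>1 / n\<close> for the ideal frame plus at most
  \<open>1 / n\<close> for the deviation.\<close>

lemma frame_upper_bound:
  assumes wuv: "weighted_unit_vectors n N p w"
    and le: "schatten_norm \<infinity> (weighted_mat_sum n N p (\<lambda>i. ket_bra (w i)) - complex_of_real (1 / real n) \<cdot>\<^sub>m 1\<^sub>m n) \<le> 1 / real n"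
    and x: "sqn n x = 1"
  shows "(\<Sum>i<N. p i * (cmod (ip n (coords (w i)) x))\<^sup>2) \<le> 2 / real n"
proof -
  define F where "F = weighted_mat_sum n N p (\<lambda>i. ket_bra (w i)) - complex_of_real (1 / real n) \<cdot>\<^sub>m 1\<^sub>m n"
  have wc: "w i \<in> carrier_vec n" if "i < N" for i using wuv that by (simp add: weighted_unit_vectors_def)
  have Dc: "F \<in> carrier_mat n n" unfolding F_def by (intro minus_carrier_mat smult_carrier_mat one_carrier_mat)
  have e: "fun_of_mat F i j = (\<Sum>a<N. complex_of_real (p a) * (w a $ i * cnj (w a $ j))) - complex_of_real (1 / real n) * (if i = j then 1 else 0)"
    if "i < n" "j < n" for i j
  proof -
    have "ket_bra (w a) $$ (i, j) = w a $ i * cnj (w a $ j)" if "a < N" for a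
      using fun_of_ket_bra[OF wc[OF that] \<open>i < n\<close> \<open>j < n\<close>] by (simp add: fun_of_mat_def)
    then show ?thesis using that by (simp add: F_def fun_of_mat_def weighted_mat_sum_def)
  qed
  have "herm n (fun_of_mat F)" unfolding herm_def by (simp add: e mult_ac)
  then have D: "F \<in> hermitian_mats n" using Dc by (simp add: hermitian_mats_iff)
  obtain v \<delta> where v: "eigsys n (fun_of_mat F) v \<delta>" using D spectral_theorem hermitian_mats_iff by blast
  have "\<bar>qf n (fun_of_mat F) x\<bar> \<le> 1 / real n * sqn n x"
    using schatten_norm_inf_ge[OF D v] le[folded F_def] by (intro eigsys_qf_bound[OF v]) force
  moreover have "bform n (fun_of_mat F) x x = complex_of_real ((\<Sum>i<N. p i * (cmod (ip n (coords (w i)) x))\<^sup>2) - 1 / real n * sqn n x)"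
  proof -
    have "bform n (fun_of_mat F) x x = (\<Sum>i<n. \<Sum>j<n. (\<Sum>a<N. complex_of_real (p a) * ((cnj (x i) * w a $ i) * (cnj (w a $ j) * x j)))
        - complex_of_real (1 / real n) * (if i = j then cnj (x i) * x j else 0))"
      unfolding bform_def by (intro sum.cong refl) (simp add: e algebra_simps sum_distrib_left)
    also have "\<dots> = (\<Sum>i<n. \<Sum>j<n. \<Sum>a<N. complex_of_real (p a) * ((cnj (x i) * w a $ i) * (cnj (w a $ j) * x j)))
        - complex_of_real (1 / real n) * ip n x x"
      unfolding sum_subtractf sum_distrib_left[symmetric] ip_def by simp
    also have "(\<Sum>i<n. \<Sum>j<n. \<Sum>a<N. complex_of_real (p a) * ((cnj (x i) * w a $ i) * (cnj (w a $ j) * x j)))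
       = (\<Sum>a<N. \<Sum>i<n. \<Sum>j<n. complex_of_real (p a) * ((cnj (x i) * w a $ i) * (cnj (w a $ j) * x j)))"
      by (simp only: sum.swap[of _ "{..<N}" "{..<n}"])
    also have "\<dots> = (\<Sum>a<N. complex_of_real (p a) * (ip n x (coords (w a)) * ip n (coords (w a)) x))"
      by (simp only: ip_def sum_product) (simp only: sum_distrib_left)
    also have "\<dots> = complex_of_real (\<Sum>a<N. p a * (cmod (ip n (coords (w a)) x))\<^sup>2)"
      unfolding of_real_sum by (intro sum.cong refl) (simp only: ip_cnj[of n "coords _" x, symmetric] of_real_mult cnj_mult_self)
    finally show ?thesis by (simp add: ip_self)
  qed
  ultimately have "\<bar>(\<Sum>i<N. p i * (cmod (ip n (coords (w i)) x))\<^sup>2) - 1 / real n\<bar> \<le> 1 / real n" by (simp add: x)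
  then show ?thesis by linarith
qed

text \<open>The list is reversed because enlarging the product adds the largest index, whereas
  \<open>expect\<close> conditions on the head of the list.\<close>

lemma expect_design_pmf:
  fixes f :: "nat list \<Rightarrow> real"
  assumes w: "weights {..<N} p"
  defines "q \<equiv> embed_pmf (\<lambda>i. if i < N then p i else 0)"
  shows "measure_pmf.expectation (Pi_pmf {..<m} d (\<lambda>_. q)) (\<lambda>a. f (map a (rev [0..<m]))) = expect {..<N} p m f"
    and "set_pmf q \<subseteq> {..<N}"
proof -
  have nn: "(\<integral>\<^sup>+ x. ennreal (if x < N then p x else 0) \<partial>count_space UNIV) = 1"
  proof -
    have "(\<integral>\<^sup>+ x. ennreal (if x < N then p x else 0) \<partial>count_space UNIV) = (\<Sum>x<N. ennreal (if x < N then p x else 0))"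
      by (rule nn_integral_count_space') auto
    also have "\<dots> = (\<Sum>x<N. ennreal (p x))" by (intro sum.cong) auto
    also have "\<dots> = ennreal (\<Sum>x<N. p x)" using w by (intro sum_ennreal) (auto simp: weights_def)
    finally show ?thesis using w by (simp add: weights_def)
  qed
  have q: "pmf q i = (if i < N then p i else 0)" for i
    unfolding q_def using w nn by (intro pmf_embed_pmf) (auto simp: weights_def)
  show sub: "set_pmf q \<subseteq> {..<N}" using q by (auto simp: set_pmf_eq split: if_splits)
  then have finq: "finite (set_pmf q)" using finite_subset by blast
  show "measure_pmf.expectation (Pi_pmf {..<m} d (\<lambda>_. q)) (\<lambda>a. f (map a (rev [0..<m]))) = expect {..<N} p m f"
  proof (induction m arbitrary: f)
    case 0
    show ?case by simp
  next
    case (Suc m)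
    have fin: "finite (set_pmf (Pi_pmf {..<m} d (\<lambda>_. q)))"
      using finq by (intro finite_subset[OF set_Pi_pmf_subset']) (auto intro!: finite_PiE_dflt)
    have "Pi_pmf {..<Suc m} d (\<lambda>_. q) = q \<bind> (\<lambda>y. map_pmf (\<lambda>g. g(m := y)) (Pi_pmf {..<m} d (\<lambda>_. q)))"
      unfolding lessThan_Suc by (subst Pi_pmf_insert') (auto simp: map_pmf_def)
    then have "measure_pmf.expectation (Pi_pmf {..<Suc m} d (\<lambda>_. q)) (\<lambda>a. f (map a (rev [0..<Suc m])))
      = (\<Sum>y\<in>{..<N}. pmf q y *\<^sub>R measure_pmf.expectation (map_pmf (\<lambda>g. g(m := y)) (Pi_pmf {..<m} d (\<lambda>_. q))) (\<lambda>a. f (map a (rev [0..<Suc m]))))"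
      using sub fin by (simp only:) (intro pmf_expectation_bind; simp)
    also have "\<dots> = (\<Sum>y\<in>{..<N}. p y * expect {..<N} p m (\<lambda>xs. f (y # xs)))"
    proof (intro sum.cong refl)
      fix y assume "y \<in> {..<N}"
      have "map (g(m := y)) (rev [0..<Suc m]) = y # map g (rev [0..<m])" for g by auto
      then show "pmf q y *\<^sub>R measure_pmf.expectation (map_pmf (\<lambda>g. g(m := y)) (Pi_pmf {..<m} d (\<lambda>_. q))) (\<lambda>a. f (map a (rev [0..<Suc m])))
        = p y * expect {..<N} p m (\<lambda>xs. f (y # xs))"
        using \<open>y \<in> {..<N}\<close> Suc.IH[of "\<lambda>xs. f (y # xs)"] by (simp add: q del: upt_Suc)
    qed
    finally show ?case by simp
  qed
qed

text \<open>Indices are sampled in place of vectors, which makes the support explicit.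
  \<open>N\<close> is the default index; it lies outside the range and is sent to the zero vector,
  the default of \<open>design_sample_pmf\<close>.\<close>

lemma design_sample_prob_ge:
  assumes w: "weights {..<N} p"
    and good: "\<And>a. (\<And>j. j < m \<Longrightarrow> a j < N) \<Longrightarrow> \<not> Q (map a (rev [0..<m])) \<Longrightarrow> (\<lambda>j. if a j < N then v (a j) else 0\<^sub>v n) \<in> S"
  shows "1 - expect {..<N} p m (\<lambda>xs. if Q xs then 1 else 0) \<le> measure_pmf.prob (design_sample_pmf n m N p v) S"
proof -
  define q where "q = embed_pmf (\<lambda>i. if i < N then p i else 0)"
  define v' where "v' i = (if i < N then v i else 0\<^sub>v n)" for i
  let ?P = "Pi_pmf {..<m} N (\<lambda>_. q)"
  have sub: "set_pmf q \<subseteq> {..<N}" unfolding q_def by (rule expect_design_pmf(2)[OF w])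
  have "map_pmf v q = map_pmf v' q" using sub by (intro map_pmf_cong) (auto simp: v'_def)
  then have "design_sample_pmf n m N p v = Pi_pmf {..<m} (v' N) (\<lambda>_. map_pmf v' q)"
    by (simp add: design_sample_pmf_def design_pmf_def q_def v'_def)
  also have "\<dots> = map_pmf (\<lambda>a. v' \<circ> a) ?P" by (intro Pi_pmf_map) auto
  finally have eq: "design_sample_pmf n m N p v = map_pmf (\<lambda>a. v' \<circ> a) ?P" .
  let ?B = "{a. Q (map a (rev [0..<m]))}"
  have "1 - measure_pmf.prob ?P ?B = measure_pmf.prob ?P (UNIV - ?B)"
    using measure_pmf.prob_compl[of ?B ?P] by simp
  also have "\<dots> \<le> measure_pmf.prob ?P ((\<lambda>a. v' \<circ> a) -` S)"
  proof (rule measure_pmf.finite_measure_mono_AE)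
    show "AE a in measure_pmf ?P. a \<in> UNIV - ?B \<longrightarrow> a \<in> (\<lambda>a. v' \<circ> a) -` S"
    proof (rule AE_pmfI, rule impI)
      fix a assume a: "a \<in> set_pmf ?P" "a \<in> UNIV - ?B"
      have "a j < N" if "j < m" for j
        using a(1) sub that set_Pi_pmf[of "{..<m}" N "\<lambda>_. q"] by (auto simp: PiE_dflt_def)
      then have "(\<lambda>j. if a j < N then v (a j) else 0\<^sub>v n) \<in> S" using a(2) by (intro good) auto
      then show "a \<in> (\<lambda>a. v' \<circ> a) -` S" by (simp add: v'_def comp_def)
    qed
  qed simp
  finally have "1 - measure_pmf.prob ?P ?B \<le> measure_pmf.prob (design_sample_pmf n m N p v) S"
    unfolding eq by (simp add: measure_map_pmf)
  moreover have "measure_pmf.prob ?P ?B = expect {..<N} p m (\<lambda>xs. if Q xs then 1 else 0)"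
  proof -
    have "measure_pmf.prob ?P ?B = measure_pmf.expectation ?P (\<lambda>a. indicat_real ?B a)" by simp
    also have "\<dots> = measure_pmf.expectation ?P (\<lambda>a. if Q (map a (rev [0..<m])) then 1 else 0)"
      by (intro Bochner_Integration.integral_cong refl) (auto simp: indicator_def)
    also have "\<dots> = expect {..<N} p m (\<lambda>xs. if Q xs then 1 else 0)"
      unfolding q_def by (rule expect_design_pmf(1)[OF w, of m N "\<lambda>xs. if Q xs then 1 else 0"])
    finally show ?thesis .
  qed
  ultimately show ?thesis by simp
qed

section \<open>The empirical process over the cone\<close>

lemma abs_min_1_lipschitz: "\<bar>- min \<bar>a\<bar> 1 - (- min \<bar>b\<bar> 1)\<bar> \<le> \<bar>a - b :: real\<bar>"
  by (auto simp: min_def)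

lemma sum_list_zip_nth:
  assumes "length ss = length xs"
  shows "(\<Sum>(s, x)\<leftarrow>zip ss xs. f s x) = (\<Sum>j<length xs. f (ss ! j) (xs ! j))"
  using assms by (simp add: sum_list_sum_nth atLeast0LessThan)

definition outer :: "real \<Rightarrow> (nat \<Rightarrow> complex) \<Rightarrow> nat \<Rightarrow> nat \<Rightarrow> complex" where
  "outer c v i j = complex_of_real c * (v i * cnj (v j))"

lemma outer_herm: "herm n (outer c v)"
  unfolding herm_def outer_def by simp

lemma bform_outer: "bform n (outer c v) x y = complex_of_real c * (ip n x v * ip n v y)"
  unfolding bform_def outer_def ip_def sum_product unfolding sum_distrib_left by (intro sum.cong refl) (simp add: mult_ac)

lemma qf_outer: "qf n (outer c v) x = c * (cmod (ip n v x))\<^sup>2"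
  unfolding bform_outer ip_cnj[of n v x, symmetric] cnj_mult_self by simp

lemma trace_prod_outer: "trace_prod n (outer c v) Z = complex_of_real c * bform n Z v v"
proof -
  have "trace_prod n (outer c v) Z = (\<Sum>i<n. \<Sum>j<n. complex_of_real c * (cnj (v j) * Z j i * v i))"
    unfolding trace_prod_def outer_def by (intro sum.cong refl) (simp add: mult_ac)
  also have "\<dots> = (\<Sum>j<n. \<Sum>i<n. complex_of_real c * (cnj (v j) * Z j i * v i))" by (rule sum.swap)
  finally show ?thesis by (simp add: bform_def sum_distrib_left)
qed

lemma trace_prod_signed_sum: "trace_prod n (signed_sum m A ss) Z = (\<Sum>a<m. complex_of_real (ss ! a) * trace_prod n (A a) Z)"
proof -
  have "trace_prod n (signed_sum m A ss) Z = (\<Sum>i<n. \<Sum>j<n. \<Sum>a<m. complex_of_real (ss ! a) * (A a i j * Z j i))"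
    unfolding trace_prod_def signed_sum_def by (simp add: sum_distrib_right mult.assoc)
  also have "\<dots> = (\<Sum>a<m. \<Sum>i<n. \<Sum>j<n. complex_of_real (ss ! a) * (A a i j * Z j i))"
    by (simp only: sum.swap[of _ "{..<m}" "{..<n}"])
  finally show ?thesis by (simp add: trace_prod_def sum_distrib_left)
qed

lemma mat_app_outer: "sqn n (mat_app n (outer c v) x) = c\<^sup>2 * (cmod (ip n v x))\<^sup>2 * sqn n v"
proof -
  have "mat_app n (outer c v) x i = (complex_of_real c * ip n v x) * v i" for i
    unfolding mat_app_def outer_def ip_def sum_distrib_left sum_distrib_right by (intro sum.cong refl) (simp add: mult_ac)
  then show ?thesis by (simp add: sqn_def norm_mult power_mult_distrib sum_distrib_left mult.assoc)
qed

section \<open>Sampling from a nearly tight frame\<close>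

text \<open>\<open>P\<close> is the moment order for the Khintchine inequality, later chosen
  logarithmic in \<open>n\<close> by \<open>exponent_exists\<close>.\<close>

locale frame_sampling =
  fixes n N m P :: nat and p :: "nat \<Rightarrow> real" and v :: "nat \<Rightarrow> nat \<Rightarrow> complex"
  assumes n2: "2 \<le> n" and m0: "0 < m" and P: "0 < P" "real n \<le> 3 ^ P"
    and w: "weights {..<N} p" and unit: "\<And>i. i < N \<Longrightarrow> sqn n (v i) = 1"
    and frame: "\<And>x. sqn n x = 1 \<Longrightarrow> (\<Sum>i<N. p i * (cmod (ip n (v i) x))\<^sup>2) \<le> 2 / real n"
begin

definition c :: real where "c = sqrt (real n * (real n + 1))"

text \<open>Collects the constants of \<open>khintchine_norm\<close>: the outer factor 2 enters the
  square root as 4, and 24 is 4 times 6.\<close>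

definition D :: real where "D = 24 * real P * c"

lemma c_bounds: "0 < c" "c \<le> 2 * real n" "c * (2 / real n) \<le> 3"
proof -
  show "0 < c" using n2 by (simp add: c_def)
  have "c \<le> 3 / 2 * real n"
    unfolding c_def
  proof (rule real_le_lsqrt)
    have "1 \<le> real n" using n2 by simp
    then show "real n * (real n + 1) \<le> (3 / 2 * real n)\<^sup>2"
    proof -
      have "2 * real n \<le> real n * real n" using n2 by (intro mult_right_mono) auto
      then show ?thesis by (simp add: power2_eq_square algebra_simps)
    qed
  qed (use n2 in auto)
  then show "c \<le> 2 * real n" "c * (2 / real n) \<le> 3" using n2 by (auto simp: field_simps)
qed

lemma D_pos: "0 < D"
  using P c_bounds by (simp add: D_def)

text \<open>The spectral norm of the sum of the sampled measurement matrices, written as the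
  supremum of a positive form over the unit sphere.\<close>

definition frame_norm :: "nat list \<Rightarrow> real" where
  "frame_norm xs = (SUP x\<in>{x. sqn n x = 1}. \<Sum>i\<leftarrow>xs. c * (cmod (ip n (v i) x))\<^sup>2)"

lemma sphere_nonempty: "{x. sqn n x = 1} \<noteq> {}"
  using onb_sqn1[OF onb_std[of n], of 0] n2 by auto

lemma frame_term_le:
  assumes "i < N" "sqn n x = 1" shows "c * (cmod (ip n (v i) x))\<^sup>2 \<le> c"
  using cauchy_ip[of n "v i" x] unit[OF assms(1)] assms(2) c_bounds by (simp add: mult_left_le)

lemma frame_term_bdd: "i < N \<Longrightarrow> bdd_on {x. sqn n x = 1} (\<lambda>x. c * (cmod (ip n (v i) x))\<^sup>2)"
  unfolding bdd_on_def using frame_term_le c_bounds by (intro exI[of _ c]) auto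

lemma le_frame_norm:
  assumes "set xs \<subseteq> {..<N}" "sqn n x = 1"
  shows "(\<Sum>i\<leftarrow>xs. c * (cmod (ip n (v i) x))\<^sup>2) \<le> frame_norm xs"
  unfolding frame_norm_def using assms by (intro SUP_upper bdd_on_sum_list frame_term_bdd) auto

lemma frame_norm_nonneg: "set xs \<subseteq> {..<N} \<Longrightarrow> 0 \<le> frame_norm xs"
proof -
  assume xs: "set xs \<subseteq> {..<N}"
  obtain x where x: "sqn n x = 1" using sphere_nonempty by blast
  have "0 \<le> (\<Sum>i\<leftarrow>xs. c * (cmod (ip n (v i) x))\<^sup>2)" using c_bounds by (intro sum_list_nonneg) auto
  also have "\<dots> \<le> frame_norm xs" by (rule le_frame_norm[OF xs x])
  finally show ?thesis .
qed

definition mats :: "nat list \<Rightarrow> nat \<Rightarrow> nat \<Rightarrow> nat \<Rightarrow> complex" where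
  "mats xs j = outer c (v (xs ! j))"

text \<open>Unit vectors make the square of each measurement matrix \<open>c\<close> times the
  matrix itself, so the variance in the Khintchine inequality is \<open>c\<close> times the norm of
  the plain sum. This self-reference is what Rudelson's argument exploits. The summand 1 keeps the
  variance positive.\<close>

lemma sign_average_le:
  assumes xs: "length xs = m" "set xs \<subseteq> {..<N}"
    and B: "\<And>ss U L b. length ss = m \<Longrightarrow> eigsys n (signed_sum m (mats xs) ss) U L \<Longrightarrow> (\<And>k. k < n \<Longrightarrow> \<bar>L k\<bar> \<le> b) \<Longrightarrow> B ss \<le> K * b"
    and K: "0 \<le> K"
  shows "sign_avg m B \<le> K * sqrt (D * (frame_norm xs + 1))"
proof -
  have herm: "herm n (mats xs a)" for a unfolding mats_def by (rule outer_herm)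
  have "\<forall>ss. \<exists>u l. eigsys n (signed_sum m (mats xs) ss) u l"
    by (intro allI spectral_theorem signed_sum_herm herm)
  then obtain U where "\<forall>ss. \<exists>l. eigsys n (signed_sum m (mats xs) ss) (U ss) l" by (rule choice[THEN exE])
  then obtain L where "\<forall>ss. eigsys n (signed_sum m (mats xs) ss) (U ss) (L ss)" by (rule choice[THEN exE])
  then have UL: "\<And>ss. eigsys n (signed_sum m (mats xs) ss) (U ss) (L ss)" by simp
  \<comment> \<open>\<open>khintchine_norm\<close> quantifies over sign lists of every length, so
    the quantity is set to 0 where the length is not \<open>m\<close>.\<close>
  define B' where "B' ss = (if length ss = m then B ss else 0)" for ss
  have "sign_avg m B = sign_avg m B'" by (rule expect_cong[OF weights_sign]) (simp add: B'_def)
  also have "\<dots> \<le> 2 * K * sqrt (6 * real P * (c * (frame_norm xs + 1)))"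
  proof (rule khintchine_norm[OF herm UL _ _ P _ K])
    show "0 < c * (frame_norm xs + 1)" using c_bounds frame_norm_nonneg[OF xs(2)] by simp
    fix x assume x: "sqn n x = 1"
    have "(\<Sum>a<m. sqn n (mat_app n (mats xs a) x)) = (\<Sum>a<m. c * (c * (cmod (ip n (v (xs ! a)) x))\<^sup>2))"
      using xs unit nth_mem[of _ xs] unfolding mats_def mat_app_outer
      by (intro sum.cong refl) (auto simp: power2_eq_square[of c] mult.assoc subset_eq)
    also have "\<dots> = c * (\<Sum>i\<leftarrow>xs. c * (cmod (ip n (v i) x))\<^sup>2)"
      using xs by (simp add: sum_list_sum_nth atLeast0LessThan sum_distrib_left)
    also have "\<dots> \<le> c * (frame_norm xs + 1)" using le_frame_norm[OF xs(2) x] c_bounds by (intro mult_left_mono) auto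
    finally show "(\<Sum>a<m. sqn n (mat_app n (mats xs a) x)) \<le> c * (frame_norm xs + 1)" .
  next
    fix ss b assume b: "\<And>k. k < n \<Longrightarrow> \<bar>L ss k\<bar> \<le> b"
    have "0 \<le> \<bar>L ss 0\<bar>" by simp
    also have "\<dots> \<le> b" using b n2 by auto
    finally have "0 \<le> K * b" using K by simp
    then show "B' ss \<le> K * b" using B[OF _ UL b] by (simp add: B'_def)
  qed
  also have "\<dots> = K * (sqrt 4 * sqrt (6 * real P * (c * (frame_norm xs + 1))))" by simp
  also have "\<dots> = K * sqrt (D * (frame_norm xs + 1))"
    unfolding real_sqrt_mult[symmetric] by (simp add: D_def mult_ac)
  finally show ?thesis .
qed

lemma am_gm_sqrt:
  assumes "0 \<le> a" "0 \<le> b" "0 < k" shows "sqrt (a * b) \<le> (k * b + a / k) / (2 :: real)"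
proof -
  have "sqrt (a * b) = sqrt ((k * b) * (a / k))" using assms by simp
  also have "\<dots> \<le> (k * b + a / k) / 2" using assms by (intro arith_geo_mean_sqrt) auto
  finally show ?thesis .
qed

text \<open>Linearises the square root with a free parameter \<open>k\<close>, so that the
  expectation passes through without Jensen's inequality.\<close>

lemma sqrt_D_le: "set xs \<subseteq> {..<N} \<Longrightarrow> 0 < k \<Longrightarrow> sqrt (D * (frame_norm xs + 1)) \<le> (k * (frame_norm xs + 1) + D / k) / 2"
  using D_pos frame_norm_nonneg[of xs] by (intro am_gm_sqrt) auto

text \<open>The mean contributes at most 3 per sample. Symmetrisation and Khintchine bound the
  deviation by a square root of \<open>frame_norm\<close> itself; the parameter \<open>1 / 2\<close>
  leaves half of the unknown expectation on the right, to be absorbed on the left.\<close>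

lemma expected_frame_norm: "expect {..<N} p m frame_norm \<le> 6 * real m + 1 + 4 * D"
proof -
  let ?S = "{x. sqn n x = 1}"
  let ?g = "\<lambda>x i. c * (cmod (ip n (v i) x))\<^sup>2"
  let ?dev = "\<lambda>xs. SUP x\<in>?S. (\<Sum>i\<leftarrow>xs. ?g x i) - real m * (\<Sum>i<N. p i * ?g x i)"
  have mean: "(\<Sum>i<N. p i * ?g x i) \<le> 3" "0 \<le> (\<Sum>i<N. p i * ?g x i)" if x: "sqn n x = 1" for x
  proof -
    have "(\<Sum>i<N. p i * ?g x i) = c * (\<Sum>i<N. p i * (cmod (ip n (v i) x))\<^sup>2)" by (simp add: sum_distrib_left mult_ac)
    also have "\<dots> \<le> c * (2 / real n)" using frame[OF x] c_bounds by (intro mult_left_mono) auto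
    finally show "(\<Sum>i<N. p i * ?g x i) \<le> 3" using c_bounds by linarith
    show "0 \<le> (\<Sum>i<N. p i * ?g x i)" using w c_bounds by (intro sum_nonneg) (auto simp: weights_def)
  qed
  have mean_bdd: "bdd_on ?S (\<lambda>x. real m * (\<Sum>i<N. p i * ?g x i))"
    using mean by (intro bdd_on_cmult) (auto simp: bdd_on_def intro!: exI[of _ 3])
  have "expect {..<N} p m frame_norm \<le> expect {..<N} p m (\<lambda>xs. 3 * real m + ?dev xs)"
  proof (rule expect_mono[OF w])
    fix xs assume xs: "length xs = m" "set xs \<subseteq> {..<N}"
    show "frame_norm xs \<le> 3 * real m + ?dev xs"
      unfolding frame_norm_def
    proof (rule SUP_le[OF sphere_nonempty])
      fix x assume x: "x \<in> ?S"
      have "(\<Sum>i\<leftarrow>xs. ?g x i) - real m * (\<Sum>i<N. p i * ?g x i) \<le> ?dev xs"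
        using xs x mean_bdd by (intro SUP_upper bdd_on_diff bdd_on_sum_list frame_term_bdd) auto
      moreover have "real m * (\<Sum>i<N. p i * ?g x i) \<le> real m * 3" using mean x by (intro mult_left_mono) auto
      ultimately show "(\<Sum>i\<leftarrow>xs. ?g x i) \<le> 3 * real m + ?dev xs" by simp
    qed
  qed
  also have "\<dots> = 3 * real m + expect {..<N} p m ?dev" by (simp only: expect_add expect_const[OF w])
  also have "expect {..<N} p m ?dev \<le> 2 * expect {..<N} p m (\<lambda>xs. sign_avg m (\<lambda>ss. SUP x\<in>?S. \<Sum>(s, i)\<leftarrow>zip ss xs. s * ?g x i))"
    by (rule symmetrization[OF w sphere_nonempty]) (use frame_term_bdd in auto)
  also have "expect {..<N} p m (\<lambda>xs. sign_avg m (\<lambda>ss. SUP x\<in>?S. \<Sum>(s, i)\<leftarrow>zip ss xs. s * ?g x i)) \<le> expect {..<N} p m (\<lambda>xs. (1 / 2 * (frame_norm xs + 1) + D / (1 / 2)) / 2)"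
  proof (rule expect_mono[OF w])
    fix xs assume xs: "length xs = m" "set xs \<subseteq> {..<N}"
    have "sign_avg m (\<lambda>ss. SUP x\<in>?S. \<Sum>(s, i)\<leftarrow>zip ss xs. s * ?g x i) \<le> 1 * sqrt (D * (frame_norm xs + 1))"
    proof (rule sign_average_le[OF xs])
      fix ss U L b assume ss: "length (ss :: real list) = m" and S: "eigsys n (signed_sum m (mats xs) ss) U L" and b: "\<And>k. k < n \<Longrightarrow> \<bar>L k\<bar> \<le> b"
      show "(SUP x\<in>?S. \<Sum>(s, i)\<leftarrow>zip ss xs. s * ?g x i) \<le> 1 * b"
      proof (rule SUP_le[OF sphere_nonempty])
        fix x assume x: "x \<in> ?S"
        have "(\<Sum>(s, i)\<leftarrow>zip ss xs. s * ?g x i) = (\<Sum>j<m. ss ! j * ?g x (xs ! j))"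
          using ss xs by (subst sum_list_zip_nth) auto
        also have "\<dots> = qf n (signed_sum m (mats xs) ss) x"
          unfolding bform_signed_sum by (simp add: mats_def qf_outer)
        also have "\<dots> \<le> b * sqn n x" using eigsys_qf_bound[OF S b, of x] by linarith
        finally show "(\<Sum>(s, i)\<leftarrow>zip ss xs. s * ?g x i) \<le> 1 * b" using x by simp
      qed
    qed simp
    also have "\<dots> \<le> (1 / 2 * (frame_norm xs + 1) + D / (1 / 2)) / 2" using sqrt_D_le[OF xs(2), of "1 / 2"] by simp
    finally show "sign_avg m (\<lambda>ss. SUP x\<in>?S. \<Sum>(s, i)\<leftarrow>zip ss xs. s * ?g x i) \<le> \<dots>" .
  qed
  also have "expect {..<N} p m (\<lambda>xs. (1 / 2 * (frame_norm xs + 1) + D / (1 / 2)) / 2) = (1 / 2 * (expect {..<N} p m frame_norm + 1) + D / (1 / 2)) / 2"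
    by (simp only: expect_divide expect_add expect_cmult expect_const[OF w])
  finally have "expect {..<N} p m frame_norm \<le> 3 * real m + 2 * ((1 / 2 * (expect {..<N} p m frame_norm + 1) + D / (1 / 2)) / 2)" by simp
  then show ?thesis by (simp add: field_simps)
qed

lemma cone_term_le:
  assumes "Z \<in> cone n r" "i < N" shows "\<bar>c * qf n Z (v i)\<bar> \<le> c"
proof -
  obtain u l where Z: "eigsys n Z u l" "(\<Sum>k<n. (l k)\<^sup>2) = 1" using assms(1) by (auto simp: cone_def)
  have "\<bar>qf n Z (v i)\<bar> \<le> 1 * sqn n (v i)"
    using power_sum_bounds(1)[of _ n l] Z(2) by (intro eigsys_qf_bound[OF Z(1)]) simp
  then show ?thesis using unit[OF assms(2)] c_bounds by (simp add: abs_mult mult_left_le)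
qed

lemma cone_nonempty: "1 \<le> r \<Longrightarrow> cone n r \<noteq> {}"
proof -
  assume r: "1 \<le> r"
  let ?l = "\<lambda>k. if k = 0 then 1 else 0 :: real"
  have s: "(\<Sum>k<n. (?l k)\<^sup>2) = 1" "(\<Sum>k<n. \<bar>?l k\<bar>) = 1"
    using n2 by (simp_all add: if_distrib[of "\<lambda>x. x\<^sup>2"] if_distrib[of abs] cong: if_cong)
  have "(\<Sum>k<n. \<bar>?l k\<bar>)\<^sup>2 \<le> 6 * real r" unfolding s(2) using r by simp
  then have "eig_mat n (\<lambda>k i. if i = k then 1 else 0) ?l \<in> cone n r"
    unfolding cone_def using eigsys_eig_mat[OF onb_std, of n ?l] s(1) by blast
  then show ?thesis by blast
qed

text \<open>The minus signs turn the lower tail of the truncated empirical means into a supremum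
  that symmetrisation, contraction and bounded differences bound from above.\<close>

definition dev :: "nat \<Rightarrow> nat list \<Rightarrow> real" where
  "dev r xs = (SUP Z\<in>cone n r. (\<Sum>i\<leftarrow>xs. - min \<bar>c * qf n Z (v i)\<bar> 1) - real m * (\<Sum>i<N. p i * - min \<bar>c * qf n Z (v i)\<bar> 1))"

lemma min_bdd: "bdd_on (cone n r) (\<lambda>Z. - min \<bar>c * qf n Z (v i)\<bar> 1)"
  unfolding bdd_on_def by (intro exI[of _ 1]) auto

lemma mean_bdd: "bdd_on (cone n r) (\<lambda>Z. real m * (\<Sum>i<N. p i * - min \<bar>c * qf n Z (v i)\<bar> 1))"
proof -
  have "\<bar>\<Sum>i<N. p i * - min \<bar>c * qf n Z (v i)\<bar> 1\<bar> \<le> 1" for Z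
  proof -
    have "\<bar>\<Sum>i<N. p i * - min \<bar>c * qf n Z (v i)\<bar> 1\<bar> \<le> (\<Sum>i<N. p i * 1)"
      using w by (intro order_trans[OF sum_abs] sum_mono) (auto simp: abs_mult weights_def intro!: mult_left_le)
    then show ?thesis using w by (simp add: weights_def)
  qed
  then show ?thesis by (intro bdd_on_cmult) (auto simp: bdd_on_def)
qed

text \<open>Contraction removes the truncation. Duality then bounds the supremum over the cone by
  \<open>K\<close> times the spectral norm of the Rademacher sum, \<open>K\<close> being the largest
  nuclear norm that the cone condition allows.\<close>

lemma expected_dev:
  assumes r: "1 \<le> r" and \<delta>: "0 < \<delta>" "\<delta> \<le> 1" and D: "240 * real r * D \<le> \<delta>\<^sup>2 * real m"
  shows "expect {..<N} p m (dev r) \<le> \<delta> * real m"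
proof -
  let ?G = "cone n r"
  let ?h = "\<lambda>Z i. c * qf n Z (v i)"
  let ?\<phi> = "\<lambda>a :: real. - min \<bar>a\<bar> 1"
  define K where "K = sqrt (6 * real r)"
  have K: "0 < K" "K\<^sup>2 = 6 * real r" "1 \<le> K" using r by (simp_all add: K_def)
  \<comment> \<open>Balances the two terms of the bound: with the expected norm at most
    \<open>10 * m\<close>, the first term is exactly \<open>\<delta> / 2 * m\<close>, and the
    hypothesis on \<open>D\<close> is what brings the second below the same value.\<close>
  define k where "k = \<delta> / (20 * K)"
  have k: "0 < k" using \<delta> K by (simp add: k_def)
  have "expect {..<N} p m (dev r) \<le> 2 * expect {..<N} p m (\<lambda>xs. sign_avg m (\<lambda>ss. SUP Z\<in>?G. \<Sum>(s, i)\<leftarrow>zip ss xs. s * ?\<phi> (?h Z i)))"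
    unfolding dev_def by (rule symmetrization[OF w cone_nonempty[OF r] min_bdd])
  also have "\<dots> \<le> 2 * expect {..<N} p m (\<lambda>xs. K * ((k * (frame_norm xs + 1) + D / k) / 2))"
  proof (intro mult_left_mono expect_mono[OF w])
    fix xs assume xs: "length xs = m" "set xs \<subseteq> {..<N}"
    have "sign_avg m (\<lambda>ss. SUP Z\<in>?G. \<Sum>(s, i)\<leftarrow>zip ss xs. s * ?\<phi> (?h Z i)) \<le> sign_avg m (\<lambda>ss. SUP Z\<in>?G. \<Sum>(s, i)\<leftarrow>zip ss xs. s * ?h Z i)"
    proof -
      have "bdd_on ?G (\<lambda>Z. ?h Z i)" if "i \<in> set xs" for i
        using cone_term_le that xs unfolding bdd_on_def by blast
      then have "sign_avg (length xs) (\<lambda>ss. SUP Z\<in>?G. 0 + (\<Sum>(s, i)\<leftarrow>zip ss xs. s * ?\<phi> (?h Z i))) \<le> sign_avg (length xs) (\<lambda>ss. SUP Z\<in>?G. 0 + (\<Sum>(s, i)\<leftarrow>zip ss xs. s * ?h Z i))"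
        by (intro contraction[OF cone_nonempty[OF r] abs_min_1_lipschitz] bdd_on_const)
      then show ?thesis using xs by simp
    qed
    also have "\<dots> \<le> K * sqrt (D * (frame_norm xs + 1))"
    proof (rule sign_average_le[OF xs])
      fix ss U L b assume ss: "length (ss :: real list) = m" and S: "eigsys n (signed_sum m (mats xs) ss) U L" and b: "\<And>k. k < n \<Longrightarrow> \<bar>L k\<bar> \<le> b"
      have b0: "0 \<le> b" using b[of 0] n2 by simp
      show "(SUP Z\<in>?G. \<Sum>(s, i)\<leftarrow>zip ss xs. s * ?h Z i) \<le> K * b"
      proof (rule SUP_le[OF cone_nonempty[OF r]])
        fix Z assume "Z \<in> ?G"
        then obtain u l where Z: "eigsys n Z u l" and l: "(\<Sum>k<n. \<bar>l k\<bar>)\<^sup>2 \<le> 6 * real r" by (auto simp: cone_def)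
        let ?H = "signed_sum m (mats xs) ss"
        have "(\<Sum>(s, i)\<leftarrow>zip ss xs. s * ?h Z i) = (\<Sum>j<m. ss ! j * ?h Z (xs ! j))"
          using ss xs by (subst sum_list_zip_nth) auto
        also have "\<dots> = Re (trace_prod n ?H Z)" unfolding trace_prod_signed_sum by (simp add: mats_def trace_prod_outer)
        also have "\<dots> = (\<Sum>k<n. l k * qf n ?H (u k))" by (rule Re_tp_eigsys[OF Z])
        also have "\<dots> \<le> (\<Sum>k<n. \<bar>l k\<bar> * b)"
        proof (rule sum_mono)
          fix k assume "k \<in> {..<n}"
          then have "\<bar>qf n ?H (u k)\<bar> \<le> b" using eigsys_qf_bound[OF S b, of "u k"] onb_sqn1[OF eigsys_onb[OF Z]] by simp
          then have "\<bar>l k * qf n ?H (u k)\<bar> \<le> \<bar>l k\<bar> * b" unfolding abs_mult by (intro mult_left_mono) auto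
          then show "l k * qf n ?H (u k) \<le> \<bar>l k\<bar> * b" by linarith
        qed
        also have "\<dots> = (\<Sum>k<n. \<bar>l k\<bar>) * b" by (simp add: sum_distrib_right)
        also have "\<dots> \<le> K * b" using l b0 unfolding K_def by (intro mult_right_mono real_le_rsqrt)
        finally show "(\<Sum>(s, i)\<leftarrow>zip ss xs. s * ?h Z i) \<le> K * b" .
      qed
    qed (use K in simp)
    also have "\<dots> \<le> K * ((k * (frame_norm xs + 1) + D / k) / 2)" using K k xs by (intro mult_left_mono sqrt_D_le) auto
    finally show "sign_avg m (\<lambda>ss. SUP Z\<in>?G. \<Sum>(s, i)\<leftarrow>zip ss xs. s * ?\<phi> (?h Z i)) \<le> \<dots>" .
  qed simp
  also have "\<dots> = K * (k * (expect {..<N} p m frame_norm + 1) + D / k)"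
    by (simp only: expect_cmult expect_divide expect_add expect_const[OF w]) simp
  also have "\<dots> \<le> K * (k * (10 * real m) + D / k)"
  proof -
    have "240 * D \<le> 240 * real r * D" using r D_pos by simp
    also have "\<dots> \<le> 1 * real m" using D \<delta> by (intro order_trans[OF D] mult_right_mono) (auto simp: power_le_one)
    finally have "240 * D \<le> real m" by simp
    moreover have "1 \<le> real m" using m0 by simp
    ultimately have "expect {..<N} p m frame_norm + 1 \<le> 10 * real m" using expected_frame_norm by linarith
    then show ?thesis using K k by (intro mult_left_mono add_mono) auto
  qed
  also have "\<dots> = \<delta> / 2 * real m + 20 * K\<^sup>2 * D / \<delta>"
    using K \<delta> by (simp add: k_def power2_eq_square field_simps)
  also have "\<dots> \<le> \<delta> * real m"
  proof -
    have "20 * K\<^sup>2 * D \<le> \<delta>\<^sup>2 * real m / 2" using D unfolding K(2) by simp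
    then have "20 * K\<^sup>2 * D / \<delta> \<le> \<delta>\<^sup>2 * real m / 2 / \<delta>" using \<delta> by (intro divide_right_mono) auto
    also have "\<dots> = \<delta> * real m / 2" using \<delta> by (simp add: power2_eq_square)
    finally show ?thesis by simp
  qed
  finally show ?thesis .
qed

text \<open>Truncation confines each summand to an interval of length 1. This holds for indices of
  any size, the generality in which \<open>bounded_differences_tail\<close> asks for it.\<close>

lemma dev_bounded_difference:
  assumes r: "1 \<le> r" shows "\<bar>dev r (as @ i # bs) - dev r (as @ j # bs)\<bar> \<le> 1"
proof -
  let ?G = "cone n r"
  let ?\<phi> = "\<lambda>Z i. - min \<bar>c * qf n Z (v i)\<bar> 1"
  have "dev r (as @ i # bs) \<le> dev r (as @ j # bs) + 1" for i j
    unfolding dev_def[of r "as @ i # bs"]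
  proof (rule SUP_le[OF cone_nonempty[OF r]])
    fix Z assume Z: "Z \<in> ?G"
    have "(\<Sum>i\<leftarrow>as @ j # bs. ?\<phi> Z i) - real m * (\<Sum>i<N. p i * ?\<phi> Z i) \<le> dev r (as @ j # bs)"
      unfolding dev_def by (intro SUP_upper[OF _ Z] bdd_on_diff bdd_on_sum_list min_bdd mean_bdd)
    moreover have "?\<phi> Z i \<le> ?\<phi> Z j + 1" by (auto simp: min_def)
    ultimately show "(\<Sum>i\<leftarrow>as @ i # bs. ?\<phi> Z i) - real m * (\<Sum>i<N. p i * ?\<phi> Z i) \<le> dev r (as @ j # bs) + 1" by simp
  qed
  then show ?thesis by (simp add: abs_le_iff diff_le_eq add.commute)
qed

text \<open>The truncated value is at most the absolute value, and Cauchy-Schwarz passes from the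
  sum of truncated values to the sum of squares at the cost of a factor \<open>m\<close>.\<close>

lemma cone_lower_bound:
  assumes Z: "Z \<in> cone n r" and mean: "\<beta> \<le> (\<Sum>i<N. p i * min \<bar>c * qf n Z (v i)\<bar> 1)" and \<beta>: "0 \<le> \<beta>"
    and xs: "length xs = m" and dev: "dev r xs \<le> \<beta> / 2 * real m"
  shows "real m * (\<beta> / 2)\<^sup>2 \<le> (\<Sum>i\<leftarrow>xs. (c * qf n Z (v i))\<^sup>2)"
proof -
  let ?\<psi> = "\<lambda>i. min \<bar>c * qf n Z (v i)\<bar> 1"
  have "(\<Sum>i\<leftarrow>xs. - ?\<psi> i) - real m * (\<Sum>i<N. p i * - ?\<psi> i) \<le> dev r xs"
    unfolding dev_def by (intro SUP_upper[OF _ Z] bdd_on_diff bdd_on_sum_list min_bdd mean_bdd)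
  moreover have "(\<Sum>i\<leftarrow>xs. - ?\<psi> i) = - (\<Sum>i\<leftarrow>xs. ?\<psi> i)" by (simp add: uminus_sum_list_map comp_def)
  moreover have "(\<Sum>i<N. p i * - ?\<psi> i) = - (\<Sum>i<N. p i * ?\<psi> i)" by (simp add: sum_negf)
  moreover have "real m * \<beta> \<le> real m * (\<Sum>i<N. p i * ?\<psi> i)" using mean by (intro mult_left_mono) auto
  ultimately have "real m * (\<beta> / 2) \<le> (\<Sum>i\<leftarrow>xs. ?\<psi> i)" using dev by (simp add: algebra_simps)
  then have "(real m * (\<beta> / 2))\<^sup>2 \<le> (\<Sum>i\<leftarrow>xs. ?\<psi> i)\<^sup>2" using \<beta> by (intro power_mono) auto
  also have "\<dots> = (\<Sum>j<m. ?\<psi> (xs ! j) * 1)\<^sup>2" using xs by (simp add: sum_list_sum_nth atLeast0LessThan)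
  also have "\<dots> \<le> (\<Sum>j<m. (?\<psi> (xs ! j))\<^sup>2) * (\<Sum>j<m. 1\<^sup>2)" by (rule Cauchy_Schwarz_ineq_sum)
  also have "\<dots> \<le> (\<Sum>j<m. (c * qf n Z (v (xs ! j)))\<^sup>2) * real m"
  proof -
    have "(?\<psi> i)\<^sup>2 \<le> (c * qf n Z (v i))\<^sup>2" for i
      unfolding power2_abs[of "c * qf n Z (v i)", symmetric] by (intro power_mono) auto
    then show ?thesis by (auto intro!: mult_right_mono sum_mono)
  qed
  also have "(\<Sum>j<m. (c * qf n Z (v (xs ! j)))\<^sup>2) = (\<Sum>i\<leftarrow>xs. (c * qf n Z (v i))\<^sup>2)"
    using xs by (simp add: sum_list_sum_nth atLeast0LessThan)
  finally have "real m * (real m * (\<beta> / 2)\<^sup>2) \<le> real m * (\<Sum>i\<leftarrow>xs. (c * qf n Z (v i))\<^sup>2)"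
    by (simp add: power2_eq_square mult_ac)
  then show ?thesis using m0 by simp
qed

end

text \<open>Rounds the logarithm up and uses that e is at most 3. For \<open>n \<ge> 2\<close> the
  logarithm is at least 1/2, so rounding at most triples it.\<close>

lemma exponent_exists:
  assumes n: "2 \<le> n"
  obtains P where "0 < P" "real n \<le> 3 ^ P" "real P \<le> 3 * ln (real n)"
proof
  define P where "P = nat \<lceil>ln (real n)\<rceil>"
  have ln2: "1 / 2 \<le> ln (real n)"
  proof -
    have "1 / 2 \<le> ln (2 :: real)" using ln_le_minus_one[of "1 / 2"] by (simp add: ln_div)
    also have "\<dots> \<le> ln (real n)" using n by simp
    finally show ?thesis .
  qed
  have P1: "ln (real n) \<le> real P" using ln2 by (simp add: P_def)
  then show "0 < P" using ln2 by (cases P) auto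
  show "real P \<le> 3 * ln (real n)" using ln2 unfolding P_def by linarith
  have "real n = exp (ln (real n))" using n by simp
  also have "\<dots> \<le> exp (real P)" using P1 by simp
  also have "\<dots> = exp 1 ^ P" by (simp flip: exp_of_nat_mult)
  also have "\<dots> \<le> 3 ^ P" by (intro power_mono exp_le) auto
  finally show "real n \<le> 3 ^ P" .
qed

theorem theorem5:
  shows "\<exists>C4 C5 C6 :: real. C4 > 0 \<and> C5 > 0 \<and> C6 > 0 \<and>
    (\<forall>(n::nat) (r::nat) (N::nat) (p :: nat \<Rightarrow> real) (w :: nat \<Rightarrow> complex vec) (m::nat).
       n \<ge> 2 \<longrightarrow> 1 \<le> r \<longrightarrow> r \<le> n \<longrightarrow>
       weighted_unit_vectors n N p w \<longrightarrow>
       schatten_norm \<infinity>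
         (weighted_mat_sum n N p (\<lambda>i. ket_bra (w i)) - complex_of_real (1 / real n) \<cdot>\<^sub>m 1\<^sub>m n)
         \<le> 1 / real n \<longrightarrow>
       ((\<exists>\<theta>. approx_design n 4 \<infinity> \<theta> N p w \<and> \<theta> \<le> 1 / (16 * (real r)\<^sup>2)) \<or>
        (\<exists>\<theta>. approx_design n 4 1 \<theta> N p w \<and> \<theta> \<le> 1 / 4)) \<longrightarrow>
       real m \<ge> C4 * real n * real r * ln (real n) \<longrightarrow>
       measure_pmf.prob (design_sample_pmf n m N p w)
         {a. \<forall>X\<in>hermitian_mats n. vec_space.rank n X \<le> r \<longrightarrow>
              (\<forall>\<eta>\<ge>0. \<forall>\<epsilon>\<in>carrier_vec m. vec_l2_norm \<epsilon> \<le> \<eta> \<longrightarrow>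
                (\<forall>Y\<in>nuclear_norm_solutions n m a (meas_map n m a X + \<epsilon>) \<eta>.
                   schatten_norm 2 (X - Y) \<le> C6 * \<eta> / sqrt (real m)))}
       \<ge> 1 - exp (- C5 * real m))"
proof -
  \<comment> \<open>The value of \<beta> is the bound of \<open>small_ball\<close>. The expectation
    of \<open>dev\<close> and its fluctuation may each cost \<open>\<delta> * m\<close>, together
    half of \<open>\<beta> * m\<close>.\<close>
  define \<beta> :: real where "\<beta> = 1 / 1072"
  define \<delta> :: real where "\<delta> = \<beta> / 4"
  \<comment> \<open>The number 34560 is 240 * 24 * 3 * 2: from the hypothesis of
    \<open>expected_dev\<close>, the definition of \<open>D\<close>, and the bounds on
    \<open>P\<close> and \<open>c\<close>. \<open>C5\<close> is the rate of
    \<open>bounded_differences_tail\<close> at \<delta>, and \<open>C6\<close> is the constant of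
    \<open>recovery_from_cone_bound\<close> for the lower bound \<open>\<beta> / 2\<close>.\<close>
  define C4 C5 C6 :: real where "C4 = 34560 / \<delta>\<^sup>2" and "C5 = \<delta>\<^sup>2 / 4" and "C6 = 4 / \<beta>"
  have \<beta>0: "0 < \<beta>" and \<delta>0: "0 < \<delta>" "\<delta> \<le> 1" by (simp_all add: \<beta>_def \<delta>_def)
  show ?thesis
  proof (rule exI[of _ C4], rule exI[of _ C5], rule exI[of _ C6], intro conjI allI impI)
    show "C4 > 0" "C5 > 0" "C6 > 0" using \<beta>0 \<delta>0 by (simp_all add: C4_def C5_def C6_def)
    fix n r N :: nat and p :: "nat \<Rightarrow> real" and w :: "nat \<Rightarrow> complex vec" and m :: nat
    assume n: "2 \<le> n" and r: "1 \<le> r" and "r \<le> n" and wuv: "weighted_unit_vectors n N p w"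
      and le: "schatten_norm \<infinity> (weighted_mat_sum n N p (\<lambda>i. ket_bra (w i)) - complex_of_real (1 / real n) \<cdot>\<^sub>m 1\<^sub>m n) \<le> 1 / real n"
      and d: "(\<exists>\<theta>. approx_design n 4 \<infinity> \<theta> N p w \<and> \<theta> \<le> 1 / (16 * (real r)\<^sup>2)) \<or> (\<exists>\<theta>. approx_design n 4 1 \<theta> N p w \<and> \<theta> \<le> 1 / 4)"
      and m: "C4 * real n * real r * ln (real n) \<le> real m"
    obtain P where Pn: "0 < P" "real n \<le> 3 ^ P" "real P \<le> 3 * ln (real n)" using exponent_exists[OF n] .
    have ln0: "0 < ln (real n)" using n by simp
    have "0 < C4 * real n * real r * ln (real n)" using \<delta>0 n r ln0 by (simp add: C4_def)
    then have m0: "0 < m" using m by linarith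
    have weights: "weights {..<N} p" using wuv by (auto simp: weighted_unit_vectors_def weights_def)
    have wc: "w i \<in> carrier_vec n" "sqn n (coords (w i)) = 1" if "i < N" for i
      using wuv that vec_l2_norm_eq_1 by (auto simp: weighted_unit_vectors_def)
    interpret frame_sampling n N m P p "\<lambda>i. coords (w i)"
      by unfold_locales (use n m0 Pn weights wc frame_upper_bound[OF wuv le] in auto)
    have D: "240 * real r * D \<le> \<delta>\<^sup>2 * real m"
    proof -
      have "D \<le> 24 * (3 * ln (real n)) * (2 * real n)"
        unfolding D_def using Pn c_bounds ln0 by (intro mult_mono) auto
      then have "240 * real r * D \<le> 240 * real r * (24 * (3 * ln (real n)) * (2 * real n))" by (intro mult_left_mono) auto
      also have "\<dots> = \<delta>\<^sup>2 * (C4 * real n * real r * ln (real n))" using \<delta>0 by (simp add: C4_def)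
      also have "\<dots> \<le> \<delta>\<^sup>2 * real m" using m by (intro mult_left_mono) auto
      finally show ?thesis .
    qed
    let ?E = "expect {..<N} p m (dev r)"
    let ?S = "{a. \<forall>X\<in>hermitian_mats n. vec_space.rank n X \<le> r \<longrightarrow>
              (\<forall>\<eta>\<ge>0. \<forall>\<epsilon>\<in>carrier_vec m. vec_l2_norm \<epsilon> \<le> \<eta> \<longrightarrow>
                (\<forall>Y\<in>nuclear_norm_solutions n m a (meas_map n m a X + \<epsilon>) \<eta>.
                   schatten_norm 2 (X - Y) \<le> C6 * \<eta> / sqrt (real m)))}"
    have "1 - exp (- C5 * real m) \<le> 1 - expect {..<N} p m (\<lambda>xs. if dev r xs \<ge> ?E + \<delta> * real m then 1 else 0)"
      using bounded_differences_tail[of "{..<N}" p \<delta> "dev r" m, OF weights _ \<delta>0(2) dev_bounded_difference[OF r]] \<delta>0 by (simp add: C5_def)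
    also have "\<dots> \<le> measure_pmf.prob (design_sample_pmf n m N p w) ?S"
    proof (rule design_sample_prob_ge[OF weights])
      fix a assume a: "\<And>j. j < m \<Longrightarrow> a j < N" and nd: "\<not> dev r (map a (rev [0..<m])) \<ge> ?E + \<delta> * real m"
      define b where "b j = (if a j < N then w (a j) else 0\<^sub>v n)" for j
      have bc: "b j \<in> carrier_vec n" if "j < m" for j using a[OF that] wc by (simp add: b_def)
      let ?xs = "map a (rev [0..<m])"
      have dev: "dev r ?xs \<le> \<beta> / 2 * real m"
        using nd expected_dev[OF r \<delta>0 D] by (simp add: \<delta>_def)
      have lower: "real m * (\<beta> / 2)\<^sup>2 \<le> (\<Sum>j<m. (sqrt (real n * (real n + 1)) * qf n Z (coords (b j)))\<^sup>2)" if Z: "Z \<in> cone n r" for Z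
      proof -
        obtain u l where l: "eigsys n Z u l" "(\<Sum>k<n. (l k)\<^sup>2) = 1" "(\<Sum>k<n. \<bar>l k\<bar>)\<^sup>2 \<le> 6 * real r" using Z by (auto simp: cone_def)
        have "\<beta> \<le> (\<Sum>i<N. p i * min \<bar>c * qf n Z (coords (w i))\<bar> 1)"
          unfolding \<beta>_def c_def by (rule small_ball[OF d wuv n r l])
        then have "real m * (\<beta> / 2)\<^sup>2 \<le> (\<Sum>i\<leftarrow>?xs. (c * qf n Z (coords (w i)))\<^sup>2)"
          using \<beta>0 dev by (intro cone_lower_bound[OF Z]) auto
        also have "\<dots> = (\<Sum>j<m. (c * qf n Z (coords (w (a j))))\<^sup>2)"
          using sum_list_distinct_conv_sum_set[of "rev [0..<m]" "\<lambda>j. (c * qf n Z (coords (w (a j))))\<^sup>2"]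
          by (simp add: comp_def atLeast0LessThan)
        also have "\<dots> = (\<Sum>j<m. (sqrt (real n * (real n + 1)) * qf n Z (coords (b j)))\<^sup>2)"
          using a by (intro sum.cong refl) (simp add: b_def c_def)
        finally show ?thesis .
      qed
      have "schatten_norm 2 (X - Y) \<le> 2 / (\<beta> / 2) * \<eta> / sqrt (real m)"
        if "X \<in> hermitian_mats n" "vec_space.rank n X \<le> r" "\<epsilon> \<in> carrier_vec m" "vec_l2_norm \<epsilon> \<le> \<eta>"
          "Y \<in> nuclear_norm_solutions n m b (meas_map n m b X + \<epsilon>) \<eta>" for X \<eta> \<epsilon> Y
        using that \<beta>0 by (intro recovery_from_cone_bound[OF bc m0 _ lower]) auto
      then show "(\<lambda>j. if a j < N then w (a j) else 0\<^sub>v n) \<in> ?S" unfolding b_def[symmetric] by (simp add: C6_def)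
    qed
    finally show "1 - exp (- C5 * real m) \<le> measure_pmf.prob (design_sample_pmf n m N p w) ?S" .
  qed
qed

end
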